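(* For each dimension $d$ there exists a constant $c(d)$ depending only on $d$ such that, for every $\varepsilon>0$ and all bounded Lipschitz domains $\Omega,\widetilde\Omega\subset\mathbb{R}^d$ that are $\varepsilon$-close in Lipschitz norm, $$\big|\beta(\Omega)-\beta(\widetilde\Omega)\big|\le c(d)\,\varepsilon .$$
   Context: A domain is a nonempty connected open set. Let $\mathcal I_d$ be the identity matrix in $\mathbb{R}^d$ and $\mathcal E_d$ the space of endomorphisms of $\mathbb{R}^d$ with the operator norm subordinate to the Euclidean norm. Two bounded Lipschitz domains $\Omega,\widetilde\Omega\subset\mathbb{R}^d$ are called $\varepsilon$-close in Lipschitz norm if there exists a (Lipschitz) diffeomorphism $\mathcal F$ from $\widetilde\Omega$ onto $\Omega$, i.e. a bijection such that $\mathcal F$ and $\mathcal F^{-1}$ are Lipschitz, satisfying $$\mathcal F\in W^{1,\infty}(\widetilde\Omega)^d,\quad \|D\mathcal F-\mathcal I_d\|_{L^\infty(\widetilde\Omega;\mathcal E_d)}\le\varepsilon,\qquad \mathcal F^{-1}\in W^{1,\infty}(\Omega)^d,\quad \|D\mathcal F^{-1}-\mathcal I_d\|_{L^\infty(\Omega;\mathcal E_d)}\le\varepsilon .$$ $L^2_\circ(\Omega)$ is the space of functions in $L^2(\Omega)$ with mean value zero; $\langle\cdot,\cdot\rangle_\Omega$ and $\|\cdot\|_{0,\Omega}$ are the $L^2(\Omega)$ scalar product and norm; for $\mathbf v\in H^1_0(\Omega)^d$, $|\mathbf v|_{1,\Omega}=\|\nabla\mathbf v\|_{0,\Omega}=\big(\sum_{k,j=1}^d\|\partial_{x_j}v_k\|_{0,\Omega}^2\big)^{1/2}$.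 The inf-sup (LBB) constant of a domain $\Omega$ is $$\beta(\Omega)=\inf_{q\in L^2_\circ(\Omega)}\ \sup_{\mathbf v\in H^1_0(\Omega)^d}\frac{\langle \operatorname{div}\mathbf v,q\rangle_\Omega}{|\mathbf v|_{1,\Omega}\,\|q\|_{0,\Omega}},$$ with infimum and supremum over nonzero elements. *)

theory Defs
  imports "HOL-Analysis.Analysis" "HOL-Probability.Essential_Supremum"
begin

text \<open>
  Elements of the Lebesgue and Sobolev spaces are represented by functions on the whole
  space of which only the restriction to the open set \<open>\<Omega>\<close> matters: integrals and null sets
  are taken with respect to \<open>lebesgue_on \<Omega>\<close>. Functions are not identified almost everywhere,
  so a nonzero element is a function that is not almost everywhere zero on \<open>\<Omega>\<close>.
\<close>

section \<open>Bounded Lipschitz domains\<close>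

definition is_domain :: "'a::topological_space set \<Rightarrow> bool" where
  "is_domain \<Omega> \<longleftrightarrow> open \<Omega> \<and> connected \<Omega> \<and> \<Omega> \<noteq> {}"

text \<open>
  Near each boundary point, \<open>\<Omega>\<close> is the strict epigraph of a Lipschitz function in suitable
  orthonormal coordinates. The unit vector \<open>e\<close> is the last coordinate axis, and its orthogonal
  hyperplane plays the role of \<open>\<real>\<^sup>d\<^sup>-\<^sup>1\<close>, so that \<open>y - (y \<bullet> e) *\<^sub>R e\<close> stands for the
  first \<open>d - 1\<close> coordinates of \<open>y\<close>.
\<close>

definition lipschitz_boundary :: "'a::euclidean_space set \<Rightarrow> bool" where
  "lipschitz_boundary \<Omega> \<longleftrightarrow>
     (\<forall>x\<in>frontier \<Omega>. \<exists>r>0. \<exists>e C. \<exists>\<gamma> :: 'a \<Rightarrow> real.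
        norm e = 1 \<and> lipschitz_on C {z. z \<bullet> e = 0} \<gamma> \<and>
        \<Omega> \<inter> ball x r = {y \<in> ball x r. y \<bullet> e > \<gamma> (y - (y \<bullet> e) *\<^sub>R e)})"

definition bounded_lipschitz_domain :: "'a::euclidean_space set \<Rightarrow> bool" where
  "bounded_lipschitz_domain \<Omega> \<longleftrightarrow> is_domain \<Omega> \<and> bounded \<Omega> \<and> lipschitz_boundary \<Omega>"

section \<open>Test functions and weak derivatives\<close>

definition partial_deriv :: "'n::finite \<Rightarrow> (real^'n \<Rightarrow> real) \<Rightarrow> real^'n \<Rightarrow> real" where
  "partial_deriv i f x = frechet_derivative f (at x) (axis i 1)"

fun C_k :: "nat \<Rightarrow> (real^'n::finite \<Rightarrow> real) \<Rightarrow> bool" where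
  "C_k 0 f \<longleftrightarrow> continuous_on UNIV f"
| "C_k (Suc k) f \<longleftrightarrow> (\<forall>x. f differentiable at x) \<and> (\<forall>i. C_k k (partial_deriv i f))"

definition test_function :: "(real^'n::finite) set \<Rightarrow> (real^'n \<Rightarrow> real) \<Rightarrow> bool" where
  "test_function \<Omega> \<phi> \<longleftrightarrow>
     (\<forall>k. C_k k \<phi>) \<and> compact (closure {x. \<phi> x \<noteq> 0}) \<and> closure {x. \<phi> x \<noteq> 0} \<subseteq> \<Omega>"

definition locally_integrable :: "(real^'n::finite) set \<Rightarrow> (real^'n \<Rightarrow> real) \<Rightarrow> bool" where
  "locally_integrable \<Omega> u \<longleftrightarrow> (\<forall>K. compact K \<and> K \<subseteq> \<Omega> \<longrightarrow> integrable (lebesgue_on K) u)"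

definition has_weak_partial ::
  "(real^'n::finite) set \<Rightarrow> 'n \<Rightarrow> (real^'n \<Rightarrow> real) \<Rightarrow> (real^'n \<Rightarrow> real) \<Rightarrow> bool" where
  "has_weak_partial \<Omega> i u g \<longleftrightarrow>
     locally_integrable \<Omega> u \<and> locally_integrable \<Omega> g \<and>
     (\<forall>\<phi>. test_function \<Omega> \<phi> \<longrightarrow>
        integral\<^sup>L (lebesgue_on \<Omega>) (\<lambda>x. u x * partial_deriv i \<phi> x)
        = - integral\<^sup>L (lebesgue_on \<Omega>) (\<lambda>x. g x * \<phi> x))"

text \<open>
  The choice is unique up to null sets. It is only used for functions that have a weak
  derivative.
\<close>

definition weak_partial ::
  "(real^'n::finite) set \<Rightarrow> 'n \<Rightarrow> (real^'n \<Rightarrow> real) \<Rightarrow> real^'n \<Rightarrow> real" where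
  "weak_partial \<Omega> i u = (SOME g. has_weak_partial \<Omega> i u g)"

section \<open>Lebesgue and Sobolev spaces\<close>

definition L2 :: "(real^'n::finite) set \<Rightarrow> (real^'n \<Rightarrow> real) set" where
  "L2 \<Omega> = {u. u \<in> borel_measurable (lebesgue_on \<Omega>) \<and> integrable (lebesgue_on \<Omega>) (\<lambda>x. (u x)\<^sup>2)}"

definition L2_inner :: "(real^'n::finite) set \<Rightarrow> (real^'n \<Rightarrow> real) \<Rightarrow> (real^'n \<Rightarrow> real) \<Rightarrow> real" where
  "L2_inner \<Omega> u w = integral\<^sup>L (lebesgue_on \<Omega>) (\<lambda>x. u x * w x)"

definition L2_norm :: "(real^'n::finite) set \<Rightarrow> (real^'n \<Rightarrow> real) \<Rightarrow> real" where
  "L2_norm \<Omega> u = sqrt (L2_inner \<Omega> u u)"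

definition L2_mean_zero :: "(real^'n::finite) set \<Rightarrow> (real^'n \<Rightarrow> real) set" where
  "L2_mean_zero \<Omega> = {q \<in> L2 \<Omega>. integral\<^sup>L (lebesgue_on \<Omega>) q = 0}"

definition H1 :: "(real^'n::finite) set \<Rightarrow> (real^'n \<Rightarrow> real) set" where
  "H1 \<Omega> = {u \<in> L2 \<Omega>. \<forall>i. \<exists>g \<in> L2 \<Omega>. has_weak_partial \<Omega> i u g}"

definition H1_norm :: "(real^'n::finite) set \<Rightarrow> (real^'n \<Rightarrow> real) \<Rightarrow> real" where
  "H1_norm \<Omega> u = sqrt ((L2_norm \<Omega> u)\<^sup>2 + (\<Sum>i\<in>UNIV. (L2_norm \<Omega> (weak_partial \<Omega> i u))\<^sup>2))"

text \<open>The closure of the test functions in \<open>H1 \<Omega>\<close>.\<close>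

definition H10 :: "(real^'n::finite) set \<Rightarrow> (real^'n \<Rightarrow> real) set" where
  "H10 \<Omega> = {u \<in> H1 \<Omega>. \<exists>\<phi>. (\<forall>n::nat. test_function \<Omega> (\<phi> n)) \<and>
                 (\<lambda>n. H1_norm \<Omega> (\<lambda>x. u x - \<phi> n x)) \<longlonglongrightarrow> 0}"

definition H10_vec :: "(real^'n::finite) set \<Rightarrow> (real^'n \<Rightarrow> real^'n) set" where
  "H10_vec \<Omega> = {v. \<forall>k. (\<lambda>x. v x $ k) \<in> H10 \<Omega>}"

definition Linfty :: "(real^'n::finite) set \<Rightarrow> (real^'n \<Rightarrow> real) set" where
  "Linfty \<Omega> = {u. u \<in> borel_measurable (lebesgue_on \<Omega>) \<and>
                  esssup (lebesgue_on \<Omega>) (\<lambda>x. ereal \<bar>u x\<bar>) < \<infinity>}"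

definition W1infty :: "(real^'n::finite) set \<Rightarrow> (real^'n \<Rightarrow> real) set" where
  "W1infty \<Omega> = {u \<in> Linfty \<Omega>. \<forall>i. \<exists>g \<in> Linfty \<Omega>. has_weak_partial \<Omega> i u g}"

definition W1infty_vec :: "(real^'n::finite) set \<Rightarrow> (real^'n \<Rightarrow> real^'n) set" where
  "W1infty_vec \<Omega> = {F. \<forall>k. (\<lambda>x. F x $ k) \<in> W1infty \<Omega>}"

definition weak_jacobian ::
  "(real^'n::finite) set \<Rightarrow> (real^'n \<Rightarrow> real^'n) \<Rightarrow> real^'n \<Rightarrow> real^'n^'n" where
  "weak_jacobian \<Omega> F x = (\<chi> k j. weak_partial \<Omega> j (\<lambda>y. F y $ k) x)"

text \<open>The norm of \<open>L\<^sup>\<infinity>(\<Omega>; \<E>\<^sub>d)\<close>; \<open>onorm\<close> is subordinate to the Euclidean norm of \<open>real^'n\<close>.\<close>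

definition Linfty_op_norm :: "(real^'n::finite) set \<Rightarrow> (real^'n \<Rightarrow> real^'n^'n) \<Rightarrow> ereal" where
  "Linfty_op_norm \<Omega> A = esssup (lebesgue_on \<Omega>) (\<lambda>x. ereal (onorm ((*v) (A x))))"

section \<open>Closeness in Lipschitz norm\<close>

definition lipschitz_close ::
  "real \<Rightarrow> (real^'n::finite) set \<Rightarrow> (real^'n) set \<Rightarrow> bool" where
  "lipschitz_close \<epsilon> \<Omega> \<Omega>' \<longleftrightarrow>
     (\<exists>F G. bij_betw F \<Omega>' \<Omega> \<and> G = inv_into \<Omega>' F \<and>
        (\<exists>C. lipschitz_on C \<Omega>' F) \<and> (\<exists>C. lipschitz_on C \<Omega> G) \<and>
        F \<in> W1infty_vec \<Omega>' \<and> Linfty_op_norm \<Omega>' (\<lambda>x. weak_jacobian \<Omega>' F x - mat 1) \<le> ereal \<epsilon> \<and>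
        G \<in> W1infty_vec \<Omega> \<and> Linfty_op_norm \<Omega> (\<lambda>x. weak_jacobian \<Omega> G x - mat 1) \<le> ereal \<epsilon>)"

section \<open>The inf-sup constant\<close>

definition weak_div :: "(real^'n::finite) set \<Rightarrow> (real^'n \<Rightarrow> real^'n) \<Rightarrow> real^'n \<Rightarrow> real" where
  "weak_div \<Omega> v x = (\<Sum>k\<in>UNIV. weak_partial \<Omega> k (\<lambda>y. v y $ k) x)"

definition H1_seminorm :: "(real^'n::finite) set \<Rightarrow> (real^'n \<Rightarrow> real^'n) \<Rightarrow> real" where
  "H1_seminorm \<Omega> v =
     sqrt (\<Sum>k\<in>UNIV. \<Sum>j\<in>UNIV. (L2_norm \<Omega> (weak_partial \<Omega> j (\<lambda>y. v y $ k)))\<^sup>2)"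

text \<open>
  Infimum and supremum are those of the conditionally complete lattice of reals. They are
  genuine for a bounded domain: the index sets are nonempty, the quotients are bounded
  by \<open>sqrt d\<close> in absolute value, and the denominators are positive by the Poincare inequality.
\<close>

definition inf_sup_constant :: "(real^'n::finite) set \<Rightarrow> real" where
  "inf_sup_constant \<Omega> =
     (INF q \<in> {q \<in> L2_mean_zero \<Omega>. \<not> (AE x in lebesgue_on \<Omega>. q x = 0)}.
      SUP v \<in> {v \<in> H10_vec \<Omega>. \<not> (AE x in lebesgue_on \<Omega>. v x = 0)}.
        L2_inner \<Omega> (weak_div \<Omega> v) q / (H1_seminorm \<Omega> v * L2_norm \<Omega> q))"

end

theory Submission
  imports Defs
begin

text \<open>
  A map \<open>F\<close> from \<open>U\<close> onto \<open>V\<close> that is close to the identity in Lipschitz norm transports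
  velocities by \<open>v \<mapsto> v \<circ> F\<close> and pressures on \<open>U\<close> by \<open>q \<mapsto> (q / J) \<circ> F\<^sup>-\<^sup>1\<close>, where \<open>J\<close> is the
  density on \<open>U\<close> of the image of the Lebesgue measure of \<open>V\<close>. The second map preserves the mean
  value, and \<open>\<langle>div v, q\<rangle>\<close> on \<open>V\<close> becomes \<open>\<langle>(div v) \<circ> F, q\<rangle>\<close> on \<open>U\<close>, which differs from
  \<open>\<langle>div (v \<circ> F), q\<rangle>\<close> by \<open>O(\<epsilon>)\<close> because of the chain rule. All norms change by factors \<open>1 + O(\<epsilon>)\<close>,
  so the suprema differ by \<open>O(\<epsilon>)\<close>, and exchanging the roles of \<open>U\<close> and \<open>V\<close> bounds the difference
  of the infima. For \<open>\<epsilon> > 1\<close> the quotients are bounded by the dimension anyway.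

  Rademacher's theorem and the area formula are avoided. Mollifying \<open>F\<close> shows that it is
  \<open>(1 + \<epsilon>)\<close>-Lipschitz on balls; by the Vitali covering theorem it then expands volumes by at most
  \<open>(1 + \<epsilon>)\<^sup>d\<close>, and so does its inverse, which bounds the Radon-Nikodym density \<open>J\<close> from both sides.
  The chain rule for \<open>\<phi> \<circ> F\<close> with a test function \<open>\<phi>\<close> is also obtained by mollifying \<open>F\<close>.
\<close>

section \<open>Smooth functions and mollifiers\<close>

text \<open>Two obstacles shape the argument. A domain need not be convex, so the bound on the
  Jacobian controls increments of \<open>F\<close> only along segments inside \<open>U\<close>. This
  is why the Lipschitz estimate lives on balls, and why the quantity derived from it is volume,
  which can be summed over small balls. Moreover \<open>\<phi> \<circ> F\<close> with a test
  function \<open>\<phi>\<close> is merely Lipschitz, so composition does not visibly respect the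
  closure that defines \<open>H10\<close>. It is mollified a second time; there is room for this
  because its support lies in the compact image under \<open>G\<close> of the support of
  \<open>\<phi>\<close>.

  The transports run in opposite directions, velocities from \<open>V\<close> to \<open>U\<close>
  and pressures from \<open>U\<close> to \<open>V\<close>. Hence the supremum on \<open>U\<close> at
  \<open>q\<close> controls every quotient on \<open>V\<close> at the transported pressure, and the
  infimum over \<open>q\<close> yields one inequality between the two constants.

  With \<open>n\<close> the dimension, the final constant is \<open>(n + n^2 (n + 1)) 4^n\<close>:
  quotients are at most \<open>n\<close>, the chain rule costs \<open>n^2 \<epsilon>\<close>, and
  the two norms in the denominator cost \<open>(1 + \<epsilon>)^(2 n)\<close>, which is at most
  \<open>1 + 4^n \<epsilon>\<close> for \<open>\<epsilon> \<le> 1\<close>.\<close>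

lemma partial_deriv_eq:
  "(f has_derivative f') (at x) \<Longrightarrow> partial_deriv i f x = f' (axis i 1)"
  unfolding partial_deriv_def using frechet_derivative_at by metis

lemma partial_deriv_has_derivative:
  fixes f :: "real^'n::finite \<Rightarrow> real"
  assumes "f differentiable at x"
  shows "(f has_derivative (\<lambda>h. \<Sum>i\<in>UNIV. h $ i * partial_deriv i f x)) (at x)"
proof -
  obtain f' where f': "(f has_derivative f') (at x)"
    using assms unfolding differentiable_def by blast
  then have lin: "linear f'" by (rule has_derivative_linear)
  have "f' h = (\<Sum>i\<in>UNIV. h $ i * partial_deriv i f x)" for h
  proof -
    have "f' h = f' (\<Sum>i\<in>UNIV. h $ i *\<^sub>R axis i 1)"
      using basis_expansion[of h] by (simp add: scalar_mult_eq_scaleR)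
    also have "\<dots> = (\<Sum>i\<in>UNIV. h $ i * f' (axis i 1))"
      by (simp add: linear_sum[OF lin] linear_cmul[OF lin])
    finally show ?thesis by (simp add: partial_deriv_eq[OF f'])
  qed
  then have "f' = (\<lambda>h. \<Sum>i\<in>UNIV. h $ i * partial_deriv i f x)" by auto
  with f' show ?thesis by simp
qed

lemma C_k_SucD: "C_k (Suc k) f \<Longrightarrow> C_k k f"
proof (induction k arbitrary: f)
  case 0
  then show ?case
    by (auto intro!: differentiable_imp_continuous_within simp: continuous_on_eq_continuous_within)
next
  case (Suc k)
  then show ?case by simp
qed

lemma C_k_continuous: "C_k k f \<Longrightarrow> continuous_on S f"
  by (induction k) (auto simp del: C_k.simps(2) intro: C_k_SucD continuous_on_subset)

lemma C_k_const: "C_k k (\<lambda>x. c)"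
proof (induction k arbitrary: c)
  case (Suc k)
  have "partial_deriv i (\<lambda>x. c) = (\<lambda>x::real^'a. 0)" for i
    by (rule ext) (auto intro!: partial_deriv_eq[THEN trans] derivative_eq_intros)
  then show ?case using Suc by simp
qed simp

lemma C_k_nth: "C_k k (\<lambda>x. x $ i)"
proof (cases k)
  case (Suc k)
  have hd: "((\<lambda>x::real^'a. x $ i) has_derivative (\<lambda>h. h $ i)) (at x)" for x
    by (rule bounded_linear_imp_has_derivative) (rule bounded_linear_vec_nth)
  have "partial_deriv j (\<lambda>x. x $ i) = (\<lambda>x::real^'a. axis j 1 $ i)" for j
    by (rule ext) (rule partial_deriv_eq[OF hd])
  then show ?thesis using Suc hd by (auto simp: C_k_const differentiable_def)
qed (auto intro: continuous_intros)

lemma sum_axis_mult: "(\<Sum>j\<in>UNIV. axis i 1 $ j * f j) = (f i :: real)"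
  by (simp add: axis_def if_distrib[of "\<lambda>a. a * _"] cong: if_cong)

lemma partial_deriv_add:
  fixes f g :: "real^'n::finite \<Rightarrow> real"
  assumes "f differentiable at x" "g differentiable at x"
  shows "partial_deriv i (\<lambda>x. f x + g x) x = partial_deriv i f x + partial_deriv i g x"
  using has_derivative_add[OF partial_deriv_has_derivative[OF assms(1)] partial_deriv_has_derivative[OF assms(2)]]
  by (rule partial_deriv_eq[THEN trans]) (simp add: sum_axis_mult)

lemma partial_deriv_mult:
  fixes f g :: "real^'n::finite \<Rightarrow> real"
  assumes "f differentiable at x" "g differentiable at x"
  shows "partial_deriv i (\<lambda>x. f x * g x) x = f x * partial_deriv i g x + partial_deriv i f x * g x"
  using has_derivative_mult[OF partial_deriv_has_derivative[OF assms(1)] partial_deriv_has_derivative[OF assms(2)]]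
  by (rule partial_deriv_eq[THEN trans]) (simp add: sum_axis_mult)

lemma C_k_add:
  assumes "C_k k f" "C_k k g" shows "C_k k (\<lambda>x. f x + g x)"
  using assms
proof (induction k arbitrary: f g)
  case (Suc k)
  then have d: "\<And>x. f differentiable at x" "\<And>x. g differentiable at x" by auto
  have "partial_deriv i (\<lambda>x. f x + g x) = (\<lambda>x. partial_deriv i f x + partial_deriv i g x)" for i
    by (rule ext) (rule partial_deriv_add[OF d])
  then show ?case using Suc d by auto
qed (auto intro: continuous_intros)

lemma C_k_mult:
  assumes "C_k k f" "C_k k g" shows "C_k k (\<lambda>x. f x * g x)"
  using assms
proof (induction k arbitrary: f g)
  case (Suc k)
  then have d: "\<And>x. f differentiable at x" "\<And>x. g differentiable at x" by auto
  have "partial_deriv i (\<lambda>x. f x * g x) = (\<lambda>x. f x * partial_deriv i g x + partial_deriv i f x * g x)" for i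
    by (rule ext) (rule partial_deriv_mult[OF d])
  moreover have "C_k k f" "C_k k g" using Suc.prems C_k_SucD by blast+
  ultimately show ?case using Suc d by (auto intro!: C_k_add)
qed (auto intro: continuous_intros)

lemma C_k_sum: "(\<And>i. i \<in> I \<Longrightarrow> C_k k (f i)) \<Longrightarrow> C_k k (\<lambda>x. \<Sum>i\<in>I. f i x)"
  by (induction I rule: infinite_finite_induct) (auto intro!: C_k_const C_k_add)

lemma partial_deriv_affine:
  fixes f :: "real^'n::finite \<Rightarrow> real"
  assumes "f differentiable at (a *\<^sub>R x + b)"
  shows "partial_deriv i (\<lambda>x. f (a *\<^sub>R x + b)) x = a * partial_deriv i f (a *\<^sub>R x + b)"
proof -
  obtain f' where f': "(f has_derivative f') (at (a *\<^sub>R x + b))"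
    using assms unfolding differentiable_def by blast
  have "((\<lambda>x. f (a *\<^sub>R x + b)) has_derivative (\<lambda>h. f' (a *\<^sub>R h))) (at x)"
    by (rule has_derivative_compose[where f="\<lambda>x. a *\<^sub>R x + b", OF _ f']) (auto intro!: derivative_eq_intros)
  from partial_deriv_eq[OF this] partial_deriv_eq[OF f'] show ?thesis
    by (simp add: linear_cmul[OF has_derivative_linear[OF f']])
qed

text \<open>Serves to scale a bump function to radius \<open>r\<close>, to translate it, and with
  \<open>a = -1\<close> to turn a mollifier into the test function
  \<open>y \<mapsto> \<rho> (x - y)\<close>.\<close>

lemma C_k_affine:
  fixes f :: "real^'n::finite \<Rightarrow> real"
  assumes "C_k k f" shows "C_k k (\<lambda>x. f (a *\<^sub>R x + b))"
  using assms
proof (induction k arbitrary: f)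
  case 0
  then show ?case
    by (auto intro!: continuous_on_compose2[of UNIV f UNIV] continuous_intros)
next
  case (Suc k)
  then have d: "\<And>x. f differentiable at x" by auto
  have "(\<lambda>x. f (a *\<^sub>R x + b)) differentiable at x" for x
    by (rule differentiable_compose[where f=f]) (auto simp: d intro!: derivative_intros)
  moreover have "partial_deriv i (\<lambda>x. f (a *\<^sub>R x + b)) = (\<lambda>x. a * partial_deriv i f (a *\<^sub>R x + b))" for i
    by (rule ext) (rule partial_deriv_affine[OF d])
  ultimately show ?case using Suc by (auto intro!: C_k_mult C_k_const)
qed

section \<open>Smooth bump functions and mollifiers\<close>

text \<open>The power in the denominator closes the family under differentiation: the derivative of
  a member is a linear combination of members with larger \<open>m\<close>.\<close>

definition flat_exp :: "nat \<Rightarrow> real \<Rightarrow> real" where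
  "flat_exp m t = (if t > 0 then exp (- (1 / t)) / t ^ m else 0)"

text \<open>In the variable \<open>s = 1/t\<close> the limit from the right is that of
  \<open>s ^ m / exp s\<close> at infinity; from the left the function is zero.\<close>

lemma flat_exp_tendsto: "(flat_exp m \<longlongrightarrow> 0) (at 0)"
proof -
  have "((\<lambda>t::real. (1/t) ^ m / exp (1/t)) \<longlongrightarrow> 0) (at_right 0)"
    by (rule filterlim_compose[OF tendsto_power_div_exp_0])
       (simp add: filterlim_inverse_at_top_right flip: inverse_eq_divide)
  then have "(flat_exp m \<longlongrightarrow> 0) (at_right 0)"
    by (rule Lim_transform_eventually)
       (auto simp: flat_exp_def eventually_at_filter exp_minus field_simps)
  moreover have "(flat_exp m \<longlongrightarrow> 0) (at_left 0)"
    by (rule Lim_transform_eventually[of "\<lambda>_. 0"]) (auto simp: flat_exp_def eventually_at_filter)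
  ultimately show ?thesis by (simp add: filterlim_at_split)
qed

lemma flat_exp_has_derivative:
  "(flat_exp m has_real_derivative (flat_exp (m + 2) t - real m * flat_exp (m + 1) t)) (at t)"
proof -
  consider "t > 0" | "t < 0" | "t = 0" by linarith
  then show ?thesis
  proof cases
    case 1
    have i: "(inverse has_real_derivative - (inverse t ^ 2)) (at t)"
      using DERIV_inverse[of t UNIV] 1 by (simp add: power2_eq_square)
    have e: "((\<lambda>t. exp (- inverse t)) has_real_derivative exp (- inverse t) * inverse t ^ 2) (at t)"
      using DERIV_fun_exp[OF DERIV_minus[OF i]] by simp
    \<comment> \<open>The power rule produces the exponent \<open>m - Suc 0\<close>. For
      \<open>m = 0\<close> the truncated subtraction is harmless because the factor
      \<open>real m\<close> vanishes.\<close>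
    have "real m * (- (inverse t ^ 2) * inverse t ^ (m - Suc 0)) = - real m * inverse t ^ (m + 1)"
      by (cases m) (simp_all add: power2_eq_square algebra_simps)
    then have p: "((\<lambda>t. inverse t ^ m) has_real_derivative - real m * inverse t ^ (m + 1)) (at t)"
      using DERIV_power[OF i, of m] by (simp only:)
    have fe: "flat_exp k s = exp (- inverse s) * inverse s ^ k" if "s > 0" for k s
      using that by (simp add: flat_exp_def divide_inverse power_inverse)
    have "exp (- inverse t) * inverse t ^ 2 * inverse t ^ m + - real m * inverse t ^ (m + 1) * exp (- inverse t)
       = flat_exp (m + 2) t - real m * flat_exp (m + 1) t"
      unfolding fe[OF 1] by (simp add: power_add power2_eq_square algebra_simps)
    then have "((\<lambda>t. exp (- inverse t) * inverse t ^ m) has_real_derivative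
       (flat_exp (m + 2) t - real m * flat_exp (m + 1) t)) (at t)"
      using DERIV_mult[OF e p] by (simp only:)
    then show ?thesis
      by (rule has_field_derivative_transform_within_open[of _ _ _ "{0<..}"])
         (use 1 fe in force)+
  next
    case 2
    have "((\<lambda>t. 0) has_real_derivative 0) (at t)" by simp
    then have "(flat_exp m has_real_derivative 0) (at t)"
      by (rule has_field_derivative_transform_within_open[of _ _ _ "{..<0}"])
         (use 2 in \<open>auto simp: flat_exp_def\<close>)
    with 2 show ?thesis by (simp add: flat_exp_def)
  next
    case 3
    \<comment> \<open>At the origin the difference quotient of \<open>flat_exp m\<close> is
      \<open>flat_exp (Suc m)\<close> itself, whose limit is known.\<close>
    have "((\<lambda>h. (flat_exp m (0 + h) - flat_exp m 0) / h) \<longlongrightarrow> 0) (at 0)"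
      by (rule Lim_transform_eventually[OF flat_exp_tendsto[of "Suc m"]])
         (auto simp: flat_exp_def eventually_at_filter)
    with 3 show ?thesis by (simp add: DERIV_def flat_exp_def)
  qed
qed

text \<open>The induction keeps \<open>m\<close> arbitrary because differentiation leads to the
  indices \<open>m + 1\<close> and \<open>m + 2\<close>.\<close>

lemma C_k_flat_exp:
  fixes u :: "real^'n::finite \<Rightarrow> real"
  assumes u: "\<And>k. C_k k u"
  shows "C_k k (\<lambda>x. flat_exp m (u x))"
proof (induction k arbitrary: m)
  case 0
  have "isCont (flat_exp m) t" for t
    using flat_exp_has_derivative DERIV_isCont by blast
  then have "continuous_on UNIV (flat_exp m)" by (simp add: continuous_at_imp_continuous_on)
  then show ?case using C_k_continuous[OF u]
    by (auto intro!: continuous_on_compose2[of UNIV "flat_exp m" UNIV u])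
next
  case (Suc k)
  have d: "u differentiable at x" for x using u[of 1] by simp
  have hd: "((\<lambda>x. flat_exp m (u x)) has_derivative
      (\<lambda>h. (flat_exp (m + 2) (u x) - real m * flat_exp (m + 1) (u x)) * (\<Sum>i\<in>UNIV. h $ i * partial_deriv i u x))) (at x)" for x
    by (rule has_derivative_compose[OF partial_deriv_has_derivative[OF d]
       flat_exp_has_derivative[unfolded has_field_derivative_def]])
  have "partial_deriv i (\<lambda>x. flat_exp m (u x)) =
     (\<lambda>x. (flat_exp (m + 2) (u x) + (- real m) * flat_exp (m + 1) (u x)) * partial_deriv i u x)" for i
    by (rule ext, subst partial_deriv_eq[OF hd]) (simp add: sum_axis_mult)
  moreover have "C_k k (partial_deriv i u)" for i using u[of "Suc k"] by simp
  ultimately show ?case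
    using hd Suc C_k_add[OF Suc C_k_mult[OF C_k_const Suc], of "m + 2" "- real m" "m + 1"]
    by (auto intro!: C_k_mult simp: differentiable_def)
qed

lemma test_functionI:
  assumes "\<And>k. C_k k f" "\<And>x. x \<notin> K \<Longrightarrow> f x = 0" "compact K" "K \<subseteq> \<Omega>"
  shows "test_function \<Omega> f"
proof -
  have "closure {x. f x \<noteq> 0} \<subseteq> K"
    using assms by (intro closure_minimal) (auto intro: compact_imp_closed)
  moreover from this have "compact (closure {x. f x \<noteq> 0})"
    using \<open>compact K\<close> by (metis closed_closure closed_Int_compact inf.absorb_iff1)
  ultimately show ?thesis using assms by (auto simp: test_function_def)
qed

lemma bump_exists:
  obtains b :: "real^'n::finite \<Rightarrow> real" where
    "\<And>k. C_k k b" "\<And>x. b x \<ge> 0" "\<And>x. norm x < 1 \<longleftrightarrow> b x > 0"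
proof
  \<comment> \<open>The squared norm is written as a polynomial in the coordinates, hence smooth at
    the origin as well, where the norm is not differentiable.\<close>
  define b where "b x = flat_exp 0 (1 + (-1) * (\<Sum>i\<in>UNIV. x $ i * x $ i))" for x :: "real^'n"
  have b: "b x = flat_exp 0 (1 - (norm x)\<^sup>2)" for x
    by (simp add: b_def norm_vec_def L2_set_def sum_nonneg power2_eq_square)
  show "C_k k b" for k unfolding b_def
    by (intro C_k_flat_exp C_k_add C_k_mult C_k_const C_k_sum C_k_nth)
  show "b x \<ge> 0" for x by (simp add: b flat_exp_def)
  show "norm x < 1 \<longleftrightarrow> b x > 0" for x
    by (simp add: b flat_exp_def abs_square_less_1)
qed

text \<open>The radius bounds the support only from outside, so a mollifier of radius
  \<open>r\<close> is also one of every larger radius. This later allows one kernel to meet several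
  smallness conditions at once.\<close>

definition is_mollifier :: "real \<Rightarrow> (real^'n::finite \<Rightarrow> real) \<Rightarrow> bool" where
  "is_mollifier r \<rho> \<longleftrightarrow> (\<forall>k. C_k k \<rho>) \<and> (\<forall>x. \<rho> x \<ge> 0) \<and> (\<forall>x. norm x \<ge> r \<longrightarrow> \<rho> x = 0)
     \<and> integral\<^sup>L lborel \<rho> = 1"

lemma integrable_compact_support:
  fixes f :: "'a::euclidean_space \<Rightarrow> real"
  assumes "continuous_on UNIV f" "\<And>x. x \<notin> K \<Longrightarrow> f x = 0" "compact K"
  shows "integrable lborel f"
proof -
  have "integrable lborel (\<lambda>x. indicator K x *\<^sub>R f x)"
    by (rule borel_integrable_compact[OF assms(3)]) (rule continuous_on_subset[OF assms(1)], simp)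
  moreover have "(\<lambda>x. indicator K x *\<^sub>R f x) = f"
    using assms(2) by (auto simp: indicator_def of_bool_def intro!: ext)
  ultimately show ?thesis by simp
qed

lemma mollifier_exists:
  assumes "r > 0"
  obtains \<rho> :: "real^'n::finite \<Rightarrow> real" where "is_mollifier r \<rho>"
proof -
  obtain b :: "real^'n \<Rightarrow> real" where b: "\<And>k. C_k k b" "\<And>x. b x \<ge> 0" "\<And>x. norm x < 1 \<longleftrightarrow> b x > 0"
    using bump_exists by blast
  define c where "c x = b ((1/r) *\<^sub>R x + 0)" for x
  have c: "C_k k c" "c x \<ge> 0" "norm x < r \<longleftrightarrow> c x > 0" for k x
    unfolding c_def using b(2) C_k_affine[OF b(1), of k "1/r" 0] b(3)[of "(1/r) *\<^sub>R x"] assms by auto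
  have c0: "c x = 0" if "x \<notin> cball 0 r" for x
    using that c(2,3)[of x] by (metis less_eq_real_def mem_cball_0)
  have cc: "continuous_on UNIV c" using C_k_continuous c(1) by blast
  have int: "integrable lborel c" by (rule integrable_compact_support[OF cc c0 compact_cball])
  \<comment> \<open>If the integral were zero, the nonnegative \<open>c\<close> would vanish almost
    everywhere, although it is positive on a ball of positive volume.\<close>
  have pos: "integral\<^sup>L lborel c > 0"
  proof -
    have "\<not> (AE x in lborel. c x = 0)"
    proof
      assume "AE x in lborel. c x = 0"
      then have "AE x in lborel. x \<notin> ball (0::real^'n) r"
        by (rule eventually_mono) (use c(3) in force)
      then have "emeasure lborel (ball (0::real^'n) r) = 0"
        by (subst (asm) AE_iff_measurable[OF _ refl]) (auto simp: ball_def)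
      then show False using assms
        by (metis emeasure_lborel_ball_finite content_ball_pos measure_def enn2real_0 less_irrefl)
    qed
    then show ?thesis
      using integral_nonneg_eq_0_iff_AE[OF int] c(2) integral_nonneg_AE[of c lborel]
      by (auto simp: less_le)
  qed
  have "is_mollifier r (\<lambda>x. (1 / integral\<^sup>L lborel c) * c x)"
    unfolding is_mollifier_def
  proof (intro conjI allI impI)
    show "C_k k (\<lambda>x. (1 / integral\<^sup>L lborel c) * c x)" for k by (intro C_k_mult C_k_const c)
    show "(1 / integral\<^sup>L lborel c) * c x \<ge> 0" for x using c(2) pos by simp
    show "(1 / integral\<^sup>L lborel c) * c x = 0" if "r \<le> norm x" for x
      using c(2,3)[of x] that by auto
    show "(\<integral>x. (1 / integral\<^sup>L lborel c) * c x \<partial>lborel) = 1" using pos by simp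
  qed
  then show thesis by (rule that)
qed

section \<open>Uniform estimates for compactly supported functions\<close>

lemma uniformly_continuous_compact_support:
  fixes f :: "'a::euclidean_space \<Rightarrow> real"
  assumes f: "continuous_on UNIV f" "\<And>x. norm x > r \<Longrightarrow> f x = 0" and "e > 0"
  obtains d where "d > 0" "\<And>x y. norm (x - y) < d \<Longrightarrow> \<bar>f x - f y\<bar> < e"
proof -
  \<comment> \<open>With the margin 2, two points at distance less than 1 either both lie in this
    ball or both lie where \<open>f\<close> vanishes.\<close>
  have "uniformly_continuous_on (cball 0 (r + 2)) f"
    by (rule compact_uniformly_continuous) (use f(1) continuous_on_subset in auto)
  then obtain d where d: "d > 0"
    "\<And>x y. \<lbrakk>x \<in> cball 0 (r+2); y \<in> cball 0 (r+2); dist y x < d\<rbrakk> \<Longrightarrow> dist (f y) (f x) < e"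
    unfolding uniformly_continuous_on_def using \<open>e > 0\<close> by metis
  show thesis
  proof
    show "min d 1 > 0" using d by simp
    fix x y :: 'a assume xy: "norm (x - y) < min d 1"
    show "\<bar>f x - f y\<bar> < e"
    proof (cases "norm x \<le> r + 1")
      case True
      moreover have "norm y \<le> norm x + norm (x - y)"
        by (metis norm_triangle_sub norm_minus_commute)
      ultimately have "norm y \<le> r + 2" using xy by linarith
      with True xy show ?thesis using d(2)[of y x] by (auto simp: dist_norm)
    next
      case False
      moreover have "norm x \<le> norm y + norm (x - y)" by (metis norm_triangle_sub)
      ultimately show ?thesis using f(2) xy \<open>e > 0\<close> by auto
    qed
  qed
qed

lemma bounded_compact_support:
  fixes f :: "'a::euclidean_space \<Rightarrow> real"
  assumes f: "continuous_on UNIV f" "\<And>x. norm x > r \<Longrightarrow> f x = 0"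
  obtains B where "B > 0" "\<And>x. \<bar>f x\<bar> \<le> B"
proof -
  have "compact (f ` cball 0 r)"
    by (rule compact_continuous_image) (use f(1) continuous_on_subset in auto)
  then obtain B where "B > 0" "\<forall>y\<in>f ` cball 0 r. norm y \<le> B"
    using compact_imp_bounded bounded_pos by metis
  show thesis
  proof (rule that[OF \<open>B > 0\<close>])
    show "\<bar>f x\<bar> \<le> B" for x
      using f(2)[of x] \<open>B > 0\<close> \<open>\<forall>y\<in>f ` cball 0 r. norm y \<le> B\<close> by (cases "norm x \<le> r") auto
  qed
qed

lemma partial_deriv_zero_off_closed:
  assumes "\<And>x. x \<notin> K \<Longrightarrow> f x = 0" "closed K" "x \<notin> K"
  shows "partial_deriv i f x = 0"
proof -
  have "((\<lambda>x. 0) has_derivative (\<lambda>x. 0)) (at x)" by simp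
  then have "(f has_derivative (\<lambda>x. 0)) (at x)"
    by (rule has_derivative_transform_within_open[of _ _ _ _ "- K"]) (use assms in auto)
  then show ?thesis by (rule partial_deriv_eq)
qed

lemma partial_deriv_zero_outside:
  fixes f :: "real^'n::finite \<Rightarrow> real"
  assumes "\<And>x. norm x > r \<Longrightarrow> f x = 0" "norm x > r"
  shows "partial_deriv i f x = 0"
  by (rule partial_deriv_zero_off_closed[where K="cball 0 r"]) (use assms in auto)

text \<open>The point is that \<open>d\<close> does not depend on \<open>x\<close>, so that the
  remainder can be integrated over \<open>x\<close>. The mean value inequality is applied to
  \<open>f\<close> minus its linear part at \<open>x\<close>; the derivative of this difference is
  small because the partial derivatives are uniformly continuous.\<close>

lemma C1_uniform_Taylor:
  fixes f :: "real^'n::finite \<Rightarrow> real"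
  assumes f: "C_k (Suc 0) f" "\<And>x. norm x > r \<Longrightarrow> f x = 0" and "e > 0"
  obtains d where "d > 0"
    "\<And>x h. norm h < d \<Longrightarrow> \<bar>f (x + h) - f x - (\<Sum>i\<in>UNIV. h $ i * partial_deriv i f x)\<bar> \<le> e * norm h"
proof -
  \<comment> \<open>Each coordinate gets the share \<open>e / CARD('n)\<close>, because the
    increments of the partial derivatives are summed with weights
    \<open>\<bar>s $ i\<bar> \<le> norm s\<close>.\<close>
  have "\<exists>d>0. \<forall>x y. norm (x - y) < d \<longrightarrow> \<bar>partial_deriv i f x - partial_deriv i f y\<bar> < e / CARD('n)" for i
  proof -
    have c: "continuous_on UNIV (partial_deriv i f)" using f(1) by simp
    have pos: "e / CARD('n) > 0" using \<open>e > 0\<close> by simp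
    show ?thesis
      by (rule uniformly_continuous_compact_support[OF c partial_deriv_zero_outside[OF f(2)] pos])
         auto
  qed
  then obtain d where d: "\<And>i. d i > 0"
    "\<And>i x y. norm (x - y) < d i \<Longrightarrow> \<bar>partial_deriv i f x - partial_deriv i f y\<bar> < e / CARD('n)"
    by metis
  define d0 where "d0 = Min (range d)"
  have d0: "d0 > 0" "\<And>i. d0 \<le> d i" unfolding d0_def using d(1) by auto
  show thesis
  proof (rule that[OF d0(1)])
    fix x h :: "real^'n" assume h: "norm h < d0"
    define g where "g t = f (x + t) - (\<Sum>i\<in>UNIV. t $ i * partial_deriv i f x)" for t
    have diff: "f differentiable at z" for z using f(1) by simp
    have hd: "(g has_derivative (\<lambda>s. (\<Sum>i\<in>UNIV. s $ i * partial_deriv i f (x + t)) -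
        (\<Sum>i\<in>UNIV. s $ i * partial_deriv i f x))) (at t within S)" for t S
      unfolding g_def
      apply (rule has_derivative_at_withinI)
      apply (rule has_derivative_diff)
       apply (rule has_derivative_compose[where f="\<lambda>t. x + t", OF _ partial_deriv_has_derivative[OF diff]])
       apply (auto intro!: derivative_eq_intros bounded_linear.has_derivative[OF bounded_linear_vec_nth])
      done
    have "norm (g h - g 0) \<le> e * norm (h - 0)"
    proof (rule differentiable_bound[where S="ball 0 d0" and f=g, OF convex_ball hd])
      fix t :: "real^'n" assume t: "t \<in> ball 0 d0"
      show "onorm (\<lambda>s. (\<Sum>i\<in>UNIV. s $ i * partial_deriv i f (x + t)) -
        (\<Sum>i\<in>UNIV. s $ i * partial_deriv i f x)) \<le> e"
      proof (rule onorm_bound)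
        show "e \<ge> 0" using \<open>e > 0\<close> by simp
        fix s :: "real^'n"
        have "norm ((\<Sum>i\<in>UNIV. s $ i * partial_deriv i f (x + t)) -
            (\<Sum>i\<in>UNIV. s $ i * partial_deriv i f x))
          = \<bar>\<Sum>i\<in>UNIV. s $ i * (partial_deriv i f (x + t) - partial_deriv i f x)\<bar>"
          by (simp add: right_diff_distrib sum_subtractf)
        also have "\<dots> \<le> (\<Sum>i::'n\<in>UNIV. norm s * (e / CARD('n)))"
        proof (rule order_trans[OF sum_abs sum_mono])
          fix i
          have "\<bar>partial_deriv i f (x + t) - partial_deriv i f x\<bar> \<le> e / CARD('n)"
            using d(2)[of "x + t" x i] d0(2)[of i] t by auto
          then show "\<bar>s $ i * (partial_deriv i f (x + t) - partial_deriv i f x)\<bar> \<le> norm s * (e / CARD('n))"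
            unfolding abs_mult using component_le_norm_cart[of s i] by (intro mult_mono) auto
        qed
        finally show "norm ((\<Sum>i\<in>UNIV. s $ i * partial_deriv i f (x + t)) -
            (\<Sum>i\<in>UNIV. s $ i * partial_deriv i f x)) \<le> e * norm s" by (simp add: mult.commute)
      qed
    qed (use h d0 in auto)
    then show "\<bar>f (x + h) - f x - (\<Sum>i\<in>UNIV. h $ i * partial_deriv i f x)\<bar> \<le> e * norm h"
      by (simp add: g_def algebra_simps)
  qed
qed

section \<open>Convolution with a mollifier\<close>

definition moll :: "(real^'n::finite \<Rightarrow> real) \<Rightarrow> (real^'n \<Rightarrow> real) \<Rightarrow> real^'n \<Rightarrow> real" where
  "moll f \<rho> x = integral\<^sup>L lborel (\<lambda>y. f y * \<rho> (x - y))"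

lemma integrable_mult_bounded_continuous:
  fixes f g :: "'a::euclidean_space \<Rightarrow> real"
  assumes f: "integrable lborel f" and g: "continuous_on UNIV g" "\<And>y. \<bar>g y\<bar> \<le> B"
  shows "integrable lborel (\<lambda>y. f y * g y)"
proof (rule Bochner_Integration.integrable_bound)
  show "integrable lborel (\<lambda>y. B * f y)" using f by simp
  show "(\<lambda>y. f y * g y) \<in> borel_measurable lborel"
    using borel_measurable_continuous_onI[OF g(1)] borel_measurable_integrable[OF f] by simp
  show "AE x in lborel. norm (f x * g x) \<le> norm (B * f x)"
  proof (rule AE_I2)
    fix x
    have "\<bar>f x\<bar> * \<bar>g x\<bar> \<le> \<bar>f x\<bar> * \<bar>B\<bar>" using g(2)[of x] by (intro mult_left_mono) auto
    then show "norm (f x * g x) \<le> norm (B * f x)" by (simp add: abs_mult mult.commute)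
  qed
qed

lemma integrable_moll:
  fixes f \<rho> :: "real^'n::finite \<Rightarrow> real"
  assumes "integrable lborel f" "continuous_on UNIV \<rho>" "\<And>x. norm x > r \<Longrightarrow> \<rho> x = 0"
  shows "integrable lborel (\<lambda>y. f y * \<rho> (x - y))"
proof -
  obtain B where B: "\<And>x. \<bar>\<rho> x\<bar> \<le> B" using bounded_compact_support assms(2,3) by metis
  have "continuous_on UNIV (\<lambda>y. \<rho> (x - y))"
    by (rule continuous_on_compose2[OF assms(2)]) (auto intro: continuous_intros)
  then show ?thesis using integrable_mult_bounded_continuous assms(1) B by blast
qed

text \<open>Differentiation under the integral sign: the uniform Taylor remainder of
  \<open>\<rho>\<close> is multiplied by \<open>f\<close> and integrated.\<close>

lemma moll_has_derivative:
  fixes f \<rho> :: "real^'n::finite \<Rightarrow> real"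
  assumes f: "integrable lborel f" and \<rho>: "C_k (Suc 0) \<rho>" "\<And>x. norm x > r \<Longrightarrow> \<rho> x = 0"
  shows "(moll f \<rho> has_derivative (\<lambda>h. \<Sum>i\<in>UNIV. h $ i * moll f (partial_deriv i \<rho>) x)) (at x)"
  unfolding has_derivative_at_alt
proof (intro conjI allI impI)
  show "bounded_linear (\<lambda>h. \<Sum>i\<in>UNIV. h $ i * moll f (partial_deriv i \<rho>) x)"
    by (intro bounded_linear_sum bounded_linear_mult_const bounded_linear_vec_nth)
  fix e :: real assume "e > 0"
  \<comment> \<open>The remainder of \<open>\<rho>\<close> is integrated against
    \<open>\<bar>f\<bar>\<close>, so its tolerance is \<open>e\<close> divided by the
    \<open>L1\<close> norm of \<open>f\<close>; adding 1 avoids division by zero.\<close>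
  define I where "I = (\<integral>y. \<bar>f y\<bar> \<partial>lborel)"
  have I: "I \<ge> 0" unfolding I_def by simp
  have eI: "e / (I + 1) > 0" using I \<open>e > 0\<close> by simp
  obtain d where d: "d > 0" "\<And>x h. norm h < d \<Longrightarrow>
      \<bar>\<rho> (x + h) - \<rho> x - (\<Sum>i\<in>UNIV. h $ i * partial_deriv i \<rho> x)\<bar> \<le> e / (I + 1) * norm h"
    by (rule C1_uniform_Taylor[OF \<rho>(1,2) eI]) auto
  show "\<exists>d>0. \<forall>y. norm (y - x) < d \<longrightarrow>
     norm (moll f \<rho> y - moll f \<rho> x - (\<Sum>i\<in>UNIV. (y - x) $ i * moll f (partial_deriv i \<rho>) x)) \<le> e * norm (y - x)"
  proof (intro exI[of _ d] conjI d(1) allI impI)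
    fix x' assume x': "norm (x' - x) < d"
    define h where "h = x' - x"
    have c: "continuous_on UNIV \<rho>" "continuous_on UNIV (partial_deriv i \<rho>)" for i
      using C_k_continuous[OF \<rho>(1)] \<rho>(1) by auto
    have int: "integrable lborel (\<lambda>y. f y * \<rho> (z - y))"
       "integrable lborel (\<lambda>y. f y * partial_deriv i \<rho> (z - y))" for z i
      using integrable_moll[OF f c(1) \<rho>(2)] integrable_moll[OF f c(2) partial_deriv_zero_outside[OF \<rho>(2)]] by auto
    have int2: "integrable lborel (\<lambda>y. h $ i * (f y * partial_deriv i \<rho> (x - y)))" for i
      by (rule integrable_mult_right) (rule int(2))
    have "moll f \<rho> x' - moll f \<rho> x - (\<Sum>i\<in>UNIV. h $ i * moll f (partial_deriv i \<rho>) x)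
      = (\<integral>y. (f y * \<rho> (x' - y) - f y * \<rho> (x - y)) - (\<Sum>i\<in>UNIV. h $ i * (f y * partial_deriv i \<rho> (x - y))) \<partial>lborel)"
    proof -
      have "(\<integral>y. (f y * \<rho> (x' - y) - f y * \<rho> (x - y)) - (\<Sum>i\<in>UNIV. h $ i * (f y * partial_deriv i \<rho> (x - y))) \<partial>lborel)
        = (\<integral>y. f y * \<rho> (x' - y) - f y * \<rho> (x - y) \<partial>lborel)
          - (\<integral>y. (\<Sum>i\<in>UNIV. h $ i * (f y * partial_deriv i \<rho> (x - y))) \<partial>lborel)"
        by (rule Bochner_Integration.integral_diff)
          (intro Bochner_Integration.integrable_diff Bochner_Integration.integrable_sum int int2)+
      also have "(\<integral>y. f y * \<rho> (x' - y) - f y * \<rho> (x - y) \<partial>lborel) = moll f \<rho> x' - moll f \<rho> x"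
        unfolding moll_def by (rule Bochner_Integration.integral_diff[OF int(1) int(1)])
      also have "(\<integral>y. (\<Sum>i\<in>UNIV. h $ i * (f y * partial_deriv i \<rho> (x - y))) \<partial>lborel)
         = (\<Sum>i\<in>UNIV. \<integral>y. h $ i * (f y * partial_deriv i \<rho> (x - y)) \<partial>lborel)"
        by (rule Bochner_Integration.integral_sum) (rule int2)
      also have "\<dots> = (\<Sum>i\<in>UNIV. h $ i * moll f (partial_deriv i \<rho>) x)"
        unfolding moll_def by (simp only: integral_mult_right_zero)
      finally show ?thesis by simp
    qed
    also have "\<bar>\<dots>\<bar> \<le> (\<integral>y. \<bar>f y\<bar> * (e / (I + 1) * norm h) \<partial>lborel)"
    proof (rule integral_abs_bound_integral)
      show "integrable lborel (\<lambda>y. \<bar>f y\<bar> * (e / (I + 1) * norm h))" using f by simp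
      show "integrable lborel (\<lambda>y. (f y * \<rho> (x' - y) - f y * \<rho> (x - y)) - (\<Sum>i\<in>UNIV. h $ i * (f y * partial_deriv i \<rho> (x - y))))"
        by (intro Bochner_Integration.integrable_diff Bochner_Integration.integrable_sum int int2)
      fix y
      have eq: "f y * \<rho> (x' - y) - f y * \<rho> (x - y) - (\<Sum>i\<in>UNIV. h $ i * (f y * partial_deriv i \<rho> (x - y)))
         = f y * (\<rho> ((x - y) + h) - \<rho> (x - y) - (\<Sum>i\<in>UNIV. h $ i * partial_deriv i \<rho> (x - y)))"
        by (simp add: h_def algebra_simps sum_distrib_left)
      show "\<bar>f y * \<rho> (x' - y) - f y * \<rho> (x - y) - (\<Sum>i\<in>UNIV. h $ i * (f y * partial_deriv i \<rho> (x - y)))\<bar>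
          \<le> \<bar>f y\<bar> * (e / (I + 1) * norm h)"
        unfolding eq abs_mult
        by (intro mult_left_mono d(2) abs_ge_zero) (use x' in \<open>simp add: h_def\<close>)
    qed
    also have "\<dots> = I * (e / (I + 1)) * norm h" by (simp add: I_def)
    also have "\<dots> \<le> e * norm h"
      using I \<open>e > 0\<close> by (intro mult_right_mono) (auto simp: field_simps)
    finally show "norm (moll f \<rho> x' - moll f \<rho> x - (\<Sum>i\<in>UNIV. (x' - x) $ i * moll f (partial_deriv i \<rho>) x)) \<le> e * norm (x' - x)"
      by (simp add: h_def)
  qed
qed

lemma partial_deriv_moll:
  fixes f \<rho> :: "real^'n::finite \<Rightarrow> real"
  assumes f: "integrable lborel f" and \<rho>: "C_k (Suc 0) \<rho>" "\<And>x. norm x > r \<Longrightarrow> \<rho> x = 0"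
  shows "partial_deriv i (moll f \<rho>) = moll f (partial_deriv i \<rho>)"
  by (rule ext) (simp add: partial_deriv_eq[OF moll_has_derivative[OF assms]] sum_axis_mult)

text \<open>Every derivative falls on \<open>\<rho>\<close>, so the induction varies
  \<open>\<rho>\<close> while \<open>f\<close> remains merely integrable.\<close>

lemma C_k_moll:
  fixes f \<rho> :: "real^'n::finite \<Rightarrow> real"
  assumes f: "integrable lborel f" and \<rho>: "\<And>k. C_k k \<rho>" "\<And>x. norm x > r \<Longrightarrow> \<rho> x = 0"
  shows "C_k k (moll f \<rho>)"
  using \<rho>
proof (induction k arbitrary: \<rho>)
  case 0
  have "moll f \<rho> differentiable at x" for x
    using moll_has_derivative[OF f 0] by (auto simp: differentiable_def)
  then show ?case
    by (auto intro!: differentiable_imp_continuous_within simp: continuous_on_eq_continuous_within)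
next
  case (Suc k)
  have "moll f \<rho> differentiable at x" for x
    using moll_has_derivative[OF f Suc.prems] by (auto simp: differentiable_def)
  moreover have "C_k k (moll f (partial_deriv i \<rho>))" for i
  proof (rule Suc.IH)
    show "C_k k (partial_deriv i \<rho>)" for k using Suc.prems(1)[of "Suc k"] by simp
    show "norm x > r \<Longrightarrow> partial_deriv i \<rho> x = 0" for x
      by (rule partial_deriv_zero_outside[OF Suc.prems(2)])
  qed
  ultimately show ?case by (simp add: partial_deriv_moll[OF f Suc.prems])
qed

lemma is_mollifierD:
  assumes "is_mollifier r \<rho>"
  shows "C_k k \<rho>" "\<rho> x \<ge> 0" "norm x \<ge> r \<Longrightarrow> \<rho> x = 0" "norm x > r \<Longrightarrow> \<rho> x = 0"
    "integral\<^sup>L lborel \<rho> = 1" "integrable lborel \<rho>" "continuous_on S \<rho>"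
  using assms C_k_continuous[of 0 \<rho>] integrable_compact_support[of \<rho> "cball 0 r"]
  by (auto simp: is_mollifier_def)

lemma lborel_distr_reflect: "distr lborel borel (\<lambda>y. x - y) = (lborel :: 'a::euclidean_space measure)"
  using lborel_affine[of "-1" x] by (simp add: density_1)

lemma integral_reflect:
  fixes f :: "'a::euclidean_space \<Rightarrow> real"
  assumes "f \<in> borel_measurable borel"
  shows "(\<integral>y. f (x - y) \<partial>lborel) = integral\<^sup>L lborel f"
  by (subst (2) lborel_distr_reflect[of x, symmetric]) (simp add: integral_distr assms)

lemma integral_mollifier:
  assumes "is_mollifier r \<rho>"
  shows "(\<integral>y. \<rho> (x - y) \<partial>lborel) = 1" "(\<integral>x. \<rho> (x - y) \<partial>lborel) = 1"
    "integrable lborel (\<lambda>y. \<rho> (x - y))" "integrable lborel (\<lambda>x. \<rho> (x - y))"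
proof -
  have m: "\<rho> \<in> borel_measurable borel"
    using is_mollifierD(7)[OF assms, of UNIV] by (rule borel_measurable_continuous_onI)
  show 1: "(\<integral>y. \<rho> (x - y) \<partial>lborel) = 1" by (simp add: integral_reflect[OF m] is_mollifierD(5)[OF assms])
  have "distr lborel borel (\<lambda>x. - y + x) = (lborel :: (real^'a) measure)"
    by (rule lborel_distr_plus)
  then have d: "distr lborel borel (\<lambda>x. x - y) = (lborel :: (real^'a) measure)" by simp
  show 2: "(\<integral>x. \<rho> (x - y) \<partial>lborel) = 1"
    by (subst is_mollifierD(5)[OF assms, symmetric], subst (2) d[symmetric]) (simp add: integral_distr m)
  \<comment> \<open>The integral of a nonintegrable function is 0 by convention, so the value 1
    already proves integrability.\<close>
  show "integrable lborel (\<lambda>y. \<rho> (x - y))" "integrable lborel (\<lambda>x. \<rho> (x - y))"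
    using 1 2 not_integrable_integral_eq by force+
qed

text \<open>A convolution averages the values of \<open>f\<close> over a ball. With
  \<open>c = 0\<close> the same statement yields bounds on the size of the convolution.\<close>

lemma moll_close:
  fixes f :: "real^'n::finite \<Rightarrow> real"
  assumes f: "integrable lborel f" and \<rho>: "is_mollifier r \<rho>"
    and close: "\<And>y. norm (x - y) < r \<Longrightarrow> \<bar>f y - c\<bar> \<le> e"
  shows "\<bar>moll f \<rho> x - c\<bar> \<le> e"
proof -
  have i: "integrable lborel (\<lambda>y. f y * \<rho> (x - y))"
    by (rule integrable_moll[OF f is_mollifierD(7,4)[OF \<rho>]])
  have "moll f \<rho> x - c = (\<integral>y. f y * \<rho> (x - y) - c * \<rho> (x - y) \<partial>lborel)"
    using integral_mollifier[OF \<rho>] i by (simp add: moll_def)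
  also have "\<bar>\<dots>\<bar> \<le> (\<integral>y. e * \<rho> (x - y) \<partial>lborel)"
  proof (rule integral_abs_bound_integral)
    show "\<bar>f y * \<rho> (x - y) - c * \<rho> (x - y)\<bar> \<le> e * \<rho> (x - y)" for y
    proof (cases "norm (x - y) < r")
      case True
      have "f y * \<rho> (x - y) - c * \<rho> (x - y) = (f y - c) * \<rho> (x - y)" by (simp add: algebra_simps)
      then show ?thesis using close[OF True] is_mollifierD(2)[OF \<rho>, of "x - y"]
        by (simp add: abs_mult mult_right_mono)
    qed (simp add: is_mollifierD(3)[OF \<rho>])
  qed (use i integral_mollifier[OF \<rho>] in simp_all)
  also have "\<dots> = e" using integral_mollifier[OF \<rho>] by simp
  finally show ?thesis .
qed

lemma moll_zero:
  assumes "is_mollifier r \<rho>" "\<And>y. norm (x - y) < r \<Longrightarrow> f y = 0"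
  shows "moll f \<rho> x = 0"
proof -
  have "(\<lambda>y. f y * \<rho> (x - y)) = (\<lambda>y. 0)"
    using assms(2) is_mollifierD(3)[OF assms(1)] by (intro ext) (metis mult_eq_0_iff not_less)
  then show ?thesis by (simp add: moll_def)
qed

lemma integrable_bounded_support:
  fixes f :: "'a::euclidean_space \<Rightarrow> real"
  assumes f: "f \<in> borel_measurable borel" "\<And>x. \<bar>f x\<bar> \<le> M" "\<And>x. x \<notin> S \<Longrightarrow> f x = 0" "bounded S"
  shows "integrable lborel f"
proof -
  obtain R where R: "S \<subseteq> cball 0 R"
    using f(4) unfolding bounded_iff by (metis mem_cball_0 subsetI)
  have "integrable lborel (\<lambda>x::'a. M * indicator (cball 0 R) x)"
    using emeasure_bounded_finite[of "cball (0::'a) R"] by (intro integrable_mult_right integrable_real_indicator) auto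
  then show ?thesis
  proof (rule Bochner_Integration.integrable_bound)
    show "AE x in lborel. norm (f x) \<le> norm (M * indicator (cball 0 R) x)"
    proof (rule AE_I2)
      show "norm (f x) \<le> norm (M * indicator (cball 0 R) x)" for x
        using R f(2)[of x] f(3)[of x] by (cases "x \<in> S") (auto simp: indicator_def subset_iff)
    qed
  qed (use f in simp)
qed

section \<open>Convergence of mollifications in the mean\<close>

text \<open>A measurable function is an almost everywhere limit of continuous functions; after
  modifying these to have a common integrable bound, dominated convergence gives closeness in
  \<open>L1\<close>.\<close>

lemma continuous_approx_L1:
  fixes f :: "'a::euclidean_space \<Rightarrow> real"
  assumes f: "f \<in> borel_measurable borel" "\<And>x. \<bar>f x\<bar> \<le> M" "\<And>x. norm x > R \<Longrightarrow> f x = 0" and "e > 0"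
  obtains h where "continuous_on UNIV h" "\<And>x. norm x > R + 1 \<Longrightarrow> h x = 0"
    "(\<integral>x. \<bar>f x - h x\<bar> \<partial>lborel) < e"
proof -
  have M: "M \<ge> 0" using f(2)[of 0] by linarith
  have "f \<in> borel_measurable lebesgue" using f(1) by (simp add: measurable_completion)
  then have "f measurable_on UNIV" by (rule lebesgue_measurable_imp_measurable_on) simp
  then obtain N g where N: "negligible N" and g: "\<And>n. continuous_on UNIV (g n)"
    "\<And>x. x \<notin> N \<Longrightarrow> (\<lambda>n. g n x) \<longlonglongrightarrow> f x"
    unfolding measurable_on_def by auto
  \<comment> \<open>Clipping at height \<open>M\<close> supplies the bound, and the last factor is a
    continuous cutoff, equal to 1 on the ball of radius \<open>R\<close> and to 0 beyond
    \<open>R + 1\<close>. Neither changes the limit \<open>f\<close>.\<close>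
  define h where "h n x = max (- M) (min M (g n x)) * max 0 (min 1 (R + 1 - norm x))" for n :: nat and x
  have hc: "continuous_on UNIV (h n)" for n
    unfolding h_def by (intro continuous_intros g(1))
  have hb: "\<bar>h n x\<bar> \<le> M * 1" for n x
    unfolding h_def abs_mult using M by (intro mult_mono) auto
  have h0: "h n x = 0" if "norm x > R + 1" for n x
    using that by (simp add: h_def)
  have lim: "(\<lambda>n. h n x) \<longlonglongrightarrow> f x" if "x \<notin> N" for x
  proof -
    have "(\<lambda>n. h n x) \<longlonglongrightarrow> max (- M) (min M (f x)) * max 0 (min 1 (R + 1 - norm x))"
      unfolding h_def by (intro tendsto_intros g(2) that)
    also have "max (- M) (min M (f x)) = f x" using f(2)[of x] by auto
    also have "f x * max 0 (min 1 (R + 1 - norm x)) = f x"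
      using f(3)[of x] by (cases "norm x > R") auto
    finally show ?thesis .
  qed
  have "AE x in lebesgue. x \<notin> N"
    by (rule AE_not_in) (use N in \<open>simp add: negligible_iff_null_sets\<close>)
  then have aeN: "AE x in lborel. x \<notin> N" by (simp add: AE_completion_iff)
  have hm: "h n \<in> borel_measurable borel" for n using hc borel_measurable_continuous_onI by blast
  have "(\<lambda>n. \<integral>x. \<bar>f x - h n x\<bar> \<partial>lborel) \<longlonglongrightarrow> (\<integral>x. 0 \<partial>(lborel :: 'a measure))"
  proof (rule integral_dominated_convergence)
    show "(\<lambda>x. \<bar>f x - h n x\<bar>) \<in> borel_measurable lborel" for n using f(1) hm by simp
    show "integrable lborel (\<lambda>x::'a. 2 * M * indicator (cball 0 (R + 1)) x)"
      using emeasure_bounded_finite[of "cball (0::'a) (R+1)"]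
      by (intro integrable_mult_right integrable_real_indicator) auto
    show "AE x in lborel. (\<lambda>n. \<bar>f x - h n x\<bar>) \<longlonglongrightarrow> 0"
      using aeN
    proof eventually_elim
      fix x assume "x \<notin> N"
      from tendsto_rabs[OF tendsto_diff[OF tendsto_const lim[OF this], of "f x"]]
      show "(\<lambda>n. \<bar>f x - h n x\<bar>) \<longlonglongrightarrow> 0" by simp
    qed
    show "AE x in lborel. norm \<bar>f x - h n x\<bar> \<le> 2 * M * indicator (cball 0 (R + 1)) x" for n
    proof (rule AE_I2)
      show "norm \<bar>f x - h n x\<bar> \<le> 2 * M * indicator (cball 0 (R + 1)) x" for x
        using f(2)[of x] hb[of n x] h0[of x n] f(3)[of x] by (cases "norm x > R + 1") auto
    qed
  qed simp
  then have "eventually (\<lambda>n. (\<integral>x. \<bar>f x - h n x\<bar> \<partial>lborel) < e) sequentially"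
    using \<open>e > 0\<close> by (intro order_tendstoD(2)) auto
  then obtain n where "(\<integral>x. \<bar>f x - h n x\<bar> \<partial>lborel) < e" by (auto simp: eventually_sequentially)
  with hc h0 show thesis by (intro that[of "h n"]) auto
qed

text \<open>Young's inequality for a kernel of mass 1. Nonnegative integrals are used throughout
  because the order of integration is exchanged before integrability is known.\<close>

lemma moll_L1_bound:
  fixes f :: "real^'n::finite \<Rightarrow> real"
  assumes f: "integrable lborel f" and \<rho>: "is_mollifier r \<rho>"
  shows "integrable lborel (moll f \<rho>)" "(\<integral>x. \<bar>moll f \<rho> x\<bar> \<partial>lborel) \<le> (\<integral>x. \<bar>f x\<bar> \<partial>lborel)"
proof -
  have fm[measurable]: "f \<in> borel_measurable borel" using borel_measurable_integrable[OF f] by simp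
  have rm[measurable]: "\<rho> \<in> borel_measurable borel"
    using is_mollifierD(7)[OF \<rho>, of UNIV] by (rule borel_measurable_continuous_onI)
  have "continuous_on UNIV (moll f \<rho>)"
    using C_k_moll[OF f is_mollifierD(1,4)[OF \<rho>], where k=0] by simp
  then have mm[measurable]: "moll f \<rho> \<in> borel_measurable borel" by (rule borel_measurable_continuous_onI)
  have "(\<integral>\<^sup>+ x. ennreal \<bar>moll f \<rho> x\<bar> \<partial>lborel) \<le> (\<integral>\<^sup>+ x. \<integral>\<^sup>+ y. ennreal (\<bar>f y\<bar> * \<rho> (x - y)) \<partial>lborel \<partial>lborel)"
  proof (rule nn_integral_mono)
    fix x
    have "integrable lborel (\<lambda>y. f y * \<rho> (x - y))"
      by (rule integrable_moll[OF f is_mollifierD(7,4)[OF \<rho>]])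
    from integral_norm_bound_ennreal[OF this]
    show "ennreal \<bar>moll f \<rho> x\<bar> \<le> (\<integral>\<^sup>+ y. ennreal (\<bar>f y\<bar> * \<rho> (x - y)) \<partial>lborel)"
      using is_mollifierD(2)[OF \<rho>] by (simp add: moll_def abs_mult)
  qed
  also have "\<dots> = (\<integral>\<^sup>+ y. \<integral>\<^sup>+ x. ennreal (\<bar>f y\<bar> * \<rho> (x - y)) \<partial>lborel \<partial>lborel)"
    by (rule lborel_pair.Fubini') simp
  also have "\<dots> = (\<integral>\<^sup>+ y. ennreal \<bar>f y\<bar> \<partial>lborel)"
  proof (rule nn_integral_cong)
    fix y
    have "(\<integral>\<^sup>+ x. ennreal (\<bar>f y\<bar> * \<rho> (x - y)) \<partial>lborel) = ennreal (\<integral>x. \<bar>f y\<bar> * \<rho> (x - y) \<partial>lborel)"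
      using integral_mollifier[OF \<rho>] is_mollifierD(2)[OF \<rho>]
      by (intro nn_integral_eq_integral) auto
    then show "(\<integral>\<^sup>+ x. ennreal (\<bar>f y\<bar> * \<rho> (x - y)) \<partial>lborel) = ennreal \<bar>f y\<bar>"
      using integral_mollifier[OF \<rho>] by simp
  qed
  also have "\<dots> = ennreal (\<integral>y. \<bar>f y\<bar> \<partial>lborel)"
    using f by (intro nn_integral_eq_integral) auto
  finally have le: "(\<integral>\<^sup>+ x. ennreal \<bar>moll f \<rho> x\<bar> \<partial>lborel) \<le> ennreal (\<integral>y. \<bar>f y\<bar> \<partial>lborel)" .
  show i: "integrable lborel (moll f \<rho>)"
    by (rule integrableI_bounded) (use le in \<open>auto intro: le_less_trans\<close>)
  then have "(\<integral>\<^sup>+ x. ennreal \<bar>moll f \<rho> x\<bar> \<partial>lborel) = ennreal (\<integral>x. \<bar>moll f \<rho> x\<bar> \<partial>lborel)"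
    by (intro nn_integral_eq_integral) auto
  with le show "(\<integral>x. \<bar>moll f \<rho> x\<bar> \<partial>lborel) \<le> (\<integral>x. \<bar>f x\<bar> \<partial>lborel)"
    by (simp add: ennreal_le_iff)
qed

lemma moll_diff:
  fixes f g :: "real^'n::finite \<Rightarrow> real"
  assumes f: "integrable lborel f" "integrable lborel g" and \<rho>: "is_mollifier r \<rho>"
  shows "moll (\<lambda>x. f x - g x) \<rho> x = moll f \<rho> x - moll g \<rho> x"
  using integrable_moll[OF f(1) is_mollifierD(7,4)[OF \<rho>], where x=x] integrable_moll[OF f(2) is_mollifierD(7,4)[OF \<rho>], where x=x]
  by (simp add: moll_def left_diff_distrib)

text \<open>With a continuous \<open>h\<close> near \<open>f\<close> in \<open>L1\<close>, the error
  splits into the mollification of \<open>f - h\<close>, the error for \<open>h\<close>, and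
  \<open>h - f\<close>. The outer terms are controlled by the \<open>L1\<close> distance; the middle
  one is uniformly small and lives on a ball of volume \<open>V\<close>, which explains the
  tolerance \<open>e / (3 * (V + 1))\<close>.\<close>

lemma moll_tendsto_L1:
  fixes f :: "real^'n::finite \<Rightarrow> real"
  assumes f: "f \<in> borel_measurable borel" "\<And>x. \<bar>f x\<bar> \<le> M" "\<And>x. norm x > R \<Longrightarrow> f x = 0" and "e > 0"
  obtains d where "d > 0" "\<And>r \<rho>. is_mollifier r \<rho> \<Longrightarrow> r \<le> d \<Longrightarrow> (\<integral>x. \<bar>moll f \<rho> x - f x\<bar> \<partial>lborel) < e"
proof -
  obtain h where h: "continuous_on UNIV h" "\<And>x. norm x > R + 1 \<Longrightarrow> h x = 0"
    "(\<integral>x. \<bar>f x - h x\<bar> \<partial>lborel) < e / 3"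
    by (rule continuous_approx_L1[OF f, where e="e/3"]) (use \<open>e > 0\<close> in auto)
  have fi: "integrable lborel f"
    by (rule integrable_bounded_support[OF f(1,2), of "cball 0 R"]) (use f(3) in auto)
  have hi: "integrable lborel h"
    by (rule integrable_compact_support[OF h(1), of "cball 0 (R + 1)"]) (use h(2) in auto)
  define V where "V = measure lborel (cball (0::real^'n) (R + 2))"
  have V: "V \<ge> 0" by (simp add: V_def)
  have eV: "e / (3 * (V + 1)) > 0" using V \<open>e > 0\<close> by simp
  obtain d where d: "d > 0" "\<And>x y. norm (x - y) < d \<Longrightarrow> \<bar>h x - h y\<bar> < e / (3 * (V + 1))"
    by (rule uniformly_continuous_compact_support[OF h(1) h(2)[OF less_le_trans] eV, of "R+2"]) auto
  show thesis
  proof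
    show "min d 1 > 0" using d by simp
    fix r and \<rho> :: "real^'n \<Rightarrow> real" assume \<rho>: "is_mollifier r \<rho>" and r: "r \<le> min d 1"
    have i: "integrable lborel (moll h \<rho>)" "integrable lborel (moll f \<rho>)"
      "integrable lborel (moll (\<lambda>x. f x - h x) \<rho>)"
      using moll_L1_bound(1) \<rho> hi fi by (auto intro!: moll_L1_bound(1)[OF _ \<rho>])
    have hh: "\<bar>moll h \<rho> x - h x\<bar> \<le> e / (3 * (V + 1)) * indicator (cball 0 (R + 2)) x" for x
    proof (cases "norm x \<le> R + 2")
      case True
      have "\<bar>moll h \<rho> x - h x\<bar> \<le> e / (3 * (V + 1))"
        by (rule moll_close[OF hi \<rho>]) (use d(2) r in \<open>force simp: norm_minus_commute intro: less_imp_le\<close>)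
      with True show ?thesis by simp
    next
      case False
      have "moll h \<rho> x = 0"
      proof (rule moll_zero[OF \<rho>])
        fix y assume "norm (x - y) < r"
        moreover have "norm x \<le> norm y + norm (x - y)" by (metis norm_triangle_sub)
        ultimately show "h y = 0" using False r by (intro h(2)) auto
      qed
      with False h(2)[of x] show ?thesis by simp
    qed
    have "(\<integral>x. \<bar>moll h \<rho> x - h x\<bar> \<partial>lborel) \<le> (\<integral>x. e / (3 * (V + 1)) * indicator (cball 0 (R + 2)) (x::real^'n) \<partial>lborel)"
      using i hi emeasure_bounded_finite[of "cball (0::real^'n) (R+2)"] by (intro integral_mono hh) auto
    also have "\<dots> = e / (3 * (V + 1)) * V" by (simp add: V_def)
    also have "\<dots> < e / 3" using V \<open>e > 0\<close> by (simp add: field_simps)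
    finally have 2: "(\<integral>x. \<bar>moll h \<rho> x - h x\<bar> \<partial>lborel) < e / 3" .
    have "(\<integral>x. \<bar>moll (\<lambda>x. f x - h x) \<rho> x\<bar> \<partial>lborel) \<le> (\<integral>x. \<bar>f x - h x\<bar> \<partial>lborel)"
      by (rule moll_L1_bound(2)[OF _ \<rho>]) (use fi hi in simp)
    then have 1: "(\<integral>x. \<bar>moll (\<lambda>x. f x - h x) \<rho> x\<bar> \<partial>lborel) < e / 3" using h(3) by linarith
    have "(\<integral>x. \<bar>moll f \<rho> x - f x\<bar> \<partial>lborel) \<le>
      (\<integral>x. \<bar>moll (\<lambda>x. f x - h x) \<rho> x\<bar> + \<bar>moll h \<rho> x - h x\<bar> + \<bar>f x - h x\<bar> \<partial>lborel)"
      using i fi hi by (intro integral_mono) (auto simp: moll_diff[OF fi hi \<rho>])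
    also have "\<dots> = (\<integral>x. \<bar>moll (\<lambda>x. f x - h x) \<rho> x\<bar> \<partial>lborel) + (\<integral>x. \<bar>moll h \<rho> x - h x\<bar> \<partial>lborel) + (\<integral>x. \<bar>f x - h x\<bar> \<partial>lborel)"
      using i fi hi by simp
    finally show "(\<integral>x. \<bar>moll f \<rho> x - f x\<bar> \<partial>lborel) < e" using 1 2 h(3) by linarith
  qed
qed

section \<open>Weak derivatives\<close>

lemma AE_lebesgue_on_iff:
  "S \<in> sets lebesgue \<Longrightarrow> (AE x in lebesgue_on S. P x) \<longleftrightarrow> (AE x in lborel. x \<in> S \<longrightarrow> P x)"
  by (subst AE_restrict_space_iff) (simp_all add: AE_completion_iff)

text \<open>All Sobolev notions refer to \<open>lebesgue_on\<close>, whereas translations and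
  exchange of integrals are carried out for \<open>lborel\<close>. The bridge is a Borel function
  \<open>g\<close> that extends \<open>f\<close> by zero.\<close>

lemma lebesgue_on_lborel:
  fixes f g :: "'a::euclidean_space \<Rightarrow> real"
  assumes "S \<in> sets lebesgue" "g \<in> borel_measurable borel"
    "\<And>x. x \<in> S \<Longrightarrow> f x = g x" "\<And>x. x \<notin> S \<Longrightarrow> g x = 0"
  shows integrable_lebesgue_on_lborel: "integrable (lebesgue_on S) f \<longleftrightarrow> integrable lborel g"
    and integral_lebesgue_on_lborel: "integral\<^sup>L (lebesgue_on S) f = integral\<^sup>L lborel g"
proof -
  have eq: "(\<lambda>x. indicator S x *\<^sub>R f x) = g"
    using assms(3,4) by (auto simp: indicator_def)
  have S: "S \<inter> space lebesgue \<in> sets lebesgue" using assms(1) by simp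
  have g: "g \<in> lborel \<rightarrow>\<^sub>M borel" using assms(2) by simp
  show "integrable (lebesgue_on S) f \<longleftrightarrow> integrable lborel g"
    unfolding integrable_restrict_space[OF S] eq by (rule integrable_completion[OF g])
  show "integral\<^sup>L (lebesgue_on S) f = integral\<^sup>L lborel g"
    unfolding integral_restrict_space[OF S] eq by (rule integral_completion[OF g])
qed

lemma borel_representative:
  fixes f :: "'a::euclidean_space \<Rightarrow> real"
  assumes S: "S \<in> sets borel" and f: "f \<in> borel_measurable (lebesgue_on S)"
  obtains g where "g \<in> borel_measurable borel" "\<And>x. x \<notin> S \<Longrightarrow> g x = 0" "AE x in lebesgue_on S. f x = g x"
proof -
  have S': "S \<in> sets lebesgue" using S by (simp add: sets_completionI_sets)
  have "(\<lambda>x. if x \<in> S then f x else 0) \<in> borel_measurable lebesgue"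
    using borel_measurable_if_I[OF f S'] .
  then obtain g where g: "g \<in> borel_measurable lborel" "AE x in lborel. (if x \<in> S then f x else 0) = g x"
    using completion_ex_borel_measurable_real by blast
  show thesis
  proof
    show "(\<lambda>x. indicator S x * g x) \<in> borel_measurable borel" using g(1) S by simp
    show "AE x in lebesgue_on S. f x = indicator S x * g x"
      unfolding AE_lebesgue_on_iff[OF S'] using g(2) by eventually_elim (auto split: if_splits)
  qed simp
qed

lemma borel_measurable_lebesgue_on: "f \<in> borel_measurable borel \<Longrightarrow> f \<in> borel_measurable (lebesgue_on S)"
  by (simp add: measurable_completion measurable_restrict_space1)

lemma lebesgue_on_subset_measurable:
  fixes f :: "'a::euclidean_space \<Rightarrow> real"
  assumes f: "f \<in> borel_measurable (lebesgue_on S)" "K \<subseteq> S" "S \<in> sets lebesgue" "K \<in> sets lebesgue"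
  shows "f \<in> borel_measurable (lebesgue_on K)"
proof -
  have "(\<lambda>x. if x \<in> S then f x else 0) \<in> borel_measurable lebesgue" by (rule borel_measurable_if_I[OF f(1,3)])
  then have "(\<lambda>x. indicator K x * (if x \<in> S then f x else 0)) \<in> borel_measurable lebesgue"
    using f(4) by simp
  also have "(\<lambda>x. indicator K x * (if x \<in> S then f x else 0)) = (\<lambda>x. if x \<in> K then f x else 0)"
    using f(2) by (auto simp: fun_eq_iff indicator_def)
  finally show ?thesis by (rule borel_measurable_if_D)
qed

lemma open_sets_lebesgue [simp]: "open S \<Longrightarrow> S \<in> sets lebesgue"
  by (simp add: sets_completionI_sets)

lemma compact_sets_lebesgue [simp]: "compact S \<Longrightarrow> S \<in> sets lebesgue"
  by (simp add: sets_completionI_sets compact_imp_closed)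

text \<open>Integrability on compact sets gives measurability only piece by piece; the pieces are
  glued because an open set is a countable union of closed boxes.\<close>

lemma locally_integrable_measurable:
  assumes "open \<Omega>" "locally_integrable \<Omega> u"
  shows "u \<in> borel_measurable (lebesgue_on \<Omega>)"
proof -
  obtain D where D: "countable D" "D \<subseteq> Pow \<Omega>" "\<And>X. X \<in> D \<Longrightarrow> \<exists>a b. X = cbox a b" "\<Union>D = \<Omega>"
    using open_countable_Union_open_cbox[OF assms(1)] by metis
  show ?thesis
  proof (rule measurable_piecewise_restrict[OF D(1)])
    show "space (lebesgue_on \<Omega>) \<subseteq> \<Union>D" using D by simp
    fix X assume X: "X \<in> D"
    then obtain a b where X': "X = cbox a b" "X \<subseteq> \<Omega>" using D by blast
    show "X \<inter> space (lebesgue_on \<Omega>) \<in> sets (lebesgue_on \<Omega>)"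
      using X' assms(1) by (simp add: sets_restrict_space_iff Int_absorb2)
    have "integrable (lebesgue_on X) u"
      using assms(2) X' by (auto simp: locally_integrable_def)
    then have "u \<in> borel_measurable (lebesgue_on X)" by auto
    then show "u \<in> borel_measurable (restrict_space (lebesgue_on \<Omega>) X)"
      using X' assms(1) by (simp add: restrict_restrict_space Int_absorb1)
  qed
qed

section \<open>Products with test functions\<close>

lemma test_functionE:
  fixes \<phi> :: "real^'n::finite \<Rightarrow> real"
  assumes "test_function \<Omega> \<phi>"
  obtains K r where "compact K" "K \<subseteq> \<Omega>" "K \<subseteq> cball 0 r" "\<And>x. x \<notin> K \<Longrightarrow> \<phi> x = 0"
    "\<And>i x. x \<notin> K \<Longrightarrow> partial_deriv i \<phi> x = 0"
proof -
  let ?K = "closure {x. \<phi> x \<noteq> 0}"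
  have K: "compact ?K" "?K \<subseteq> \<Omega>" using assms by (auto simp: test_function_def)
  then obtain r where r: "?K \<subseteq> cball 0 r"
    using compact_imp_bounded[OF K(1)] unfolding bounded_iff by (metis mem_cball_0 subsetI)
  have 0: "\<phi> x = 0" if "x \<notin> ?K" for x using that closure_subset[of "{x. \<phi> x \<noteq> 0}"] by auto
  show thesis
    by (rule that[OF K r 0 partial_deriv_zero_off_closed[OF 0 closed_closure]])
qed

lemma test_function_C_k:
  assumes "test_function \<Omega> \<phi>"
  shows "C_k k \<phi>" "C_k k (partial_deriv i \<phi>)" "continuous_on S \<phi>" "continuous_on S (partial_deriv i \<phi>)"
    "\<phi> differentiable at x" "\<phi> \<in> borel_measurable borel" "partial_deriv i \<phi> \<in> borel_measurable borel"
proof -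
  show 1: "C_k k \<phi>" for k using assms by (simp add: test_function_def)
  show 2: "C_k k (partial_deriv i \<phi>)" for k using 1[of "Suc k"] by simp
  show "continuous_on S \<phi>" "continuous_on S (partial_deriv i \<phi>)" for S
    using C_k_continuous 1 2 by blast+
  then show "\<phi> \<in> borel_measurable borel" "partial_deriv i \<phi> \<in> borel_measurable borel"
    by (auto intro: borel_measurable_continuous_onI)
  show "\<phi> differentiable at x" using 1[of 1] by simp
qed

lemma test_function_bounds:
  fixes \<phi> :: "real^'n::finite \<Rightarrow> real"
  assumes "test_function \<Omega> \<phi>"
  obtains B where "B > 0" "\<And>x. \<bar>\<phi> x\<bar> \<le> B" "\<And>i x. \<bar>partial_deriv i \<phi> x\<bar> \<le> B"
proof -
  obtain K r where K: "K \<subseteq> cball 0 r" "\<And>x. x \<notin> K \<Longrightarrow> \<phi> x = 0"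
    "\<And>i x. x \<notin> K \<Longrightarrow> partial_deriv i \<phi> x = 0" by (rule test_functionE[OF assms]) blast
  have z: "norm x > r \<Longrightarrow> \<phi> x = 0" "norm x > r \<Longrightarrow> partial_deriv i \<phi> x = 0" for i x
    using K by (force simp: subset_iff)+
  obtain B0 where B0: "B0 > 0" "\<And>x. \<bar>\<phi> x\<bar> \<le> B0"
    using bounded_compact_support[OF test_function_C_k(3)[OF assms] z(1)] by metis
  have "\<exists>B. \<forall>x. \<bar>partial_deriv i \<phi> x\<bar> \<le> B" for i
    using bounded_compact_support[OF test_function_C_k(4)[OF assms] z(2)] by metis
  then obtain B where B: "\<And>i x. \<bar>partial_deriv i \<phi> x\<bar> \<le> B i" by metis
  have Bi: "B i \<ge> 0" for i using B[of i 0] by linarith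
  have "B i \<le> (\<Sum>i\<in>UNIV. B i)" for i by (rule member_le_sum) (auto simp: Bi)
  then have "\<bar>partial_deriv i \<phi> x\<bar> \<le> B0 + (\<Sum>i\<in>UNIV. B i)" for i x
    using B[of i x] B0(1) by (smt (verit))
  moreover have "(\<Sum>i\<in>UNIV. B i) \<ge> 0" by (simp add: Bi sum_nonneg)
  ultimately show thesis using B0 by (intro that[of "B0 + (\<Sum>i\<in>UNIV. B i)"]) (auto intro: order_trans add_increasing2)
qed

lemma locally_integrable_mult:
  fixes u :: "real^'n::finite \<Rightarrow> real"
  assumes u: "locally_integrable \<Omega> u" and "open \<Omega>" and f: "f \<in> borel_measurable borel"
    "\<And>x. \<bar>f x\<bar> \<le> B" "\<And>x. x \<notin> K \<Longrightarrow> f x = 0" and K: "compact K" "K \<subseteq> \<Omega>"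
  shows "integrable (lebesgue_on \<Omega>) (\<lambda>x. u x * f x)"
proof -
  have uK: "integrable (lebesgue_on K) u" using u K by (simp add: locally_integrable_def)
  have fm: "f \<in> borel_measurable (lebesgue_on K)"
    using f(1) by (simp add: borel_measurable_lebesgue_on)
  have "integrable (lebesgue_on K) (\<lambda>x. u x * f x)"
  proof (rule Bochner_Integration.integrable_bound)
    show "integrable (lebesgue_on K) (\<lambda>x. B * u x)" using uK by simp
    show "(\<lambda>x. u x * f x) \<in> borel_measurable (lebesgue_on K)" using uK fm by (intro borel_measurable_times) auto
    show "AE x in lebesgue_on K. norm (u x * f x) \<le> norm (B * u x)"
    proof (rule AE_I2)
      fix x
      have "\<bar>f x\<bar> \<le> \<bar>B\<bar>" using f(2)[of x] by linarith
      then have "\<bar>u x\<bar> * \<bar>f x\<bar> \<le> \<bar>u x\<bar> * \<bar>B\<bar>" by (intro mult_left_mono) auto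
      then show "norm (u x * f x) \<le> norm (B * u x)" by (simp add: abs_mult mult.commute)
    qed
  qed
  then have "integrable lebesgue (\<lambda>x. indicator K x *\<^sub>R (u x * f x))"
    by (subst (asm) integrable_restrict_space) (use K in auto)
  moreover have "(\<lambda>x. indicator K x *\<^sub>R (u x * f x)) = (\<lambda>x. indicator \<Omega> x *\<^sub>R (u x * f x))"
    using f(3) K by (auto simp: fun_eq_iff indicator_def)
  ultimately show ?thesis
    by (subst integrable_restrict_space) (use \<open>open \<Omega>\<close> in auto)
qed

lemma locally_integrable_mult_test:
  fixes u :: "real^'n::finite \<Rightarrow> real"
  assumes u: "locally_integrable \<Omega> u" and "open \<Omega>" and \<phi>: "test_function \<Omega> \<phi>"
  shows "integrable (lebesgue_on \<Omega>) (\<lambda>x. u x * \<phi> x)"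
    "integrable (lebesgue_on \<Omega>) (\<lambda>x. u x * partial_deriv i \<phi> x)"
proof -
  obtain K r where K: "compact K" "K \<subseteq> \<Omega>" "\<And>x. x \<notin> K \<Longrightarrow> \<phi> x = 0"
    "\<And>i x. x \<notin> K \<Longrightarrow> partial_deriv i \<phi> x = 0" by (rule test_functionE[OF \<phi>]) blast
  obtain B where B: "\<And>x. \<bar>\<phi> x\<bar> \<le> B" "\<And>i x. \<bar>partial_deriv i \<phi> x\<bar> \<le> B"
    by (rule test_function_bounds[OF \<phi>]) blast
  show "integrable (lebesgue_on \<Omega>) (\<lambda>x. u x * \<phi> x)"
    by (rule locally_integrable_mult[OF u \<open>open \<Omega>\<close> test_function_C_k(6)[OF \<phi>] B(1) K(3,1,2)])
  show "integrable (lebesgue_on \<Omega>) (\<lambda>x. u x * partial_deriv i \<phi> x)"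
    by (rule locally_integrable_mult[OF u \<open>open \<Omega>\<close> test_function_C_k(7)[OF \<phi>] B(2) K(4,1,2)])
qed

section \<open>Integration by parts\<close>

lemma norm_axis_real: "norm (axis i t :: real^'n::finite) = \<bar>t\<bar>"
  by (simp add: norm_eq_sqrt_inner inner_axis_axis)

text \<open>The integral of a difference quotient vanishes by translation invariance of the measure.
  Since the quotients approach the derivative uniformly, with supports in one fixed ball, the
  derivative inherits this.\<close>

lemma integral_partial_deriv_eq_0:
  fixes f :: "real^'n::finite \<Rightarrow> real"
  assumes f: "C_k (Suc 0) f" "\<And>x. norm x > r \<Longrightarrow> f x = 0"
  shows "integral\<^sup>L lborel (partial_deriv i f) = 0"
proof -
  have c: "continuous_on UNIV f" "continuous_on UNIV (partial_deriv i f)"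
    using C_k_continuous[OF f(1)] f(1) by auto
  define V where "V = measure lborel (cball (0::real^'n) (r + 1))"
  have V: "V \<ge> 0" by (simp add: V_def)
  have int: "integrable lborel f" "integrable lborel (partial_deriv i f)"
    by (rule integrable_compact_support[OF _ _ compact_cball[of 0 r]];
        use c f(2) partial_deriv_zero_outside[of r f, OF f(2)] in simp)+
  have small: "\<bar>integral\<^sup>L lborel (partial_deriv i f)\<bar> \<le> e * V" if "e > 0" for e
  proof -
    obtain d where d: "d > 0" "\<And>x h. norm h < d \<Longrightarrow>
      \<bar>f (x + h) - f x - (\<Sum>i\<in>UNIV. h $ i * partial_deriv i f x)\<bar> \<le> e * norm h"
      by (rule C1_uniform_Taylor[where r=r, OF f \<open>e > 0\<close>]) auto
    \<comment> \<open>The bound \<open>t \<le> 1\<close> keeps the support of the shifted function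
      in the ball of radius \<open>r + 1\<close>, whose volume is \<open>V\<close>.\<close>
    define t where "t = min (d / 2) 1"
    have t: "t > 0" "t < d" "t \<le> 1" using d(1) by (auto simp: t_def)
    define D where "D x = (f (x + axis i t) - f x) / t" for x
    have shift: "distr lborel borel (\<lambda>x. axis i t + x) = (lborel :: (real^'n) measure)"
      by (rule lborel_distr_plus)
    have fm: "f \<in> borel_measurable borel" using c(1) by (rule borel_measurable_continuous_onI)
    have ish: "integrable lborel (\<lambda>x. f (x + axis i t))" "(\<integral>x. f (x + axis i t) \<partial>lborel) = integral\<^sup>L lborel f"
      using integrable_distr_eq[of "\<lambda>x. axis i t + x" lborel borel f]
        integral_distr[of "\<lambda>x. axis i t + x" lborel borel f] int(1) fm
      unfolding shift by (simp_all add: add.commute)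
    have D: "integrable lborel D" "integral\<^sup>L lborel D = 0"
      unfolding D_def using ish int(1) by simp_all
    have close: "\<bar>partial_deriv i f x - D x\<bar> \<le> e * indicator (cball 0 (r + 1)) x" for x
    proof (cases "norm x \<le> r + 1")
      case True
      have "(\<Sum>j\<in>UNIV. axis i t $ j * partial_deriv j f x) = t * partial_deriv i f x"
        using sum_axis_mult[of i "\<lambda>j. t * partial_deriv j f x"]
        by (simp add: axis_def if_distrib[of "\<lambda>a. a * _"] cong: if_cong)
      then have "\<bar>f (x + axis i t) - f x - t * partial_deriv i f x\<bar> \<le> e * t"
        using d(2)[of "axis i t" x] t by (simp add: norm_axis_real)
      then have "\<bar>f (x + axis i t) - f x - t * partial_deriv i f x\<bar> / t \<le> e"
        using t by (simp add: field_simps)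
      moreover have "\<bar>partial_deriv i f x - D x\<bar> = \<bar>f (x + axis i t) - f x - t * partial_deriv i f x\<bar> / t"
      proof -
        have "partial_deriv i f x - D x = - ((f (x + axis i t) - f x - t * partial_deriv i f x) / t)"
          using t by (simp add: D_def field_simps)
        then show ?thesis using t by (simp add: abs_divide)
      qed
      ultimately show ?thesis using True by simp
    next
      case False
      have "norm x \<le> norm (x + axis i t) + norm (axis i t)"
        using norm_triangle_ineq4[of "x + axis i t" "axis i t"] by simp
      then have "norm (x + axis i t) > r" using False t by (simp add: norm_axis_real)
      with False f(2) partial_deriv_zero_outside[of r f x, OF f(2)] show ?thesis by (simp add: D_def)
    qed
    have "\<bar>integral\<^sup>L lborel (partial_deriv i f)\<bar> = \<bar>\<integral>x. partial_deriv i f x - D x \<partial>lborel\<bar>"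
      using int D by simp
    also have "\<dots> \<le> (\<integral>x. e * indicator (cball 0 (r + 1)) (x::real^'n) \<partial>lborel)"
      using int D emeasure_bounded_finite[of "cball (0::real^'n) (r+1)"]
      by (intro integral_abs_bound_integral close) auto
    also have "\<dots> = e * V" by (simp add: V_def)
    finally show ?thesis .
  qed
  show ?thesis
  proof (rule ccontr)
    assume "integral\<^sup>L lborel (partial_deriv i f) \<noteq> 0"
    then have I: "\<bar>integral\<^sup>L lborel (partial_deriv i f)\<bar> > 0" (is "?I > 0") by simp
    \<comment> \<open>The choice \<open>e = ?I / (V + 1)\<close> turns the estimate
      \<open>?I \<le> e * V\<close> into the contradiction \<open>?I < ?I\<close>.\<close>
    have "?I \<le> ?I / (V + 1) * V" using I V by (intro small) auto
    also have "\<dots> < ?I" using I V by (simp add: field_simps)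
    finally show False by simp
  qed
qed

lemma integral_by_parts:
  fixes f g :: "real^'n::finite \<Rightarrow> real"
  assumes f: "C_k (Suc 0) f" and g: "C_k (Suc 0) g" "\<And>x. norm x > r \<Longrightarrow> g x = 0"
  shows "(\<integral>x. f x * partial_deriv i g x \<partial>lborel) = - (\<integral>x. partial_deriv i f x * g x \<partial>lborel)"
proof -
  have d: "f differentiable at x" "g differentiable at x" for x using f g by auto
  have c: "continuous_on UNIV f" "continuous_on UNIV (partial_deriv i f)"
    "continuous_on UNIV g" "continuous_on UNIV (partial_deriv i g)"
    using C_k_continuous[OF f] C_k_continuous[OF g(1)] f g by auto
  have int: "integrable lborel (\<lambda>x. f x * partial_deriv i g x)" "integrable lborel (\<lambda>x. partial_deriv i f x * g x)"
    by (rule integrable_compact_support[OF _ _ compact_cball[of 0 r]];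
        use c g(2) partial_deriv_zero_outside[of r g, OF g(2)] in \<open>simp add: continuous_on_mult\<close>)+
  have "partial_deriv i (\<lambda>x. f x * g x) = (\<lambda>x. f x * partial_deriv i g x + partial_deriv i f x * g x)"
    by (rule ext) (rule partial_deriv_mult[OF d])
  moreover have "integral\<^sup>L lborel (partial_deriv i (\<lambda>x. f x * g x)) = 0"
    by (rule integral_partial_deriv_eq_0[where r=r]) (use C_k_mult[OF f g(1)] g(2) in auto)
  ultimately show ?thesis using int by simp
qed

lemma locally_integrable_continuous:
  assumes "continuous_on UNIV f" shows "locally_integrable \<Omega> f"
  unfolding locally_integrable_def
proof (intro allI impI)
  fix K assume K: "compact K \<and> K \<subseteq> \<Omega>"
  have "integrable lborel (\<lambda>x. indicator K x *\<^sub>R f x)"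
    by (rule borel_integrable_compact) (use K assms continuous_on_subset in auto)
  then show "integrable (lebesgue_on K) f"
    by (subst integrable_restrict_space) (use K in \<open>auto intro: integrable_completion[THEN iffD2]\<close>)
qed

lemma test_function_has_weak_partial:
  assumes "open \<Omega>" "test_function \<Omega> \<phi>"
  shows "has_weak_partial \<Omega> i \<phi> (partial_deriv i \<phi>)"
  unfolding has_weak_partial_def
proof (intro conjI allI impI)
  show "locally_integrable \<Omega> \<phi>" "locally_integrable \<Omega> (partial_deriv i \<phi>)"
    using test_function_C_k[OF assms(2)] by (auto intro: locally_integrable_continuous)
  fix \<psi> assume \<psi>: "test_function \<Omega> \<psi>"
  obtain K r where K: "K \<subseteq> \<Omega>" "K \<subseteq> cball 0 r" "\<And>x. x \<notin> K \<Longrightarrow> \<psi> x = 0"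
    "\<And>i x. x \<notin> K \<Longrightarrow> partial_deriv i \<psi> x = 0" by (rule test_functionE[OF \<psi>]) blast
  have z: "\<psi> x = 0" "partial_deriv i \<psi> x = 0" if "x \<notin> \<Omega>" for x
    using K(1,3,4) that by blast+
  have r: "\<psi> x = 0" if "norm x > r" for x using K that by force
  have "integral\<^sup>L (lebesgue_on \<Omega>) (\<lambda>x. \<phi> x * partial_deriv i \<psi> x) = (\<integral>x. \<phi> x * partial_deriv i \<psi> x \<partial>lborel)"
    using z assms(1) test_function_C_k[OF assms(2)] test_function_C_k[OF \<psi>]
    by (intro integral_lebesgue_on_lborel) auto
  also have "\<dots> = - (\<integral>x. partial_deriv i \<phi> x * \<psi> x \<partial>lborel)"
    by (rule integral_by_parts[OF test_function_C_k(1)[OF assms(2)] test_function_C_k(1)[OF \<psi>] r])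
  also have "(\<integral>x. partial_deriv i \<phi> x * \<psi> x \<partial>lborel) = integral\<^sup>L (lebesgue_on \<Omega>) (\<lambda>x. partial_deriv i \<phi> x * \<psi> x)"
    using z assms(1) test_function_C_k[OF assms(2)] test_function_C_k[OF \<psi>]
    by (intro integral_lebesgue_on_lborel[symmetric]) auto
  finally show "integral\<^sup>L (lebesgue_on \<Omega>) (\<lambda>x. \<phi> x * partial_deriv i \<psi> x) =
    - integral\<^sup>L (lebesgue_on \<Omega>) (\<lambda>x. partial_deriv i \<phi> x * \<psi> x)" .
qed

section \<open>Mollifying sequences and neighbourhoods of compact sets\<close>

lemma is_mollifier_mono: "is_mollifier r \<rho> \<Longrightarrow> r \<le> r' \<Longrightarrow> is_mollifier r' \<rho>"
  by (auto simp: is_mollifier_def)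

text \<open>The same kernels must serve a whole finite family, since a function is mollified
  together with its derivatives. The sum \<open>u\<close> of all errors tends to zero in
  \<open>L1\<close>, so along a subsequence it tends to zero almost everywhere, simultaneously for
  all members.\<close>

lemma mollifier_sequence:
  fixes f :: "'i::finite \<Rightarrow> real^'n::finite \<Rightarrow> real"
  assumes f: "\<And>i. f i \<in> borel_measurable borel" "\<And>i x. \<bar>f i x\<bar> \<le> M" "\<And>i x. norm x > R \<Longrightarrow> f i x = 0"
    and "r > 0"
  obtains \<rho> where "\<And>n. is_mollifier (r / real (Suc n)) (\<rho> n)"
    "\<And>i. AE x in lborel. (\<lambda>n. moll (f i) (\<rho> n) x) \<longlonglongrightarrow> f i x"
    "\<And>i. (\<lambda>n. \<integral>x. \<bar>moll (f i) (\<rho> n) x - f i x\<bar> \<partial>lborel) \<longlonglongrightarrow> 0"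
proof -
  have fi: "integrable lborel (f i)" for i
    by (rule integrable_bounded_support[OF f(1,2), where S="cball 0 R"]) (use f(3) in auto)
  have "\<exists>\<rho>. is_mollifier (r / real (Suc n)) \<rho> \<and>
      (\<forall>i. (\<integral>x. \<bar>moll (f i) \<rho> x - f i x\<bar> \<partial>lborel) < 1 / real (Suc n))" for n
  proof -
    have "\<exists>d>0. \<forall>s \<rho>. is_mollifier s \<rho> \<longrightarrow> s \<le> d \<longrightarrow> (\<integral>x. \<bar>moll (f i) \<rho> x - f i x\<bar> \<partial>lborel) < 1 / real (Suc n)" for i
    proof -
      have e: "1 / real (Suc n) > 0" by simp
      show ?thesis
        by (rule moll_tendsto_L1[where f="f i" and M=M and R=R, OF f(1,2) f(3) e]) auto
    qed
    then obtain d where d: "\<And>i. d i > 0" "\<And>i s \<rho>. is_mollifier s \<rho> \<Longrightarrow> s \<le> d i \<Longrightarrow>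
       (\<integral>x. \<bar>moll (f i) \<rho> x - f i x\<bar> \<partial>lborel) < 1 / real (Suc n)" by metis
    define s where "s = min (r / real (Suc n)) (Min (range d))"
    have "s > 0" using d(1) \<open>r > 0\<close> by (auto simp: s_def)
    then obtain \<rho> :: "real^'n \<Rightarrow> real" where \<rho>: "is_mollifier s \<rho>" using mollifier_exists by blast
    have "s \<le> d i" for i by (simp add: s_def min.coboundedI2)
    then show ?thesis using \<rho> d(2) is_mollifier_mono[OF \<rho>, of "r / real (Suc n)"]
      by (intro exI[of _ \<rho>]) (auto simp: s_def)
  qed
  then obtain \<rho> where \<rho>: "\<And>n. is_mollifier (r / real (Suc n)) (\<rho> n)"
    "\<And>n i. (\<integral>x. \<bar>moll (f i) (\<rho> n) x - f i x\<bar> \<partial>lborel) < 1 / real (Suc n)" by metis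
  have mi: "integrable lborel (moll (f i) (\<rho> n))" for i n by (rule moll_L1_bound(1)[OF fi \<rho>(1)])
  define u where "u n x = (\<Sum>i\<in>UNIV. \<bar>moll (f i) (\<rho> n) x - f i x\<bar>)" for n x
  have ui: "integrable lborel (u n)" for n unfolding u_def using mi fi by simp
  have "(\<integral>x. norm (u n x) \<partial>lborel) = (\<Sum>i\<in>UNIV. \<integral>x. \<bar>moll (f i) (\<rho> n) x - f i x\<bar> \<partial>lborel)" for n
    unfolding u_def using mi fi by (simp add: sum_nonneg)
  then have ub: "(\<integral>x. norm (u n x) \<partial>lborel) \<le> CARD('i) * (1 / real (Suc n))" for n
    using sum_mono[of UNIV "\<lambda>i. \<integral>x. \<bar>moll (f i) (\<rho> n) x - f i x\<bar> \<partial>lborel" "\<lambda>i. 1 / real (Suc n)"] \<rho>(2)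
    by (simp add: less_imp_le)
  have z: "(\<lambda>n. 1 / real (Suc n)) \<longlonglongrightarrow> 0"
    using LIMSEQ_inverse_real_of_nat by (simp add: inverse_eq_divide)
  have "(\<lambda>n. \<integral>x. norm (u n x) \<partial>lborel) \<longlonglongrightarrow> 0"
    by (rule real_tendsto_sandwich[OF _ _ tendsto_const tendsto_mult_right_zero[OF z, of "CARD('i)"]])
       (use ub in auto)
  then obtain k where k: "strict_mono k" "AE x in lborel. (\<lambda>n. u (k n) x) \<longlonglongrightarrow> 0"
    using tendsto_L1_AE_subseq[of lborel u, OF ui] by blast
  show thesis
  proof (rule that[of "\<lambda>n. \<rho> (k n)"])
    \<comment> \<open>A subsequence satisfies \<open>n \<le> k n\<close>, so its radii obey the
      original bound.\<close>
    show "is_mollifier (r / real (Suc n)) (\<rho> (k n))" for n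
      by (rule is_mollifier_mono[OF \<rho>(1)])
         (use seq_suble[OF k(1), of n] \<open>r > 0\<close> in \<open>auto intro!: divide_left_mono\<close>)
    show "AE x in lborel. (\<lambda>n. moll (f i) (\<rho> (k n)) x) \<longlonglongrightarrow> f i x" for i
      using k(2)
    proof eventually_elim
      fix x assume u: "(\<lambda>n. u (k n) x) \<longlonglongrightarrow> 0"
      have "norm (moll (f i) (\<rho> (k n)) x - f i x) \<le> u (k n) x" for n
        unfolding u_def real_norm_def
        by (rule member_le_sum[of i UNIV "\<lambda>i. \<bar>moll (f i) (\<rho> (k n)) x - f i x\<bar>"]) auto
      then have "(\<lambda>n. moll (f i) (\<rho> (k n)) x - f i x) \<longlonglongrightarrow> 0"
        by (intro Lim_null_comparison[OF _ u] always_eventually) auto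
      then show "(\<lambda>n. moll (f i) (\<rho> (k n)) x) \<longlonglongrightarrow> f i x" by (simp add: LIM_zero_iff)
    qed
    have l: "(\<lambda>n. \<integral>x. \<bar>moll (f i) (\<rho> n) x - f i x\<bar> \<partial>lborel) \<longlonglongrightarrow> 0" for i
      by (rule real_tendsto_sandwich[OF _ _ tendsto_const z]) (use \<rho>(2) in \<open>auto simp: less_imp_le\<close>)
    show "(\<lambda>n. \<integral>x. \<bar>moll (f i) (\<rho> (k n)) x - f i x\<bar> \<partial>lborel) \<longlonglongrightarrow> 0" for i
      using LIMSEQ_subseq_LIMSEQ[OF l k(1)] by (simp add: o_def)
  qed
qed

text \<open>The closed \<open>r\<close>-neighbourhood of \<open>K\<close> is written as a sum of two
  compact sets, which makes its compactness immediate.\<close>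

lemma compact_cball_sum:
  fixes K :: "'a::euclidean_space set"
  assumes "compact K" "open \<Omega>" "K \<subseteq> \<Omega>"
  obtains r where "r > 0" "compact {x + y | x y. x \<in> K \<and> y \<in> cball 0 r}" "{x + y | x y. x \<in> K \<and> y \<in> cball 0 r} \<subseteq> \<Omega>"
proof -
  obtain e where e: "e > 0" "(\<Union>x\<in>K. cball x e) \<subseteq> \<Omega>"
    using compact_subset_open_imp_cball_epsilon_subset[OF assms] by metis
  show thesis
  proof (rule that[OF e(1)])
    show "compact {x + y | x y. x \<in> K \<and> y \<in> cball 0 e}"
      by (rule compact_sums[OF assms(1) compact_cball])
    show "{x + y | x y. x \<in> K \<and> y \<in> cball 0 e} \<subseteq> \<Omega>"
    proof clarify
      fix x y :: 'a assume xy: "x \<in> K" "y \<in> cball 0 e"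
      then have "x + y \<in> cball x e" by (simp add: dist_norm)
      then show "x + y \<in> \<Omega>" using e(2) xy by blast
    qed
  qed
qed

lemma cball_subset_of_sum:
  fixes K :: "'a::euclidean_space set"
  assumes "{x + y | x y. x \<in> K \<and> y \<in> cball 0 r} \<subseteq> \<Omega>" "x \<in> K"
  shows "cball x r \<subseteq> \<Omega>"
proof
  fix y assume "y \<in> cball x r"
  then have "y - x \<in> cball 0 r" by (simp add: dist_norm norm_minus_commute)
  moreover have "y = x + (y - x)" by simp
  ultimately show "y \<in> \<Omega>" using assms by blast
qed

lemma moll_support:
  assumes \<rho>: "is_mollifier s \<rho>" "s \<le> r" and f: "\<And>x. x \<notin> K \<Longrightarrow> f x = 0"
    and x: "x \<notin> {x + y | x y. x \<in> K \<and> y \<in> cball 0 r}"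
  shows "moll f \<rho> x = 0"
proof (rule moll_zero[OF \<rho>(1)])
  fix y assume "norm (x - y) < s"
  then have "x - y \<in> cball 0 r" using \<rho>(2) by simp
  moreover have "x = y + (x - y)" by simp
  ultimately have "y \<notin> K" using x by blast
  then show "f y = 0" by (rule f)
qed

lemma moll_test_function:
  fixes f :: "real^'n::finite \<Rightarrow> real"
  assumes f: "integrable lborel f" "\<And>x. x \<notin> K \<Longrightarrow> f x = 0"
   and \<rho>: "is_mollifier s \<rho>" "s \<le> r"
   and r: "compact {x + y | x y. x \<in> K \<and> y \<in> cball 0 r}" "{x + y | x y. x \<in> K \<and> y \<in> cball 0 r} \<subseteq> \<Omega>"
  shows "test_function \<Omega> (moll f \<rho>)"
  by (rule test_functionI[OF C_k_moll[OF f(1) is_mollifierD(1,4)[OF \<rho>(1)]] moll_support[OF \<rho> f(2)] r]) auto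

text \<open>
  Tested with mollifications of \<open>sgn g\<close> restricted to a compact set \<open>K\<close>, the hypothesis gives in the
  limit that \<open>\<bar>g\<bar>\<close> has integral zero over \<open>K\<close>.
\<close>

lemma weakly_zero_imp_AE_zero:
  fixes g :: "real^'n::finite \<Rightarrow> real"
  assumes "open \<Omega>" and g: "locally_integrable \<Omega> g"
    and 0: "\<And>\<psi>. test_function \<Omega> \<psi> \<Longrightarrow> integral\<^sup>L (lebesgue_on \<Omega>) (\<lambda>x. g x * \<psi> x) = 0"
  shows "AE x in lebesgue_on \<Omega>. g x = 0"
proof -
  obtain g' where g': "g' \<in> borel_measurable borel" "\<And>x. x \<notin> \<Omega> \<Longrightarrow> g' x = 0" "AE x in lebesgue_on \<Omega>. g x = g' x"
    using borel_representative[OF _ locally_integrable_measurable[OF assms(1) g]] assms(1) by auto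
  have gm: "g \<in> borel_measurable (lebesgue_on \<Omega>)" by (rule locally_integrable_measurable[OF assms(1) g])
  have bm: "f \<in> borel_measurable (lebesgue_on \<Omega>)" if "f \<in> borel_measurable borel" for f :: "real^'n \<Rightarrow> real"
    using that by (simp add: borel_measurable_lebesgue_on)
  have K0: "AE x in lborel. x \<in> K \<longrightarrow> g' x = 0" if K: "compact K" "K \<subseteq> \<Omega>" for K
  proof -
    obtain r where r: "r > 0" "compact {x + y | x y. x \<in> K \<and> y \<in> cball 0 r}"
      "{x + y | x y. x \<in> K \<and> y \<in> cball 0 r} \<subseteq> \<Omega>" (is "?K' \<subseteq> _")
      by (rule compact_cball_sum[OF K(1) assms(1) K(2)])
    obtain R where R: "K \<subseteq> cball 0 R"
      using compact_imp_bounded[OF K(1)] unfolding bounded_iff by (metis mem_cball_0 subsetI)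
    have Kb: "K \<in> sets borel" "?K' \<in> sets borel" using K r by (auto intro: borel_compact)
    define s where "s x = indicator K x * sgn (g' x)" for x
    have s: "s \<in> borel_measurable borel" "\<bar>s x\<bar> \<le> 1" "norm x > R \<Longrightarrow> s x = 0" "x \<notin> K \<Longrightarrow> s x = 0" for x
      unfolding s_def using g'(1) Kb R by (auto simp: sgn_real_def indicator_def)
    have si: "integrable lborel s"
      by (rule integrable_bounded_support[where S=K, OF s(1,2,4)]) (use K compact_imp_bounded in auto)

    obtain \<rho> where \<rho>: "\<And>n. is_mollifier (r / real (Suc n)) (\<rho> n)"
      "AE x in lborel. (\<lambda>n. moll s (\<rho> n) x) \<longlonglongrightarrow> s x"
      by (rule mollifier_sequence[where f="\<lambda>_::'n. s" and M=1 and R=R and r=r]) (use s r in auto)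
    have rn: "r / real (Suc n) \<le> r" for n using r(1) by (simp add: field_simps)
    have t: "test_function \<Omega> (moll s (\<rho> n))" for n
      by (rule moll_test_function[OF si s(4) \<rho>(1) rn r(2,3)])
    have z: "moll s (\<rho> n) x = 0" if "x \<notin> ?K'" for n x
      by (rule moll_support[OF \<rho>(1) rn s(4) that])
    have b: "\<bar>moll s (\<rho> n) x\<bar> \<le> 1" for n x
      using moll_close[OF si \<rho>(1), of x n 0 1] s(2) by simp
    have zero: "(\<integral>x. g' x * moll s (\<rho> n) x \<partial>lborel) = 0" for n
    proof -
      have "(\<integral>x. g' x * moll s (\<rho> n) x \<partial>lborel) = integral\<^sup>L (lebesgue_on \<Omega>) (\<lambda>x. g' x * moll s (\<rho> n) x)"
        by (rule integral_lebesgue_on_lborel[symmetric])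
           (use g' assms(1) test_function_C_k(6)[OF t] in auto)
      also have "\<dots> = integral\<^sup>L (lebesgue_on \<Omega>) (\<lambda>x. g x * moll s (\<rho> n) x)"
        using g'(3) gm bm[OF g'(1)] bm[OF test_function_C_k(6)[OF t]]
        by (intro integral_cong_AE) auto
      finally show ?thesis using 0[OF t] by simp
    qed
    have gi: "integrable lborel (\<lambda>x. indicator ?K' x * \<bar>g' x\<bar>)"
    proof -
      have "integrable (lebesgue_on ?K') g" using g r by (simp add: locally_integrable_def)
      then have "integrable (lebesgue_on ?K') (\<lambda>x. \<bar>g x\<bar>)" by simp
      moreover have "AE x in lebesgue_on ?K'. \<bar>g x\<bar> = \<bar>g' x\<bar>"
      proof -
        have "AE x in lborel. x \<in> ?K' \<longrightarrow> \<bar>g x\<bar> = \<bar>g' x\<bar>"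
          using g'(3)[unfolded AE_lebesgue_on_iff[OF open_sets_lebesgue[OF assms(1)]]]
          by eventually_elim (use r(3) in auto)
        then show ?thesis using AE_lebesgue_on_iff[OF compact_sets_lebesgue[OF r(2)]] by blast
      qed
      moreover have "(\<lambda>x. \<bar>g' x\<bar>) \<in> borel_measurable (lebesgue_on ?K')"
        using g'(1) by (simp add: borel_measurable_lebesgue_on)
      ultimately have "integrable (lebesgue_on ?K') (\<lambda>x. \<bar>g' x\<bar>)"
        using integrable_cong_AE_imp by blast
      then show ?thesis
        by (subst (asm) integrable_lebesgue_on_lborel[where g="\<lambda>x. indicator ?K' x * \<bar>g' x\<bar>"])
           (use Kb g' r(2) in auto)
    qed
    have "(\<lambda>n. \<integral>x. g' x * moll s (\<rho> n) x \<partial>lborel) \<longlonglongrightarrow> (\<integral>x. g' x * s x \<partial>lborel)"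
    proof (rule integral_dominated_convergence[OF _ _ gi])
      show "(\<lambda>x. g' x * s x) \<in> borel_measurable lborel" using g' s(1) by simp
      show "(\<lambda>x. g' x * moll s (\<rho> n) x) \<in> borel_measurable lborel" for n
        using g'(1) test_function_C_k(6)[OF t] by simp
      show "AE x in lborel. (\<lambda>n. g' x * moll s (\<rho> n) x) \<longlonglongrightarrow> g' x * s x"
        using \<rho>(2) by eventually_elim (rule tendsto_mult_left)
      show "AE x in lborel. norm (g' x * moll s (\<rho> n) x) \<le> indicator ?K' x * \<bar>g' x\<bar>" for n
      proof (rule AE_I2)
        show "norm (g' x * moll s (\<rho> n) x) \<le> indicator ?K' x * \<bar>g' x\<bar>" for x
          using z[of x n] mult_left_mono[OF b[of n x] abs_ge_zero[of "g' x"]]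
          by (cases "x \<in> ?K'") (auto simp: abs_mult)
      qed
    qed
    then have "(\<integral>x. g' x * s x \<partial>lborel) = 0" by (simp add: zero LIMSEQ_const_iff)
    moreover have gs: "g' x * s x = indicator K x * \<bar>g' x\<bar>" for x
      by (simp add: s_def abs_sgn)
    have KK: "K \<subseteq> ?K'"
    proof
      fix x assume "x \<in> K"
      then have "x = x + 0 \<and> x \<in> K \<and> 0 \<in> cball (0::real^'n) r" using r(1) by simp
      then show "x \<in> ?K'" by blast
    qed
    moreover have "integrable lborel (\<lambda>x. indicator K x * \<bar>g' x\<bar>)"
      by (rule Bochner_Integration.integrable_bound[OF gi]) (use g' Kb KK in \<open>auto simp: indicator_def intro!: AE_I2\<close>)
    ultimately have "AE x in lborel. indicator K x * \<bar>g' x\<bar> = 0"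
      by (subst (asm) gs, subst (asm) integral_nonneg_eq_0_iff_AE) auto
    then show ?thesis by eventually_elim (auto split: if_splits)
  qed
  obtain D where D: "countable D" "D \<subseteq> Pow \<Omega>" "\<And>X. X \<in> D \<Longrightarrow> \<exists>a b. X = cbox a b" "\<Union>D = \<Omega>"
    using open_countable_Union_open_cbox[OF assms(1)] by metis
  have "AE x in lborel. \<forall>X\<in>D. x \<in> X \<longrightarrow> g' x = 0"
    using K0 D by (subst AE_ball_countable[OF D(1)]) (metis PowD compact_cbox subsetD)
  then have "AE x in lebesgue_on \<Omega>. g' x = 0"
    unfolding AE_lebesgue_on_iff[OF open_sets_lebesgue[OF assms(1)]]
    by eventually_elim (use D in auto)
  with g'(3) show ?thesis by eventually_elim auto
qed

section \<open>Uniqueness and mollification of weak derivatives\<close>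

lemma locally_integrable_diff:
  "locally_integrable \<Omega> u \<Longrightarrow> locally_integrable \<Omega> v \<Longrightarrow> locally_integrable \<Omega> (\<lambda>x. u x - v x)"
  by (auto simp: locally_integrable_def)

lemma has_weak_partial_diff:
  assumes "open \<Omega>" "has_weak_partial \<Omega> i u g" "has_weak_partial \<Omega> i v h"
  shows "has_weak_partial \<Omega> i (\<lambda>x. u x - v x) (\<lambda>x. g x - h x)"
proof -
  have l: "locally_integrable \<Omega> u" "locally_integrable \<Omega> g" "locally_integrable \<Omega> v" "locally_integrable \<Omega> h"
    using assms by (auto simp: has_weak_partial_def)
  show ?thesis
    using assms(2,3) locally_integrable_mult_test[OF l(1) assms(1)] locally_integrable_mult_test[OF l(2) assms(1)]
      locally_integrable_mult_test[OF l(3) assms(1)] locally_integrable_mult_test[OF l(4) assms(1)]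
    by (auto simp: has_weak_partial_def locally_integrable_diff left_diff_distrib)
qed

lemma AE_lebesgue_on_subset:
  assumes "AE x in lebesgue_on S. P x" "K \<subseteq> S" "S \<in> sets lebesgue" "K \<in> sets lebesgue"
  shows "AE x in lebesgue_on K. P x"
  using assms(1) unfolding AE_lebesgue_on_iff[OF assms(3)] AE_lebesgue_on_iff[OF assms(4)]
  by eventually_elim (use assms(2) in auto)

lemma locally_integrable_cong_AE:
  assumes "open \<Omega>" "locally_integrable \<Omega> u" "AE x in lebesgue_on \<Omega>. u x = v x" "v \<in> borel_measurable (lebesgue_on \<Omega>)"
  shows "locally_integrable \<Omega> v"
  unfolding locally_integrable_def
proof (intro allI impI)
  fix K assume K: "compact K \<and> K \<subseteq> \<Omega>"
  then have u: "integrable (lebesgue_on K) u" using assms(2) by (simp add: locally_integrable_def)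
  show "integrable (lebesgue_on K) v"
  proof (rule integrable_cong_AE_imp[OF u])
    show "v \<in> borel_measurable (lebesgue_on K)"
      by (rule lebesgue_on_subset_measurable[OF assms(4)]) (use K assms(1) in auto)
    show "AE x in lebesgue_on K. u x = v x"
      by (rule AE_lebesgue_on_subset[OF assms(3)]) (use K assms(1) in auto)
  qed
qed

lemma has_weak_partial_cong_AE:
  assumes "open \<Omega>" "has_weak_partial \<Omega> i u g"
    and v: "AE x in lebesgue_on \<Omega>. u x = v x" "v \<in> borel_measurable (lebesgue_on \<Omega>)"
    and h: "AE x in lebesgue_on \<Omega>. g x = h x" "h \<in> borel_measurable (lebesgue_on \<Omega>)"
  shows "has_weak_partial \<Omega> i v h"
proof -
  have l: "locally_integrable \<Omega> u" "locally_integrable \<Omega> g"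
    using assms by (auto simp: has_weak_partial_def)
  have m: "u \<in> borel_measurable (lebesgue_on \<Omega>)" "g \<in> borel_measurable (lebesgue_on \<Omega>)"
    using l locally_integrable_measurable assms(1) by auto
  have "integral\<^sup>L (lebesgue_on \<Omega>) (\<lambda>x. v x * partial_deriv i \<phi> x) = - integral\<^sup>L (lebesgue_on \<Omega>) (\<lambda>x. h x * \<phi> x)"
    if \<phi>: "test_function \<Omega> \<phi>" for \<phi>
  proof -
    have pm: "\<phi> \<in> borel_measurable (lebesgue_on \<Omega>)" "partial_deriv i \<phi> \<in> borel_measurable (lebesgue_on \<Omega>)"
      using test_function_C_k(6,7)[OF \<phi>] by (simp_all add: borel_measurable_lebesgue_on)
    have "integral\<^sup>L (lebesgue_on \<Omega>) (\<lambda>x. v x * partial_deriv i \<phi> x) = integral\<^sup>L (lebesgue_on \<Omega>) (\<lambda>x. u x * partial_deriv i \<phi> x)"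
      using v m pm by (intro integral_cong_AE) auto
    moreover have "integral\<^sup>L (lebesgue_on \<Omega>) (\<lambda>x. h x * \<phi> x) = integral\<^sup>L (lebesgue_on \<Omega>) (\<lambda>x. g x * \<phi> x)"
      using h m pm by (intro integral_cong_AE) auto
    ultimately show ?thesis using assms(2) \<phi> by (simp add: has_weak_partial_def)
  qed
  then show ?thesis unfolding has_weak_partial_def
    using locally_integrable_cong_AE[OF assms(1) l(1) v] locally_integrable_cong_AE[OF assms(1) l(2) h] by blast
qed

text \<open>This tames the choice in \<open>weak_partial\<close>: up to a null set the chosen
  derivative is any derivative that can be written down explicitly.\<close>

lemma has_weak_partial_unique:
  assumes "open \<Omega>" "has_weak_partial \<Omega> i u g" "has_weak_partial \<Omega> i v h" "AE x in lebesgue_on \<Omega>. u x = v x"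
  shows "AE x in lebesgue_on \<Omega>. g x = h x"
proof -
  have l: "locally_integrable \<Omega> u" "locally_integrable \<Omega> g" "locally_integrable \<Omega> v" "locally_integrable \<Omega> h"
    using assms by (auto simp: has_weak_partial_def)
  have m: "u \<in> borel_measurable (lebesgue_on \<Omega>)" "v \<in> borel_measurable (lebesgue_on \<Omega>)"
    using l locally_integrable_measurable assms(1) by auto
  have "AE x in lebesgue_on \<Omega>. g x - h x = 0"
  proof (rule weakly_zero_imp_AE_zero[OF assms(1) locally_integrable_diff[OF l(2,4)]])
    fix \<psi> assume \<psi>: "test_function \<Omega> \<psi>"
    have pm: "partial_deriv i \<psi> \<in> borel_measurable (lebesgue_on \<Omega>)"
      using test_function_C_k(7)[OF \<psi>] by (simp add: borel_measurable_lebesgue_on)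
    have "integral\<^sup>L (lebesgue_on \<Omega>) (\<lambda>x. (u x - v x) * partial_deriv i \<psi> x) = integral\<^sup>L (lebesgue_on \<Omega>) (\<lambda>x. 0)"
      using assms(4) m pm by (intro integral_cong_AE) auto
    then show "integral\<^sup>L (lebesgue_on \<Omega>) (\<lambda>x. (g x - h x) * \<psi> x) = 0"
      using has_weak_partial_diff[OF assms(1-3)] \<psi> by (simp add: has_weak_partial_def)
  qed
  then show ?thesis by simp
qed

text \<open>When the ball around \<open>x\<close> lies in \<open>\<Omega>\<close>, the function
  \<open>y \<mapsto> \<rho> (x - y)\<close> is a test function and can be inserted into the
  definition of the weak derivative. The sign from the reflection cancels the one from the
  integration by parts.\<close>

lemma partial_deriv_moll_weak:
  fixes u g :: "real^'n::finite \<Rightarrow> real"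
  assumes "open \<Omega>" "has_weak_partial \<Omega> i u g" "integrable lborel u" "integrable lborel g"
    and \<rho>: "is_mollifier r \<rho>" and x: "cball x r \<subseteq> \<Omega>"
  shows "partial_deriv i (moll u \<rho>) x = moll g \<rho> x"
proof -
  define \<psi> where "\<psi> y = \<rho> (- 1 *\<^sub>R y + x)" for y
  have d: "\<rho> differentiable at y" for y using is_mollifierD(1)[OF \<rho>, of 1] by simp
  have \<psi>x: "\<psi> y = \<rho> (x - y)" for y by (simp add: \<psi>_def)
  have z: "\<psi> y = 0" if "y \<notin> cball x r" for y
    using is_mollifierD(3)[OF \<rho>, of "x - y"] that by (simp add: \<psi>x dist_norm)
  have t: "test_function \<Omega> \<psi>"
    by (rule test_functionI[OF _ z compact_cball x])
       (use C_k_affine[OF is_mollifierD(1)[OF \<rho>], of _ "-1" x] in \<open>simp add: \<psi>_def\<close>)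
  have p: "partial_deriv i \<psi> y = - partial_deriv i \<rho> (x - y)" for y
    using partial_deriv_affine[OF d, of i "- 1" x y] unfolding \<psi>_def[abs_def] by simp
  have z': "partial_deriv i \<psi> y = 0" if "y \<notin> cball x r" for y
    by (rule partial_deriv_zero_off_closed[OF z closed_cball that])
  have z0: "\<psi> y = 0" "partial_deriv i \<psi> y = 0" if "y \<notin> \<Omega>" for y
    using that x z z' by blast+
  have um: "u \<in> borel_measurable borel" "g \<in> borel_measurable borel" using assms(3,4) by auto
  have "partial_deriv i (moll u \<rho>) x = moll u (partial_deriv i \<rho>) x"
    by (subst partial_deriv_moll[OF assms(3) is_mollifierD(1,4)[OF \<rho>]]) auto
  also have "\<dots> = - (\<integral>y. u y * partial_deriv i \<psi> y \<partial>lborel)" by (simp add: moll_def p)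
  also have "(\<integral>y. u y * partial_deriv i \<psi> y \<partial>lborel) = integral\<^sup>L (lebesgue_on \<Omega>) (\<lambda>y. u y * partial_deriv i \<psi> y)"
    by (rule integral_lebesgue_on_lborel[symmetric]) (use um assms(1) z0 test_function_C_k(7)[OF t] in auto)
  also have "\<dots> = - integral\<^sup>L (lebesgue_on \<Omega>) (\<lambda>y. g y * \<psi> y)"
    using assms(2) t by (simp add: has_weak_partial_def)
  also have "integral\<^sup>L (lebesgue_on \<Omega>) (\<lambda>y. g y * \<psi> y) = (\<integral>y. g y * \<psi> y \<partial>lborel)"
    by (rule integral_lebesgue_on_lborel) (use um assms(1) z0 test_function_C_k(6)[OF t] in auto)
  also have "(\<integral>y. g y * \<psi> y \<partial>lborel) = moll g \<rho> x" by (simp add: moll_def \<psi>x)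
  finally show ?thesis by simp
qed

section \<open>The space of Sobolev functions with zero trace\<close>

lemma L2_D:
  assumes "u \<in> L2 \<Omega>"
  shows "u \<in> borel_measurable (lebesgue_on \<Omega>)" "integrable (lebesgue_on \<Omega>) (\<lambda>x. (u x)\<^sup>2)"
  using assms by (auto simp: L2_def)

lemma L2_mult_integrable:
  assumes "u \<in> L2 \<Omega>" "v \<in> L2 \<Omega>"
  shows "integrable (lebesgue_on \<Omega>) (\<lambda>x. u x * v x)"
proof (rule Bochner_Integration.integrable_bound)
  show "integrable (lebesgue_on \<Omega>) (\<lambda>x. (u x)\<^sup>2 + (v x)\<^sup>2)"
    by (intro Bochner_Integration.integrable_add L2_D(2) assms)
  show "(\<lambda>x. u x * v x) \<in> borel_measurable (lebesgue_on \<Omega>)"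
    by (intro borel_measurable_times L2_D(1) assms)
  show "AE x in lebesgue_on \<Omega>. norm (u x * v x) \<le> norm ((u x)\<^sup>2 + (v x)\<^sup>2)"
  proof (rule AE_I2)
    fix x
    have "2 * (\<bar>u x\<bar> * \<bar>v x\<bar>) \<le> (u x)\<^sup>2 + (v x)\<^sup>2"
      using sum_squares_bound[of "\<bar>u x\<bar>" "\<bar>v x\<bar>"] by (simp add: mult.assoc)
    moreover have "\<bar>u x\<bar> * \<bar>v x\<bar> \<ge> 0" by simp
    ultimately show "norm (u x * v x) \<le> norm ((u x)\<^sup>2 + (v x)\<^sup>2)"
      unfolding real_norm_def abs_mult by linarith
  qed
qed

lemma L2_scale: "u \<in> L2 \<Omega> \<Longrightarrow> (\<lambda>x. c * u x) \<in> L2 \<Omega>"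
  by (auto simp: L2_def power_mult_distrib)

lemma L2_add:
  assumes "u \<in> L2 \<Omega>" "v \<in> L2 \<Omega>"
  shows "(\<lambda>x. u x + v x) \<in> L2 \<Omega>"
  using L2_D[OF assms(1)] L2_D[OF assms(2)] L2_mult_integrable[OF assms]
  by (auto simp: L2_def power2_sum mult.assoc)

lemma L2_diff: "u \<in> L2 \<Omega> \<Longrightarrow> v \<in> L2 \<Omega> \<Longrightarrow> (\<lambda>x. u x - v x) \<in> L2 \<Omega>"
  using L2_add[OF _ L2_scale[of v \<Omega> "-1"]] by simp

lemma L2_sum: "(\<And>i. i \<in> I \<Longrightarrow> f i \<in> L2 \<Omega>) \<Longrightarrow> (\<lambda>x. \<Sum>i\<in>I. f i x) \<in> L2 \<Omega>"
  by (induction I rule: infinite_finite_induct) (simp_all add: L2_add, simp_all add: L2_def)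

lemma L2_cong_AE:
  assumes "u \<in> L2 \<Omega>" "AE x in lebesgue_on \<Omega>. u x = v x" "v \<in> borel_measurable (lebesgue_on \<Omega>)"
  shows "v \<in> L2 \<Omega>"
proof -
  have "integrable (lebesgue_on \<Omega>) (\<lambda>x. (v x)\<^sup>2)"
    by (rule integrable_cong_AE_imp[OF L2_D(2)[OF assms(1)]]) (use assms in auto)
  then show ?thesis using assms by (simp add: L2_def)
qed

lemma L2_bounded_mult:
  assumes u: "u \<in> L2 \<Omega>" and b: "b \<in> borel_measurable (lebesgue_on \<Omega>)" "\<And>x. x \<in> \<Omega> \<Longrightarrow> \<bar>b x\<bar> \<le> B"
  shows "(\<lambda>x. u x * b x) \<in> L2 \<Omega>"
proof -
  have "integrable (lebesgue_on \<Omega>) (\<lambda>x. (u x * b x)\<^sup>2)"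
  proof (rule Bochner_Integration.integrable_bound)
    show "integrable (lebesgue_on \<Omega>) (\<lambda>x. B\<^sup>2 * (u x)\<^sup>2)" using L2_D[OF u] by simp
    show "(\<lambda>x. (u x * b x)\<^sup>2) \<in> borel_measurable (lebesgue_on \<Omega>)" using L2_D[OF u] b by simp
    show "AE x in lebesgue_on \<Omega>. norm ((u x * b x)\<^sup>2) \<le> norm (B\<^sup>2 * (u x)\<^sup>2)"
    proof (rule AE_I2)
      fix x assume "x \<in> space (lebesgue_on \<Omega>)"
      then have "(b x)\<^sup>2 \<le> B\<^sup>2" using b(2)[of x] by (auto intro: abs_le_square_iff[THEN iffD1] order_trans)
      then show "norm ((u x * b x)\<^sup>2) \<le> norm (B\<^sup>2 * (u x)\<^sup>2)"
        by (simp add: power_mult_distrib mult.commute mult_right_mono)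
    qed
  qed
  then show ?thesis using L2_D[OF u] b by (simp add: L2_def)
qed

lemma L2_norm_square: "(L2_norm \<Omega> u)\<^sup>2 = integral\<^sup>L (lebesgue_on \<Omega>) (\<lambda>x. (u x)\<^sup>2)"
  by (simp add: L2_norm_def L2_inner_def power2_eq_square[symmetric])

lemma L2_norm_nonneg [simp]: "L2_norm \<Omega> u \<ge> 0"
  by (simp add: L2_norm_def L2_inner_def)

lemma L2_norm_cong_AE:
  assumes "u \<in> borel_measurable (lebesgue_on \<Omega>)" "v \<in> borel_measurable (lebesgue_on \<Omega>)" "AE x in lebesgue_on \<Omega>. u x = v x"
  shows "L2_norm \<Omega> u = L2_norm \<Omega> v"
proof -
  have "integral\<^sup>L (lebesgue_on \<Omega>) (\<lambda>x. u x * u x) = integral\<^sup>L (lebesgue_on \<Omega>) (\<lambda>x. v x * v x)"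
    by (rule integral_cong_AE) (use assms in auto)
  then show ?thesis by (simp add: L2_norm_def L2_inner_def)
qed

lemma L2_norm_eq_0_iff:
  assumes "u \<in> L2 \<Omega>" shows "L2_norm \<Omega> u = 0 \<longleftrightarrow> (AE x in lebesgue_on \<Omega>. u x = 0)"
  using integral_nonneg_eq_0_iff_AE[OF L2_D(2)[OF assms]] L2_norm_square[of \<Omega> u] by auto

lemma L2_Cauchy_Schwarz:
  assumes u: "u \<in> L2 \<Omega>" and v: "v \<in> L2 \<Omega>"
  shows "L2_inner \<Omega> u v \<le> L2_norm \<Omega> u * L2_norm \<Omega> v"
proof (cases "L2_norm \<Omega> u = 0 \<or> L2_norm \<Omega> v = 0")
  case True
  then have "AE x in lebesgue_on \<Omega>. u x * v x = 0"
    using L2_norm_eq_0_iff[OF u] L2_norm_eq_0_iff[OF v] by (auto elim: eventually_mono)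
  then have "L2_inner \<Omega> u v = integral\<^sup>L (lebesgue_on \<Omega>) (\<lambda>x. 0)"
    unfolding L2_inner_def using L2_D u v by (intro integral_cong_AE) (auto intro: borel_measurable_times)
  then show ?thesis by simp
next
  case False
  define s t where "s = L2_norm \<Omega> u" and "t = L2_norm \<Omega> v"
  have st: "s > 0" "t > 0" using False by (auto simp: s_def t_def less_le)
  \<comment> \<open>With \<open>s\<close> and \<open>t\<close> the norms of \<open>u\<close> and
    \<open>v\<close>, both square terms become \<open>t\<^sup>2 * s\<^sup>2\<close>, and dividing by
    \<open>2 * s * t\<close> leaves the inequality.\<close>
  have "0 \<le> integral\<^sup>L (lebesgue_on \<Omega>) (\<lambda>x. (t * u x - s * v x)\<^sup>2)" by simp
  also have "(\<lambda>x. (t * u x - s * v x)\<^sup>2) = (\<lambda>x. t\<^sup>2 * (u x)\<^sup>2 + s\<^sup>2 * (v x)\<^sup>2 - 2 * t * s * (u x * v x))"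
    by (auto simp: power2_diff power_mult_distrib)
  also have "integral\<^sup>L (lebesgue_on \<Omega>) \<dots> = t\<^sup>2 * s\<^sup>2 + s\<^sup>2 * t\<^sup>2 - 2 * t * s * L2_inner \<Omega> u v"
    using L2_D(2)[OF u] L2_D(2)[OF v] L2_mult_integrable[OF u v]
    by (simp add: s_def t_def L2_norm_square L2_inner_def)
  finally have "(2 * (s * t)) * L2_inner \<Omega> u v \<le> (2 * (s * t)) * (s * t)"
    by (simp add: power2_eq_square algebra_simps)
  then show ?thesis using st by (simp add: s_def t_def)
qed

lemma L2_Cauchy_Schwarz_abs:
  assumes u: "u \<in> L2 \<Omega>" and v: "v \<in> L2 \<Omega>"
  shows "\<bar>L2_inner \<Omega> u v\<bar> \<le> L2_norm \<Omega> u * L2_norm \<Omega> v"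
  using L2_Cauchy_Schwarz[OF u v] L2_Cauchy_Schwarz[OF L2_scale[OF u, of "-1"] v]
  by (simp add: L2_norm_def L2_inner_def)

lemma L2_inner_diff_left:
  assumes "u \<in> L2 \<Omega>" "v \<in> L2 \<Omega>" "w \<in> L2 \<Omega>"
  shows "L2_inner \<Omega> (\<lambda>x. u x - v x) w = L2_inner \<Omega> u w - L2_inner \<Omega> v w"
  unfolding L2_inner_def left_diff_distrib
  by (rule Bochner_Integration.integral_diff) (intro L2_mult_integrable assms)+

lemma L2_continuous_compact_support:
  fixes f :: "real^'n::finite \<Rightarrow> real"
  assumes "open \<Omega>" "continuous_on UNIV f" "\<And>x. x \<notin> K \<Longrightarrow> f x = 0" "compact K" "K \<subseteq> \<Omega>"
  shows "f \<in> L2 \<Omega>"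
proof -
  have m: "f \<in> borel_measurable borel" by (rule borel_measurable_continuous_onI[OF assms(2)])
  have "integrable lborel (\<lambda>x. (f x)\<^sup>2)"
    by (rule integrable_compact_support[OF _ _ assms(4)]) (use assms in \<open>auto intro: continuous_intros\<close>)
  then have "integrable (lebesgue_on \<Omega>) (\<lambda>x. (f x)\<^sup>2)"
    by (subst integrable_lebesgue_on_lborel) (use assms m in auto)
  then show ?thesis using m by (simp add: L2_def borel_measurable_lebesgue_on)
qed

lemma L2_test_function:
  assumes "open \<Omega>" "test_function \<Omega> \<phi>"
  shows "\<phi> \<in> L2 \<Omega>" "partial_deriv i \<phi> \<in> L2 \<Omega>"
proof -
  obtain K r where K: "compact K" "K \<subseteq> \<Omega>" "\<And>x. x \<notin> K \<Longrightarrow> \<phi> x = 0"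
    "\<And>i x. x \<notin> K \<Longrightarrow> partial_deriv i \<phi> x = 0" by (rule test_functionE[OF assms(2)]) blast
  show "\<phi> \<in> L2 \<Omega>"
    by (rule L2_continuous_compact_support[OF assms(1) test_function_C_k(3)[OF assms(2)] K(3,1,2)])
  show "partial_deriv i \<phi> \<in> L2 \<Omega>"
    by (rule L2_continuous_compact_support[OF assms(1) test_function_C_k(4)[OF assms(2)] K(4,1,2)])
qed

text \<open>On a compact set constants are integrable, and
  \<open>\<bar>u x\<bar> \<le> 1 + (u x)\<^sup>2\<close>.\<close>

lemma L2_locally_integrable:
  assumes "open \<Omega>" "u \<in> L2 \<Omega>"
  shows "locally_integrable \<Omega> u"
  unfolding locally_integrable_def
proof (intro allI impI)
  fix K assume K: "compact K \<and> K \<subseteq> \<Omega>"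
  then have Kl: "K \<in> sets lebesgue" by simp
  have "integrable (lebesgue_on \<Omega>) (\<lambda>x. indicator K x *\<^sub>R (u x)\<^sup>2)"
    by (rule integrable_mult_indicator)
       (use L2_D[OF assms(2)] K assms(1) in \<open>auto simp: sets_restrict_space_iff\<close>)
  then have "integrable lebesgue (\<lambda>x. indicator \<Omega> x *\<^sub>R indicator K x *\<^sub>R (u x)\<^sup>2)"
    by (subst (asm) integrable_restrict_space) (use assms(1) in auto)
  moreover have "(\<lambda>x. indicator \<Omega> x *\<^sub>R indicator K x *\<^sub>R (u x)\<^sup>2) = (\<lambda>x. indicator K x *\<^sub>R (u x)\<^sup>2)"
    using K by (auto simp: fun_eq_iff indicator_def)
  ultimately have u2: "integrable (lebesgue_on K) (\<lambda>x. (u x)\<^sup>2)"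
    by (subst integrable_restrict_space) (use Kl in auto)
  have "emeasure (lebesgue_on K) (space (lebesgue_on K)) < \<infinity>"
    using K Kl fmeasurableD2[OF lmeasurable_compact[of K]]
    by (simp add: emeasure_restrict_space top.not_eq_extremum del: emeasure_completion)
  then have c: "integrable (lebesgue_on K) (\<lambda>x. 1 :: real)"
    by (intro finite_measure.integrable_const finite_measureI) auto
  show "integrable (lebesgue_on K) u"
  proof (rule Bochner_Integration.integrable_bound)
    show "integrable (lebesgue_on K) (\<lambda>x. 1 + (u x)\<^sup>2)" using c u2 by simp
    show "u \<in> borel_measurable (lebesgue_on K)"
      by (rule lebesgue_on_subset_measurable[OF L2_D(1)[OF assms(2)]]) (use K assms(1) in auto)
    show "AE x in lebesgue_on K. norm (u x) \<le> norm (1 + (u x)\<^sup>2)"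
    proof (rule AE_I2)
      fix x
      have "2 * \<bar>u x\<bar> \<le> 1 + (u x)\<^sup>2" using sum_squares_bound[of 1 "\<bar>u x\<bar>"] by simp
      then show "norm (u x) \<le> norm (1 + (u x)\<^sup>2)" unfolding real_norm_def by linarith
    qed
  qed
qed

text \<open>
  \<open>u\<close> belongs to \<open>H10 \<Omega>\<close> and has the weak gradient \<open>g\<close>. Unlike \<open>H10\<close> and \<open>weak_partial\<close>, this
  predicate involves no choice operator and is directly stable under composition.
\<close>

definition H10_grad :: "(real^'n::finite) set \<Rightarrow> (real^'n \<Rightarrow> real) \<Rightarrow> ('n \<Rightarrow> real^'n \<Rightarrow> real) \<Rightarrow> bool" where
  "H10_grad \<Omega> u g \<longleftrightarrow> u \<in> L2 \<Omega> \<and> (\<forall>i. g i \<in> L2 \<Omega>) \<and>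
    (\<forall>e>0. \<exists>\<phi>. test_function \<Omega> \<phi> \<and> L2_norm \<Omega> (\<lambda>x. u x - \<phi> x) < e \<and>
       (\<forall>i. L2_norm \<Omega> (\<lambda>x. g i x - partial_deriv i \<phi> x) < e))"

text \<open>The defining identity holds for the approximating test functions, and both of its sides
  are continuous in the \<open>L2\<close> norm by the Cauchy-Schwarz inequality. \<open>X\<close> is
  the defect of the identity, \<open>C\<close> the constant of continuity.\<close>

lemma H10_grad_has_weak_partial:
  fixes \<Omega> :: "(real^'n::finite) set"
  assumes "open \<Omega>" "H10_grad \<Omega> u g"
  shows "has_weak_partial \<Omega> i u (g i)"
  unfolding has_weak_partial_def
proof (intro conjI allI impI)
  have u: "u \<in> L2 \<Omega>" "g i \<in> L2 \<Omega>" using assms(2) by (auto simp: H10_grad_def)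
  show "locally_integrable \<Omega> u" "locally_integrable \<Omega> (g i)"
    using L2_locally_integrable[OF assms(1)] u by auto
  fix \<psi> assume \<psi>: "test_function \<Omega> \<psi>"
  have p: "\<psi> \<in> L2 \<Omega>" "partial_deriv i \<psi> \<in> L2 \<Omega>" using L2_test_function[OF assms(1) \<psi>] by auto
  define X where "X = L2_inner \<Omega> u (partial_deriv i \<psi>) + L2_inner \<Omega> (g i) \<psi>"
  define C where "C = L2_norm \<Omega> (partial_deriv i \<psi>) + L2_norm \<Omega> \<psi>"
  have C: "C \<ge> 0" by (simp add: C_def)
  have small: "\<bar>X\<bar> \<le> e * C" if "e > 0" for e
  proof -
    obtain \<phi> where \<phi>: "test_function \<Omega> \<phi>" "L2_norm \<Omega> (\<lambda>x. u x - \<phi> x) < e"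
      "L2_norm \<Omega> (\<lambda>x. g i x - partial_deriv i \<phi> x) < e"
      using assms(2) \<open>e > 0\<close> unfolding H10_grad_def by blast
    have f: "\<phi> \<in> L2 \<Omega>" "partial_deriv i \<phi> \<in> L2 \<Omega>" using L2_test_function[OF assms(1) \<phi>(1)] by auto
    have "L2_inner \<Omega> \<phi> (partial_deriv i \<psi>) + L2_inner \<Omega> (partial_deriv i \<phi>) \<psi> = 0"
      using test_function_has_weak_partial[OF assms(1) \<phi>(1), of i] \<psi>
      by (simp add: has_weak_partial_def L2_inner_def)
    moreover have "L2_inner \<Omega> (\<lambda>x. u x - \<phi> x) (partial_deriv i \<psi>) = L2_inner \<Omega> u (partial_deriv i \<psi>) - L2_inner \<Omega> \<phi> (partial_deriv i \<psi>)"
      by (rule L2_inner_diff_left[OF u(1) f(1) p(2)])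
    moreover have "L2_inner \<Omega> (\<lambda>x. g i x - partial_deriv i \<phi> x) \<psi> = L2_inner \<Omega> (g i) \<psi> - L2_inner \<Omega> (partial_deriv i \<phi>) \<psi>"
      by (rule L2_inner_diff_left[OF u(2) f(2) p(1)])
    ultimately have "X = L2_inner \<Omega> (\<lambda>x. u x - \<phi> x) (partial_deriv i \<psi>) + L2_inner \<Omega> (\<lambda>x. g i x - partial_deriv i \<phi> x) \<psi>"
      by (simp add: X_def)
    also have "\<bar>\<dots>\<bar> \<le> L2_norm \<Omega> (\<lambda>x. u x - \<phi> x) * L2_norm \<Omega> (partial_deriv i \<psi>)
        + L2_norm \<Omega> (\<lambda>x. g i x - partial_deriv i \<phi> x) * L2_norm \<Omega> \<psi>"
      by (rule order_trans[OF abs_triangle_ineq add_mono])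
         (intro L2_Cauchy_Schwarz_abs L2_diff u f p)+
    also have "\<dots> \<le> e * C"
      unfolding C_def distrib_left using \<phi> by (intro add_mono mult_right_mono) auto
    finally show ?thesis .
  qed
  have "X = 0"
  proof (rule ccontr)
    assume "X \<noteq> 0"
    then have "\<bar>X\<bar> \<le> \<bar>X\<bar> / (C + 1) * C" using C by (intro small) auto
    also have "\<dots> < \<bar>X\<bar>" using C \<open>X \<noteq> 0\<close> by (simp add: field_simps)
    finally show False by simp
  qed
  then show "integral\<^sup>L (lebesgue_on \<Omega>) (\<lambda>x. u x * partial_deriv i \<psi> x) = - integral\<^sup>L (lebesgue_on \<Omega>) (\<lambda>x. g i x * \<psi> x)"
    by (simp add: X_def L2_inner_def)
qed

lemma weak_partial_AE_eq:
  assumes "open \<Omega>" "has_weak_partial \<Omega> i u g"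
  shows "has_weak_partial \<Omega> i u (weak_partial \<Omega> i u)" "AE x in lebesgue_on \<Omega>. weak_partial \<Omega> i u x = g x"
    "weak_partial \<Omega> i u \<in> borel_measurable (lebesgue_on \<Omega>)"
proof -
  show 1: "has_weak_partial \<Omega> i u (weak_partial \<Omega> i u)"
    unfolding weak_partial_def by (rule someI[of "has_weak_partial \<Omega> i u", OF assms(2)])
  show "AE x in lebesgue_on \<Omega>. weak_partial \<Omega> i u x = g x"
    by (rule has_weak_partial_unique[OF assms(1) 1 assms(2)]) simp
  show "weak_partial \<Omega> i u \<in> borel_measurable (lebesgue_on \<Omega>)"
    using 1 locally_integrable_measurable[OF assms(1)] by (auto simp: has_weak_partial_def)
qed

lemma has_weak_partial_measurable:
  assumes "open \<Omega>" "has_weak_partial \<Omega> i u g"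
  shows "u \<in> borel_measurable (lebesgue_on \<Omega>)" "g \<in> borel_measurable (lebesgue_on \<Omega>)"
  using assms locally_integrable_measurable by (auto simp: has_weak_partial_def)

lemma H1_norm_diff_test:
  fixes \<Omega> :: "(real^'n::finite) set"
  assumes "open \<Omega>" "\<And>i. has_weak_partial \<Omega> i u (g i)" "test_function \<Omega> \<phi>"
  shows "H1_norm \<Omega> (\<lambda>x. u x - \<phi> x) =
    sqrt ((L2_norm \<Omega> (\<lambda>x. u x - \<phi> x))\<^sup>2 + (\<Sum>i\<in>UNIV. (L2_norm \<Omega> (\<lambda>x. g i x - partial_deriv i \<phi> x))\<^sup>2))"
proof -
  have w: "has_weak_partial \<Omega> i (\<lambda>x. u x - \<phi> x) (\<lambda>x. g i x - partial_deriv i \<phi> x)" for i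
    by (rule has_weak_partial_diff[OF assms(1,2) test_function_has_weak_partial[OF assms(1,3)]])
  have "L2_norm \<Omega> (weak_partial \<Omega> i (\<lambda>x. u x - \<phi> x)) = L2_norm \<Omega> (\<lambda>x. g i x - partial_deriv i \<phi> x)" for i
    by (rule L2_norm_cong_AE[OF weak_partial_AE_eq(3)[OF assms(1) w] has_weak_partial_measurable(2)[OF assms(1) w]
          weak_partial_AE_eq(2)[OF assms(1) w]])
  then show ?thesis by (simp add: H1_norm_def)
qed

lemma H10_imp_H10_grad:
  fixes \<Omega> :: "(real^'n::finite) set"
  assumes "open \<Omega>" "u \<in> H10 \<Omega>"
  shows "H10_grad \<Omega> u (\<lambda>i. weak_partial \<Omega> i u)"
  unfolding H10_grad_def
proof (intro conjI allI impI)
  let ?g = "\<lambda>i. weak_partial \<Omega> i u"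
  have H1: "u \<in> H1 \<Omega>" using assms(2) by (simp add: H10_def)
  then show "u \<in> L2 \<Omega>" by (simp add: H1_def)
  obtain h where h: "\<And>i. h i \<in> L2 \<Omega>" "\<And>i. has_weak_partial \<Omega> i u (h i)"
    using H1 unfolding H1_def by (simp add: Bex_def) metis
  show "?g i \<in> L2 \<Omega>" for i
    by (rule L2_cong_AE[OF h(1)[of i] _ weak_partial_AE_eq(3)[OF assms(1) h(2)]])
       (use weak_partial_AE_eq(2)[OF assms(1) h(2)[of i]] in \<open>auto elim: eventually_mono\<close>)
  have w: "has_weak_partial \<Omega> i u (?g i)" for i by (rule weak_partial_AE_eq(1)[OF assms(1) h(2)])
  fix e :: real assume "e > 0"
  obtain \<phi> where \<phi>: "\<And>n::nat. test_function \<Omega> (\<phi> n)" "(\<lambda>n. H1_norm \<Omega> (\<lambda>x. u x - \<phi> n x)) \<longlonglongrightarrow> 0"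
    using assms(2) by (auto simp: H10_def)
  have "eventually (\<lambda>n. H1_norm \<Omega> (\<lambda>x. u x - \<phi> n x) < e) sequentially"
    using \<phi>(2) \<open>e > 0\<close> by (intro order_tendstoD(2))
  then obtain n where n: "H1_norm \<Omega> (\<lambda>x. u x - \<phi> n x) < e" by (auto simp: eventually_sequentially)
  let ?A = "L2_norm \<Omega> (\<lambda>x. u x - \<phi> n x)" let ?B = "\<lambda>i. L2_norm \<Omega> (\<lambda>x. ?g i x - partial_deriv i (\<phi> n) x)"
  have S: "sqrt (?A\<^sup>2 + (\<Sum>i\<in>UNIV. (?B i)\<^sup>2)) < e"
    using n H1_norm_diff_test[OF assms(1) w \<phi>(1)[of n]] by simp
  have nn: "(\<Sum>i\<in>UNIV. (?B i)\<^sup>2) \<ge> 0" by (simp add: sum_nonneg)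
  have "?A \<le> sqrt (?A\<^sup>2 + (\<Sum>i\<in>UNIV. (?B i)\<^sup>2))"
    using nn by (intro real_le_rsqrt) simp
  moreover have "?B i \<le> sqrt (?A\<^sup>2 + (\<Sum>i\<in>UNIV. (?B i)\<^sup>2))" for i
    using member_le_sum[of i UNIV "\<lambda>i. (?B i)\<^sup>2"] by (intro real_le_rsqrt) (auto intro: add_increasing)
  ultimately show "\<exists>\<phi>. test_function \<Omega> \<phi> \<and> L2_norm \<Omega> (\<lambda>x. u x - \<phi> x) < e \<and>
       (\<forall>i. L2_norm \<Omega> (\<lambda>x. ?g i x - partial_deriv i \<phi> x) < e)"
    using S \<phi>(1) by (intro exI[of _ "\<phi> n"]) (auto intro: le_less_trans)
qed

lemma H10_grad_imp_H10:
  fixes \<Omega> :: "(real^'n::finite) set"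
  assumes "open \<Omega>" "H10_grad \<Omega> u g"
  shows "u \<in> H10 \<Omega>"
proof -
  have w: "has_weak_partial \<Omega> i u (g i)" for i by (rule H10_grad_has_weak_partial[OF assms])
  have H1: "u \<in> H1 \<Omega>" using assms(2) w by (auto simp: H10_grad_def H1_def)
  \<comment> \<open>The error allows \<open>1 / Suc n\<close> for the function and the same for each
    of the \<open>CARD('n)\<close> partial derivatives.\<close>
  have "\<exists>\<phi>. test_function \<Omega> \<phi> \<and> H1_norm \<Omega> (\<lambda>x. u x - \<phi> x) \<le> (1 + CARD('n)) / real (Suc n)" for n
  proof -
    have e: "1 / real (Suc n) > 0" by simp
    obtain \<phi> where \<phi>: "test_function \<Omega> \<phi>" "L2_norm \<Omega> (\<lambda>x. u x - \<phi> x) < 1 / real (Suc n)"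
      "\<And>i. L2_norm \<Omega> (\<lambda>x. g i x - partial_deriv i \<phi> x) < 1 / real (Suc n)"
      using assms(2) e unfolding H10_grad_def by blast
    have "H1_norm \<Omega> (\<lambda>x. u x - \<phi> x) \<le> sqrt ((L2_norm \<Omega> (\<lambda>x. u x - \<phi> x))\<^sup>2)
       + sqrt (\<Sum>i\<in>UNIV. (L2_norm \<Omega> (\<lambda>x. g i x - partial_deriv i \<phi> x))\<^sup>2)"
      unfolding H1_norm_diff_test[OF assms(1) w \<phi>(1)] by (rule sqrt_add_le_add_sqrt) (auto simp: sum_nonneg)
    also have "\<dots> \<le> 1 / real (Suc n) + (\<Sum>i::'n\<in>UNIV. 1 / real (Suc n))"
    proof (rule add_mono)
      show "sqrt ((L2_norm \<Omega> (\<lambda>x. u x - \<phi> x))\<^sup>2) \<le> 1 / real (Suc n)" using \<phi>(2) by simp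
      have "sqrt (\<Sum>i\<in>UNIV. (L2_norm \<Omega> (\<lambda>x. g i x - partial_deriv i \<phi> x))\<^sup>2) \<le> (\<Sum>i\<in>UNIV. L2_norm \<Omega> (\<lambda>x. g i x - partial_deriv i \<phi> x))"
        using L2_set_le_sum[of UNIV "\<lambda>i. L2_norm \<Omega> (\<lambda>x. g i x - partial_deriv i \<phi> x)"] by (simp add: L2_set_def)
      also have "\<dots> \<le> (\<Sum>i::'n\<in>UNIV. 1 / real (Suc n))" by (rule sum_mono) (use \<phi>(3) in \<open>auto intro: less_imp_le\<close>)
      finally show "sqrt (\<Sum>i\<in>UNIV. (L2_norm \<Omega> (\<lambda>x. g i x - partial_deriv i \<phi> x))\<^sup>2) \<le> (\<Sum>i::'n\<in>UNIV. 1 / real (Suc n))" .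
    qed
    also have "\<dots> = (1 + CARD('n)) / real (Suc n)" by (simp add: add_divide_distrib)
    finally show ?thesis using \<phi>(1) by blast
  qed
  then obtain \<phi> where \<phi>: "\<And>n. test_function \<Omega> (\<phi> n)"
    "\<And>n. H1_norm \<Omega> (\<lambda>x. u x - \<phi> n x) \<le> (1 + CARD('n)) / real (Suc n)" by metis
  have "(\<lambda>n. (1 + CARD('n)) / real (Suc n)) \<longlonglongrightarrow> 0"
    using tendsto_mult_right_zero[OF LIMSEQ_inverse_real_of_nat, of "1 + CARD('n)"] by (simp add: divide_inverse)
  from real_tendsto_sandwich[OF _ _ tendsto_const this]
  have "(\<lambda>n. H1_norm \<Omega> (\<lambda>x. u x - \<phi> n x)) \<longlonglongrightarrow> 0"
    by this
       (use \<phi>(2) in \<open>auto simp: H1_norm_def sum_nonneg\<close>)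
  then show ?thesis using H1 \<phi>(1) by (auto simp: H10_def)
qed

lemma H10_grad_test_function:
  assumes "open \<Omega>" "test_function \<Omega> \<phi>"
  shows "H10_grad \<Omega> \<phi> (\<lambda>i. partial_deriv i \<phi>)"
  unfolding H10_grad_def using L2_test_function[OF assms] assms(2)
  by (auto simp: L2_norm_def L2_inner_def intro!: exI[of _ \<phi>])

section \<open>Volume distortion\<close>

lemma mollifier_moll:
  assumes "integrable lborel f" "is_mollifier r \<rho>"
  shows "C_k k (moll f \<rho>)" "partial_deriv i (moll f \<rho>) = moll f (partial_deriv i \<rho>)"
    "(moll f \<rho> has_derivative (\<lambda>h. \<Sum>i\<in>UNIV. h $ i * partial_deriv i (moll f \<rho>) x)) (at x)"
proof -
  show C: "C_k k (moll f \<rho>)" for k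
    by (rule C_k_moll[OF assms(1), where r=r]) (use is_mollifierD[OF assms(2)] in auto)
  show "partial_deriv i (moll f \<rho>) = moll f (partial_deriv i \<rho>)"
    by (rule partial_deriv_moll[OF assms(1), where r=r]) (use is_mollifierD[OF assms(2)] in auto)
  show "(moll f \<rho> has_derivative (\<lambda>h. \<Sum>i\<in>UNIV. h $ i * partial_deriv i (moll f \<rho>) x)) (at x)"
    using C[of 1] by (intro partial_deriv_has_derivative) simp
qed

text \<open>
  \<open>D\<close> is a representative of the weak Jacobian of \<open>F\<close> that has been modified on a null set, so that
  it is Borel measurable and satisfies the bound at every point, even outside of \<open>U\<close>.
\<close>

locale near_identity_map =
  fixes U V :: "(real^'n::finite) set" and F G :: "real^'n \<Rightarrow> real^'n"
    and D :: "real^'n \<Rightarrow> real^'n^'n" and C \<epsilon> :: real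
  assumes open_U: "open U" and open_V: "open V" and bounded_U: "bounded U" and bounded_V: "bounded V"
    and F_in: "\<And>x. x \<in> U \<Longrightarrow> F x \<in> V" and G_in: "\<And>y. y \<in> V \<Longrightarrow> G y \<in> U"
    and G_F: "\<And>x. x \<in> U \<Longrightarrow> G (F x) = x" and F_G: "\<And>y. y \<in> V \<Longrightarrow> F (G y) = y"
    and lipschitz_F: "lipschitz_on C U F" and lipschitz_G: "lipschitz_on C V G"
    and eps_nonneg: "\<epsilon> \<ge> 0"
    and D_borel: "\<And>k j. (\<lambda>x. D x $ k $ j) \<in> borel_measurable borel"
    and D_close: "\<And>x. onorm ((*v) (D x - mat 1)) \<le> \<epsilon>"
    and D_weak: "\<And>k j. has_weak_partial U j (\<lambda>x. F x $ k) (\<lambda>x. D x $ k $ j)"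
begin

lemma norm_D_diff: "norm ((D x - mat 1) *v h) \<le> \<epsilon> * norm h"
proof -
  have "norm ((D x - mat 1) *v h) \<le> onorm ((*v) (D x - mat 1)) * norm h"
    by (rule onorm) simp
  also have "\<dots> \<le> \<epsilon> * norm h" by (rule mult_right_mono[OF D_close]) simp
  finally show ?thesis .
qed

lemma norm_D: "norm (D x *v h) \<le> (1 + \<epsilon>) * norm h"
proof -
  have "D x *v h = h + (D x - mat 1) *v h" by (simp add: matrix_vector_mult_diff_rdistrib)
  then have "norm (D x *v h) \<le> norm h + norm ((D x - mat 1) *v h)" by (metis norm_triangle_ineq)
  then show ?thesis using norm_D_diff[of x h] by (simp add: algebra_simps)
qed

lemma D_component: "\<bar>D x $ k $ j\<bar> \<le> 1 + \<epsilon>"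
proof -
  have "\<bar>D x $ k $ j\<bar> \<le> onorm ((*v) (D x))" by (rule matrix_component_le_onorm)
  also have "\<dots> \<le> 1 + \<epsilon>" by (rule onorm_bound) (use eps_nonneg norm_D in auto)
  finally show ?thesis .
qed

section \<open>Mollification of the map and its Lipschitz constant on balls\<close>

text \<open>Extension by zero makes the components integrable on the whole space, hence convolvable.
  The jump at the boundary of \<open>U\<close> does no harm, because mollified values matter only at
  points whose ball lies in \<open>U\<close>.\<close>

definition F0 :: "'n \<Rightarrow> real^'n \<Rightarrow> real" where
  "F0 k x = (if x \<in> U then F x $ k else 0)"

definition D0 :: "'n \<Rightarrow> 'n \<Rightarrow> real^'n \<Rightarrow> real" where
  "D0 k j x = (if x \<in> U then D x $ k $ j else 0)"

lemma continuous_F: "continuous_on U F"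
  using lipschitz_F by (rule lipschitz_on_continuous_on)

lemma F0_borel: "F0 k \<in> borel_measurable borel"
proof -
  have "(\<lambda>x. indicator U x *\<^sub>R (F x $ k)) \<in> borel_measurable borel"
    by (rule borel_measurable_continuous_on_indicator)
       (use open_U continuous_F in \<open>auto intro: continuous_intros\<close>)
  then show ?thesis by (rule back_subst[of "\<lambda>f. f \<in> borel_measurable borel"]) (auto simp: F0_def fun_eq_iff)
qed

lemma F0_bound: obtains M where "\<And>k x. \<bar>F0 k x\<bar> \<le> M"
proof -
  obtain M where M: "\<And>y. y \<in> V \<Longrightarrow> norm y \<le> M" "M > 0" using bounded_V unfolding bounded_pos by blast
  have "\<bar>F0 k x\<bar> \<le> M" for k x
    using M(2) M(1)[OF F_in[of x]] component_le_norm_cart[of "F x" k] by (auto simp: F0_def)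
  then show thesis by (rule that)
qed

lemma F0_integrable: "integrable lborel (F0 k)"
proof -
  obtain M where M: "\<And>k x. \<bar>F0 k x\<bar> \<le> M" by (rule F0_bound) blast
  show ?thesis
    by (rule integrable_bounded_support[OF F0_borel M _ bounded_U]) (simp add: F0_def)
qed

lemma D0_borel: "D0 k j \<in> borel_measurable borel"
proof -
  have "(\<lambda>x. indicator U x * D x $ k $ j) \<in> borel_measurable borel"
    using D_borel open_U by simp
  then show ?thesis by (rule back_subst[of "\<lambda>f. f \<in> borel_measurable borel"]) (auto simp: D0_def fun_eq_iff)
qed

lemma D0_bound: "\<bar>D0 k j x\<bar> \<le> 1 + \<epsilon>"
  using D_component eps_nonneg by (auto simp: D0_def)

lemma D0_integrable: "integrable lborel (D0 k j)"
  by (rule integrable_bounded_support[OF D0_borel D0_bound _ bounded_U]) (simp add: D0_def)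

lemma D0_weak: "has_weak_partial U j (F0 k) (D0 k j)"
proof (rule has_weak_partial_cong_AE[OF open_U D_weak])
  show "AE x in lebesgue_on U. F x $ k = F0 k x" "AE x in lebesgue_on U. D x $ k $ j = D0 k j x"
    by (auto simp: F0_def D0_def intro!: AE_I2)
qed (use F0_borel D0_borel in \<open>simp_all add: borel_measurable_lebesgue_on\<close>)

lemma lipschitz_const_nonneg: "C \<ge> 0"
  using lipschitz_F by (rule lipschitz_on_nonneg)

lemma norm_F_diff: "x \<in> U \<Longrightarrow> y \<in> U \<Longrightarrow> norm (F x - F y) \<le> C * norm (x - y)"
  using lipschitz_onD[OF lipschitz_F] by (simp add: dist_norm)

lemma moll_F_close:
  assumes "is_mollifier r \<rho>" "cball x r \<subseteq> U" "r > 0"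
  shows "\<bar>moll (F0 k) \<rho> x - F x $ k\<bar> \<le> C * r"
proof (rule moll_close[OF F0_integrable assms(1)])
  fix y assume y: "norm (x - y) < r"
  then have yU: "y \<in> U" using assms(2) by (auto simp: dist_norm subset_iff)
  have xU: "x \<in> U" using assms by auto
  have "\<bar>F0 k y - F x $ k\<bar> = \<bar>(F y - F x) $ k\<bar>" using yU by (simp add: F0_def)
  also have "\<dots> \<le> norm (F y - F x)" by (rule component_le_norm_cart)
  also have "\<dots> \<le> C * norm (y - x)" by (rule norm_F_diff[OF yU xU])
  also have "\<dots> \<le> C * r" using y lipschitz_const_nonneg by (intro mult_left_mono) (auto simp: norm_minus_commute)
  finally show "\<bar>F0 k y - F x $ k\<bar> \<le> C * r" .
qed

text \<open>The mollified Jacobian is an average of matrices whose operator norm is at most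
  \<open>1 + \<epsilon>\<close>. Pairing the image vector \<open>v\<close> with itself reduces the
  claim to an integral of scalars.\<close>

lemma norm_moll_D:
  assumes \<rho>: "is_mollifier r \<rho>" and x: "cball x r \<subseteq> U"
  shows "norm (\<chi> k. \<Sum>j\<in>UNIV. h $ j * moll (D0 k j) \<rho> x) \<le> (1 + \<epsilon>) * norm h"
proof -
  define v where "v = (\<chi> k. \<Sum>j\<in>UNIV. h $ j * moll (D0 k j) \<rho> x)"
  have int: "integrable lborel (\<lambda>y. D0 k j y * \<rho> (x - y))" for k j
    by (rule integrable_moll[OF D0_integrable is_mollifierD(7,4)[OF \<rho>]])
  have "norm v * norm v = v \<bullet> v" by (simp add: power2_norm_eq_inner flip: power2_eq_square)
  also have "\<dots> = (\<Sum>k\<in>UNIV. v $ k * (\<Sum>j\<in>UNIV. h $ j * (\<integral>y. D0 k j y * \<rho> (x - y) \<partial>lborel)))"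
    by (simp add: inner_vec_def v_def moll_def)
  also have "\<dots> = (\<integral>y. (\<Sum>k\<in>UNIV. v $ k * (\<Sum>j\<in>UNIV. h $ j * (D0 k j y * \<rho> (x - y)))) \<partial>lborel)"
    using int by simp
  also have "\<dots> \<le> (\<integral>y. (1 + \<epsilon>) * norm h * norm v * \<rho> (x - y) \<partial>lborel)"
  proof (rule integral_mono)
    show "integrable lborel (\<lambda>y. \<Sum>k\<in>UNIV. v $ k * (\<Sum>j\<in>UNIV. h $ j * (D0 k j y * \<rho> (x - y))))"
      using int by simp
    show "integrable lborel (\<lambda>y. (1 + \<epsilon>) * norm h * norm v * \<rho> (x - y))"
      using integral_mollifier[OF \<rho>] by simp
    show "(\<Sum>k\<in>UNIV. v $ k * (\<Sum>j\<in>UNIV. h $ j * (D0 k j y * \<rho> (x - y)))) \<le> (1 + \<epsilon>) * norm h * norm v * \<rho> (x - y)" for y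
    proof (cases "norm (x - y) < r")
      case True
      then have "y \<in> U" using x by (auto simp: dist_norm subset_iff)
      then have "(\<Sum>k\<in>UNIV. v $ k * (\<Sum>j\<in>UNIV. h $ j * (D0 k j y * \<rho> (x - y)))) = (v \<bullet> (D y *v h)) * \<rho> (x - y)"
        by (simp add: D0_def inner_vec_def matrix_vector_mult_def sum_distrib_left sum_distrib_right algebra_simps)
      also have "\<dots> \<le> (norm v * ((1 + \<epsilon>) * norm h)) * \<rho> (x - y)"
        by (intro mult_right_mono order_trans[OF norm_cauchy_schwarz] mult_left_mono norm_D is_mollifierD(2)[OF \<rho>]) auto
      finally show ?thesis by (simp add: algebra_simps)
    qed (simp add: is_mollifierD(3)[OF \<rho>])
  qed
  also have "\<dots> = (1 + \<epsilon>) * norm h * norm v" using integral_mollifier[OF \<rho>] by simp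
  finally have "norm v * norm v \<le> ((1 + \<epsilon>) * norm h) * norm v" .
  then have "norm v \<le> (1 + \<epsilon>) * norm h"
    using eps_nonneg by (cases "norm v = 0") (auto simp: mult_le_cancel_right)
  then show ?thesis by (simp add: v_def)
qed

text \<open>The mean value inequality holds for the mollified map \<open>H\<close> because a ball is
  convex and \<open>norm_moll_D\<close> bounds the derivative. The crude constant \<open>C\<close>
  measures the distance from \<open>F\<close> to \<open>H\<close>, which disappears as the radius
  \<open>t\<close> shrinks.\<close>

lemma F_lipschitz_cball:
  assumes "cball z s \<subseteq> U" "x \<in> cball z s" "y \<in> cball z s"
  shows "norm (F x - F y) \<le> (1 + \<epsilon>) * norm (x - y)"
proof -
  obtain r where r: "r > 0" "{x + y | x y. x \<in> cball z s \<and> y \<in> cball 0 r} \<subseteq> U"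
    by (rule compact_cball_sum[OF compact_cball open_U assms(1)])
  have rU: "cball w r' \<subseteq> U" if "w \<in> cball z s" "r' \<le> r" for w r'
    using cball_subset_of_sum[OF r(2) that(1)] subset_cball[OF that(2)] by blast
  have est: "norm (F x - F y) \<le> (1 + \<epsilon>) * norm (x - y) + 2 * (CARD('n) * (C * t))" if t: "0 < t" "t \<le> r" for t
  proof -
    obtain \<rho> :: "real^'n \<Rightarrow> real" where \<rho>: "is_mollifier t \<rho>" using mollifier_exists t(1) by blast
    define H where "H w = (\<chi> k. moll (F0 k) \<rho> w)" for w
    have hd: "(H has_derivative (\<lambda>h. \<chi> k. \<Sum>j\<in>UNIV. h $ j * moll (D0 k j) \<rho> w)) (at w within S)"
      if w: "w \<in> cball z s" for w S
    proof -
      have "(moll (F0 k) \<rho> has_derivative (\<lambda>h. \<Sum>j\<in>UNIV. h $ j * moll (D0 k j) \<rho> w)) (at w)" for k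
        using mollifier_moll(3)[OF F0_integrable[of k] \<rho>, where x=w]
        by (simp add: partial_deriv_moll_weak[OF open_U D0_weak F0_integrable D0_integrable \<rho> rU[OF w t(2)]])
      then show ?thesis unfolding H_def
        by (subst has_derivative_componentwise_within)
           (auto simp: Basis_vec_def inner_axis intro: has_derivative_at_withinI)
    qed
    have on: "onorm (\<lambda>h. \<chi> k. \<Sum>j\<in>UNIV. h $ j * moll (D0 k j) \<rho> w) \<le> 1 + \<epsilon>" if w: "w \<in> cball z s" for w
      by (rule onorm_bound) (use eps_nonneg norm_moll_D[OF \<rho> rU[OF w t(2)]] in auto)
    have H: "norm (H x - H y) \<le> (1 + \<epsilon>) * norm (x - y)"
      by (rule differentiable_bound[OF convex_cball hd on assms(2,3)])
    have cl: "norm (F w - H w) \<le> CARD('n) * (C * t)" if w: "w \<in> cball z s" for w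
    proof -
      have "norm (F w - H w) \<le> (\<Sum>k\<in>UNIV. \<bar>(F w - H w) $ k\<bar>)" by (rule norm_le_l1_cart)
      also have "\<dots> \<le> (\<Sum>k::'n\<in>UNIV. C * t)"
        by (rule sum_mono) (use moll_F_close[OF \<rho> rU[OF w t(2)] t(1)] in \<open>simp add: H_def abs_minus_commute\<close>)
      finally show ?thesis by simp
    qed
    have "F x - F y = (H x - H y) + ((F x - H x) - (F y - H y))" by simp
    then have "norm (F x - F y) \<le> norm (H x - H y) + norm ((F x - H x) - (F y - H y))"
      by (metis norm_triangle_ineq)
    with norm_triangle_ineq4[of "F x - H x" "F y - H y"] H cl[OF assms(2)] cl[OF assms(3)] show ?thesis by linarith
  qed
  show ?thesis
  proof (rule field_le_epsilon)
    fix e :: real assume "e > 0"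
    \<comment> \<open>Twice the mollification error is \<open>2 * CARD('n) * C * t\<close>; the
      added 1 keeps \<open>N\<close> positive when \<open>C = 0\<close>.\<close>
    define N where "N = 2 * (real CARD('n) * C) + 1"
    have N: "N > 0" using lipschitz_const_nonneg by (simp add: N_def add_nonneg_pos)
    define t where "t = min r (e / N)"
    have t: "0 < t" "t \<le> r" "t \<le> e / N" using r(1) N \<open>e > 0\<close> by (auto simp: t_def)
    have "2 * (real CARD('n) * (C * t)) \<le> N * t" using t(1) by (simp add: N_def algebra_simps)
    also have "\<dots> \<le> e" using t(3) N by (simp add: field_simps)
    finally show "norm (F x - F y) \<le> (1 + \<epsilon>) * norm (x - y) + e" using est[OF t(1,2)] by linarith
  qed
qed

lemma F_image_ball:
  assumes "ball z s \<subseteq> U"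
  shows "F ` ball z s \<subseteq> cball (F z) ((1 + \<epsilon>) * s)"
proof clarify
  fix x assume x: "x \<in> ball z s"
  \<comment> \<open>The open ball may reach up to the boundary of \<open>U\<close>, but the
    concentric closed ball through \<open>x\<close> stays inside.\<close>
  have "cball z (dist z x) \<subseteq> U" using assms x by (auto simp: subset_iff)
  then have "norm (F z - F x) \<le> (1 + \<epsilon>) * norm (z - x)"
    by (rule F_lipschitz_cball) auto
  also have "\<dots> \<le> (1 + \<epsilon>) * s" using x eps_nonneg by (intro mult_left_mono) (auto simp: dist_norm)
  finally show "F x \<in> cball (F z) ((1 + \<epsilon>) * s)" by (simp add: dist_norm)
qed

section \<open>Images of Lebesgue sets and their volume\<close>

lemma negligible_F_image:
  assumes "negligible N" "N \<subseteq> U" shows "negligible (F ` N)"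
proof (rule negligible_locally_Lipschitz_image[OF _ assms(1)])
  fix x assume "x \<in> N"
  then show "\<exists>T B. open T \<and> x \<in> T \<and> (\<forall>y\<in>N \<inter> T. norm (F y - F x) \<le> B * norm (y - x))"
    using norm_F_diff assms(2) by (intro exI[of _ UNIV] exI[of _ C]) auto
qed simp

text \<open>A Lebesgue set is a countable union of compact sets together with a null set. Continuity
  handles the compact sets, but the null set calls for the Lipschitz property: a merely continuous
  image of it could fail to be measurable.\<close>

lemma F_image_lebesgue:
  assumes "A \<in> sets lebesgue" "A \<subseteq> U" shows "F ` A \<in> sets lebesgue"
proof -
  obtain K T where KT: "fsigma K" "T \<in> null_sets lebesgue" "K \<union> T = A"
    using lebesgue_set_almost_fsigma[OF assms(1)] by metis
  obtain H :: "nat \<Rightarrow> (real^'n) set" where H: "range H \<subseteq> Collect compact" "K = \<Union>(range H)"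
    using KT(1) fsigma_Union_compact by metis
  have "F ` H n \<in> sets lebesgue" for n
  proof -
    have "compact (F ` H n)"
      using H KT assms(2) by (intro compact_continuous_image continuous_on_subset[OF continuous_F]) auto
    then show ?thesis by simp
  qed
  then have "(\<Union>n. F ` H n) \<in> sets lebesgue" by auto
  moreover have "F ` K = (\<Union>n. F ` H n)" using H(2) by auto
  moreover have "F ` T \<in> sets lebesgue"
    using negligible_F_image[of T] KT assms(2) by (auto simp: negligible_iff_null_sets)
  ultimately have "F ` K \<union> F ` T \<in> sets lebesgue" by auto
  then show ?thesis by (simp add: KT(3)[symmetric] image_Un)
qed

lemma inj_F: "inj_on F U"
  using G_F by (rule inj_on_inverseI)

lemma emeasure_F_image_ball:
  assumes "ball z s \<subseteq> U" "s > 0"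
  shows "emeasure lebesgue (F ` ball z s) \<le> ennreal ((1 + \<epsilon>) ^ CARD('n)) * emeasure lebesgue (ball z s)"
proof -
  have "emeasure lebesgue (F ` ball z s) \<le> emeasure lebesgue (cball (F z) ((1 + \<epsilon>) * s))"
    by (rule emeasure_mono[OF F_image_ball[OF assms(1)]]) simp
  also have "\<dots> = ennreal (unit_ball_vol (CARD('n)) * ((1 + \<epsilon>) * s) ^ CARD('n))"
    using assms(2) eps_nonneg by (simp add: emeasure_cball)
  also have "\<dots> = ennreal ((1 + \<epsilon>) ^ CARD('n)) * ennreal (unit_ball_vol (CARD('n)) * s ^ CARD('n))"
    using assms(2) eps_nonneg by (subst ennreal_mult[symmetric]) (auto simp: power_mult_distrib mult_ac)
  also have "ennreal (unit_ball_vol (CARD('n)) * s ^ CARD('n)) = emeasure lebesgue (ball z s)"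
    using assms(2) by (simp add: emeasure_ball)
  finally show ?thesis .
qed

text \<open>By Vitali, countably many disjoint balls exhaust \<open>W\<close> up to a null set. The
  estimate for single balls is summed, and the null remainder has a null image because
  \<open>F\<close> is Lipschitz.\<close>

lemma emeasure_F_image_open:
  assumes "open W" "W \<subseteq> U"
  shows "emeasure lebesgue (F ` W) \<le> ennreal ((1 + \<epsilon>) ^ CARD('n)) * emeasure lebesgue W"
proof -
  \<comment> \<open>The index of a ball is its pair of centre and radius; arbitrarily small radii
    are available at each point, as a Vitali cover requires.\<close>
  define K where "K = {i :: (real^'n) \<times> real. 0 < snd i \<and> ball (fst i) (snd i) \<subseteq> W}"
  have cover: "\<exists>i. i \<in> K \<and> x \<in> ball (fst i) (snd i) \<and> snd i < d" if xd: "x \<in> W" "0 < d" for x d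
  proof -
    obtain e where e: "e > 0" "ball x e \<subseteq> W" using assms(1) xd(1) open_contains_ball by blast
    have "ball x (min e (d / 2)) \<subseteq> W" using e(2) by auto
    then show ?thesis using e(1) xd by (intro exI[of _ "(x, min e (d / 2))"]) (auto simp: K_def)
  qed
  obtain I where I: "countable I" "I \<subseteq> K" "pairwise (\<lambda>i j. disjnt (ball (fst i) (snd i)) (ball (fst j) (snd j))) I"
    "negligible (W - (\<Union>i\<in>I. ball (fst i) (snd i)))"
    by (rule Vitali_covering_theorem_balls[of W K fst snd, OF cover])
  let ?B = "\<lambda>i. ball (fst i) (snd i)"
  have B: "?B i \<subseteq> W" "snd i > 0" if "i \<in> I" for i using I(2) that by (auto simp: K_def)
  have BU: "?B i \<subseteq> U" if "i \<in> I" for i using B(1)[OF that] assms(2) by blast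
  have dB: "disjoint_family_on ?B I"
    using I(3) by (auto simp: disjoint_family_on_def pairwise_def disjnt_def)
  have dF: "disjoint_family_on (\<lambda>i. F ` ?B i) I"
    unfolding disjoint_family_on_def
  proof (intro ballI impI)
    fix i j assume ij: "i \<in> I" "j \<in> I" "i \<noteq> j"
    have "F ` ?B i \<inter> F ` ?B j = F ` (?B i \<inter> ?B j)"
      by (rule inj_on_image_Int[OF inj_F BU[OF ij(1)] BU[OF ij(2)], symmetric])
    then show "F ` ?B i \<inter> F ` ?B j = {}" using dB ij by (simp add: disjoint_family_on_def)
  qed
  let ?N = "W - (\<Union>i\<in>I. ?B i)"
  have N: "F ` ?N \<in> null_sets lebesgue"
    using negligible_F_image[OF I(4)] assms(2) by (auto simp: negligible_iff_null_sets)
  have m: "F ` ?B i \<in> sets lebesgue" if "i \<in> I" for i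
    by (rule F_image_lebesgue[OF _ BU[OF that]]) simp
  have mU: "(\<Union>i\<in>I. F ` ?B i) \<in> sets lebesgue" using m I(1) by (intro sets.countable_UN') auto
  have "emeasure lebesgue (F ` W) \<le> emeasure lebesgue ((\<Union>i\<in>I. F ` ?B i) \<union> F ` ?N)"
  proof (rule emeasure_mono)
    show "F ` W \<subseteq> (\<Union>i\<in>I. F ` ?B i) \<union> F ` ?N" by blast
    show "(\<Union>i\<in>I. F ` ?B i) \<union> F ` ?N \<in> sets lebesgue" using mU N by blast
  qed
  also have "\<dots> = emeasure lebesgue (\<Union>i\<in>I. F ` ?B i)"
    by (rule emeasure_Un_null_set[OF mU N])
  also have "\<dots> = (\<integral>\<^sup>+i. emeasure lebesgue (F ` ?B i) \<partial>count_space I)"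
    by (rule emeasure_UN_countable[OF m I(1) dF])
  also have "\<dots> \<le> (\<integral>\<^sup>+i. ennreal ((1 + \<epsilon>) ^ CARD('n)) * emeasure lebesgue (?B i) \<partial>count_space I)"
    by (rule nn_integral_mono, rule emeasure_F_image_ball) (use BU B(2) in auto)
  also have "\<dots> = ennreal ((1 + \<epsilon>) ^ CARD('n)) * (\<integral>\<^sup>+i. emeasure lebesgue (?B i) \<partial>count_space I)"
    by (rule nn_integral_cmult) simp
  also have "(\<integral>\<^sup>+i. emeasure lebesgue (?B i) \<partial>count_space I) = emeasure lebesgue (\<Union>i\<in>I. ?B i)"
    by (rule emeasure_UN_countable[symmetric, OF _ I(1) dB]) auto
  also have "\<dots> \<le> emeasure lebesgue W"
    by (rule emeasure_mono) (use B(1) assms(1) in auto)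
  finally show ?thesis by (simp add: mult_left_mono)
qed

text \<open>Outer regularity reduces the claim to open sets. The open superset is cut back to
  \<open>U\<close>, where \<open>F\<close> is controlled, and its excess \<open>e / ?c\<close> is
  chosen to absorb the factor \<open>?c\<close>.\<close>

lemma emeasure_F_image:
  assumes A: "A \<in> sets lebesgue" "A \<subseteq> U"
  shows "emeasure lebesgue (F ` A) \<le> ennreal ((1 + \<epsilon>) ^ CARD('n)) * emeasure lebesgue A"
proof (rule ennreal_le_epsilon)
  fix e :: real assume "e > 0"
  let ?c = "(1 + \<epsilon>) ^ CARD('n)"
  have c: "?c > 0" using eps_nonneg by simp
  then obtain T where T: "open T" "A \<subseteq> T" "T - A \<in> lmeasurable" "emeasure lebesgue (T - A) < ennreal (e / ?c)"
    using sets_lebesgue_outer_open[OF A(1), of "e / ?c"] \<open>e > 0\<close> by auto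
  have W: "open (T \<inter> U)" using T open_U by auto
  have "emeasure lebesgue (F ` A) \<le> emeasure lebesgue (F ` (T \<inter> U))"
    by (rule emeasure_mono) (use A T W F_image_lebesgue in auto)
  also have "\<dots> \<le> ennreal ?c * emeasure lebesgue (T \<inter> U)" by (rule emeasure_F_image_open[OF W]) auto
  also have "\<dots> \<le> ennreal ?c * emeasure lebesgue T" by (intro mult_left_mono emeasure_mono) (use T in auto)
  also have "emeasure lebesgue T = emeasure lebesgue A + emeasure lebesgue (T - A)"
    using A T by (subst plus_emeasure) (auto simp: Un_absorb1)
  also have "ennreal ?c * \<dots> \<le> ennreal ?c * (emeasure lebesgue A + ennreal (e / ?c))"
    using T(4) by (intro mult_left_mono add_left_mono) auto
  also have "\<dots> = ennreal ?c * emeasure lebesgue A + ennreal e"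
  proof -
    have "ennreal ?c * ennreal (e / ?c) = ennreal (?c * (e / ?c))"
      by (rule ennreal_mult[symmetric]) (use c \<open>e > 0\<close> in auto)
    also have "?c * (e / ?c) = e" using c by (metis less_irrefl nonzero_mult_div_cancel_left times_divide_eq_right)
    finally show ?thesis by (simp only: distrib_left)
  qed
  finally show "emeasure lebesgue (F ` A) \<le> ennreal ?c * emeasure lebesgue A + ennreal e" .
qed

lemma vimage_G: "A \<subseteq> U \<Longrightarrow> G -` A \<inter> V = F ` A"
  using F_in F_G G_F by (auto simp: image_iff) (metis F_G)

text \<open>Preimages under \<open>G\<close> are images under \<open>F\<close>, which remain
  Lebesgue measurable. Continuity of \<open>G\<close> alone would settle Borel sets only.\<close>

lemma G_measurable: "G \<in> measurable (lebesgue_on V) (lebesgue_on U)"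
proof (rule measurableI)
  show "x \<in> space (lebesgue_on V) \<Longrightarrow> G x \<in> space (lebesgue_on U)" for x using G_in by simp
  fix A assume "A \<in> sets (lebesgue_on U)"
  then have A: "A \<in> sets lebesgue" "A \<subseteq> U" using open_U by (auto simp: sets_restrict_space_iff)
  have "F ` A \<subseteq> V" using A F_in by auto
  then show "G -` A \<inter> space (lebesgue_on V) \<in> sets (lebesgue_on V)"
    using vimage_G[OF A(2)] F_image_lebesgue[OF A] open_V by (simp add: sets_restrict_space_iff)
qed

lemma emeasure_distr_G:
  assumes "A \<in> sets (lebesgue_on U)"
  shows "emeasure (distr (lebesgue_on V) (lebesgue_on U) G) A = emeasure lebesgue (F ` A)"
proof -
  have A: "A \<in> sets lebesgue" "A \<subseteq> U" using assms open_U by (auto simp: sets_restrict_space_iff)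
  have "F ` A \<subseteq> V" using A F_in by auto
  then show ?thesis
    using assms vimage_G[OF A(2)] open_V by (simp add: emeasure_distr[OF G_measurable] emeasure_restrict_space)
qed

end

text \<open>The hypothesis is tested on the set \<open>A\<close> where the conclusion fails.
  Finiteness of the integral of \<open>f\<close> is what makes the difference of the two integrals
  meaningful in the extended nonnegative reals.\<close>

lemma AE_le_if_density_le:
  assumes f: "f \<in> borel_measurable M" and g: "g \<in> borel_measurable M"
    and fin: "integral\<^sup>N M f < \<infinity>"
    and le: "\<And>A. A \<in> sets M \<Longrightarrow> emeasure (density M f) A \<le> emeasure (density M g) A"
  shows "AE x in M. f x \<le> g x"
proof -
  define A where "A = {x \<in> space M. g x < f x}"
  have A: "A \<in> sets M" unfolding A_def using f g by measurable
  have mf: "(\<lambda>x. f x * indicator A x) \<in> borel_measurable M" "(\<lambda>x. g x * indicator A x) \<in> borel_measurable M"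
    using f g A by simp_all
  have gf: "g x * indicator A x \<le> f x * indicator A x" for x by (auto simp: A_def indicator_def)
  have "(\<integral>\<^sup>+x. f x * indicator A x \<partial>M) \<le> integral\<^sup>N M f"
    by (rule nn_integral_mono) (auto simp: indicator_def)
  then have finf: "(\<integral>\<^sup>+x. f x * indicator A x \<partial>M) < \<infinity>" using fin by (rule le_less_trans)
  have "(\<integral>\<^sup>+x. g x * indicator A x \<partial>M) \<le> (\<integral>\<^sup>+x. f x * indicator A x \<partial>M)"
    by (rule nn_integral_mono) (rule gf)
  then have fing: "(\<integral>\<^sup>+x. g x * indicator A x \<partial>M) \<noteq> \<infinity>" using finf by auto
  have "(\<integral>\<^sup>+x. f x * indicator A x - g x * indicator A x \<partial>M)
     = (\<integral>\<^sup>+x. f x * indicator A x \<partial>M) - (\<integral>\<^sup>+x. g x * indicator A x \<partial>M)"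
    by (rule nn_integral_diff[OF mf fing]) (simp add: gf)
  also have "\<dots> = 0"
    using le[OF A] finf f g A by (simp add: emeasure_density diff_eq_0_iff_ennreal)
  finally have "AE x in M. f x * indicator A x - g x * indicator A x = 0"
    by (subst (asm) nn_integral_0_iff_AE) (use mf in auto)
  then show ?thesis
  proof (rule AE_mp, intro AE_I2 impI)
    fix x assume x: "x \<in> space M" "f x * indicator A x - g x * indicator A x = 0"
    show "f x \<le> g x"
    proof (rule ccontr)
      assume "\<not> f x \<le> g x"
      then have "x \<in> A" using x(1) by (auto simp: A_def)
      with x(2) have "f x \<le> g x" by (simp add: diff_eq_0_iff_ennreal)
      with \<open>\<not> f x \<le> g x\<close> show False by simp
    qed
  qed
qed

section \<open>Norm inequalities for square integrable functions\<close>

lemma L2_norm_triangle: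
  assumes u: "u \<in> L2 \<Omega>" and v: "v \<in> L2 \<Omega>"
  shows "L2_norm \<Omega> (\<lambda>x. u x + v x) \<le> L2_norm \<Omega> u + L2_norm \<Omega> v"
proof (rule power2_le_imp_le)
  have "(L2_norm \<Omega> (\<lambda>x. u x + v x))\<^sup>2 = (L2_norm \<Omega> u)\<^sup>2 + (L2_norm \<Omega> v)\<^sup>2 + 2 * L2_inner \<Omega> u v"
    using L2_D(2)[OF u] L2_D(2)[OF v] L2_mult_integrable[OF u v]
    by (simp add: L2_norm_square L2_inner_def power2_sum mult.assoc)
  also have "\<dots> \<le> (L2_norm \<Omega> u + L2_norm \<Omega> v)\<^sup>2"
    using L2_Cauchy_Schwarz[OF u v] by (simp add: power2_sum)
  finally show "(L2_norm \<Omega> (\<lambda>x. u x + v x))\<^sup>2 \<le> (L2_norm \<Omega> u + L2_norm \<Omega> v)\<^sup>2" .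
qed simp

lemma L2_norm_sum:
  assumes "finite I" "\<And>i. i \<in> I \<Longrightarrow> f i \<in> L2 \<Omega>"
  shows "L2_norm \<Omega> (\<lambda>x. \<Sum>i\<in>I. f i x) \<le> (\<Sum>i\<in>I. L2_norm \<Omega> (f i))"
  using assms
proof (induction I)
  case empty
  then show ?case by (simp add: L2_norm_def L2_inner_def)
next
  case (insert i I)
  have "L2_norm \<Omega> (\<lambda>x. f i x + (\<Sum>i\<in>I. f i x)) \<le> L2_norm \<Omega> (f i) + L2_norm \<Omega> (\<lambda>x. \<Sum>i\<in>I. f i x)"
    using insert by (intro L2_norm_triangle L2_sum) auto
  with insert show ?case by simp
qed

lemma L2_norm_bounded_mult:
  assumes u: "u \<in> L2 \<Omega>" and b: "b \<in> borel_measurable (lebesgue_on \<Omega>)" "\<And>x. x \<in> \<Omega> \<Longrightarrow> \<bar>b x\<bar> \<le> B" and "B \<ge> 0"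
  shows "L2_norm \<Omega> (\<lambda>x. u x * b x) \<le> B * L2_norm \<Omega> u"
proof (rule power2_le_imp_le)
  have "(L2_norm \<Omega> (\<lambda>x. u x * b x))\<^sup>2 = integral\<^sup>L (lebesgue_on \<Omega>) (\<lambda>x. (u x * b x)\<^sup>2)" by (rule L2_norm_square)
  also have "\<dots> \<le> integral\<^sup>L (lebesgue_on \<Omega>) (\<lambda>x. B\<^sup>2 * (u x)\<^sup>2)"
  proof (rule integral_mono)
    show "integrable (lebesgue_on \<Omega>) (\<lambda>x. (u x * b x)\<^sup>2)" using L2_bounded_mult[OF u b] by (simp add: L2_def)
    show "integrable (lebesgue_on \<Omega>) (\<lambda>x. B\<^sup>2 * (u x)\<^sup>2)" using L2_D[OF u] by simp
    fix x assume "x \<in> space (lebesgue_on \<Omega>)"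
    then have "(b x)\<^sup>2 \<le> B\<^sup>2" using b(2)[of x] \<open>B \<ge> 0\<close> by (auto simp: abs_le_square_iff[symmetric])
    then show "(u x * b x)\<^sup>2 \<le> B\<^sup>2 * (u x)\<^sup>2" by (simp add: power_mult_distrib mult.commute mult_right_mono)
  qed
  also have "\<dots> = (B * L2_norm \<Omega> u)\<^sup>2" by (simp add: power_mult_distrib L2_norm_square)
  finally show "(L2_norm \<Omega> (\<lambda>x. u x * b x))\<^sup>2 \<le> (B * L2_norm \<Omega> u)\<^sup>2" .
qed (use \<open>B \<ge> 0\<close> in simp)

section \<open>Change of variables\<close>

text \<open>The hypotheses are symmetric with the same \<open>C\<close> and
  \<open>\<epsilon>\<close>: exchanging \<open>U, F, D\<close> with \<open>V, G, E\<close> gives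
  such a pair again, so each estimate comes with its mirror image.\<close>

locale near_identity_pair =
  fw: near_identity_map U V F G D C \<epsilon> + bw: near_identity_map V U G F E C \<epsilon>
  for U V :: "(real^'n::finite) set" and F G D E C \<epsilon>
begin

definition distortion :: real where "distortion = (1 + \<epsilon>) ^ CARD('n)"

lemma distortion_ge_1: "distortion \<ge> 1"
  using fw.eps_nonneg by (simp add: distortion_def)

text \<open>The image measure assigns to \<open>A\<close> the volume of \<open>F\<close>
  A\<open>. The volume bound for\<close>F\<open>estimates it from above, and the bound for\<close>G\<open>, applied to\<close>F
  \<open>A\<close>, estimates it from below. Both inequalities between measures pass to the
  Radon-Nikodym density.\<close>

lemma Jacobian_exists:
  obtains J where "J \<in> borel_measurable (lebesgue_on U)" "\<And>x. 1 / distortion \<le> J x" "\<And>x. J x \<le> distortion"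
    "distr (lebesgue_on V) (lebesgue_on U) G = density (lebesgue_on U) (\<lambda>x. ennreal (J x))"
proof -
  let ?M = "lebesgue_on U" let ?N = "distr (lebesgue_on V) (lebesgue_on U) G" let ?c = "ennreal distortion"
  have fin: "emeasure lebesgue U < \<infinity>" "emeasure lebesgue V < \<infinity>"
    using fw.bounded_U fw.bounded_V fw.open_U fw.open_V emeasure_bounded_finite by simp_all
  have U: "U \<in> sets lebesgue" "V \<in> sets lebesgue" using fw.open_U fw.open_V by simp_all
  have emM: "emeasure ?M A = emeasure lebesgue A" if "A \<in> sets ?M" for A
    using that U by (simp add: emeasure_restrict_space sets_restrict_space_iff)
  have A: "A \<in> sets lebesgue" "A \<subseteq> U" if "A \<in> sets ?M" for A
    using that U by (auto simp: sets_restrict_space_iff)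
  have NM: "emeasure ?N A \<le> ?c * emeasure ?M A" if "A \<in> sets ?M" for A
    using fw.emeasure_F_image[OF A[OF that]] fw.emeasure_distr_G[OF that] emM[OF that] by (simp add: distortion_def)
  have MN: "emeasure ?M A \<le> ?c * emeasure ?N A" if "A \<in> sets ?M" for A
  proof -
    have "G ` F ` A = A" using A(2)[OF that] fw.G_F by (force simp: image_iff)
    moreover have "F ` A \<subseteq> V" using A(2)[OF that] fw.F_in by auto
    ultimately show ?thesis
      using bw.emeasure_F_image[OF fw.F_image_lebesgue[OF A[OF that]]] fw.emeasure_distr_G[OF that] emM[OF that]
      by (simp add: distortion_def)
  qed
  interpret M: finite_measure ?M
    by (rule finite_measureI) (use U fin in \<open>simp add: emeasure_restrict_space\<close>)
  have "absolutely_continuous ?M ?N"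
    unfolding absolutely_continuous_def
  proof
    fix B assume B: "B \<in> null_sets ?M"
    then have "emeasure ?N B \<le> ?c * 0" using NM[of B] by (auto simp: null_sets_def)
    then show "B \<in> null_sets ?N" using B by (auto simp: null_sets_def)
  qed
  then obtain J0 where J0: "J0 \<in> borel_measurable ?M" "density ?M J0 = ?N"
    using M.Radon_Nikodym[of ?N] by auto
  have finJ: "integral\<^sup>N ?M J0 < \<infinity>"
  proof -
    have "integral\<^sup>N ?M J0 = emeasure (density ?M J0) U"
      using J0(1) U by (subst emeasure_density) (auto simp: sets_restrict_space_iff intro!: nn_integral_cong)
    also have "\<dots> \<le> ?c * emeasure ?M U" unfolding J0(2) by (rule NM) (use U in \<open>simp add: sets_restrict_space_iff\<close>)
    also have "\<dots> < \<infinity>"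
    proof -
      have "U \<in> sets ?M" using U by (simp add: sets_restrict_space_iff)
      then have "emeasure ?M U < top" using fin(1) unfolding infinity_ennreal_def by (subst emM)
      then show ?thesis
        unfolding infinity_ennreal_def ennreal_mult_less_top using ennreal_less_top[of distortion] by blast
    qed
    finally show ?thesis .
  qed
  have 1: "AE x in ?M. J0 x \<le> ?c"
  proof (rule AE_le_if_density_le[OF J0(1) _ finJ])
    show "emeasure (density ?M J0) A \<le> emeasure (density ?M (\<lambda>_. ?c)) A" if "A \<in> sets ?M" for A
      unfolding J0(2) using NM[OF that] that by (simp add: emeasure_density_const)
  qed simp
  \<comment> \<open>The lower bound is stated multiplied out, so that the smaller density is the
    constant 1, whose integral over the bounded set \<open>U\<close> is finite.\<close>
  have 2: "AE x in ?M. 1 \<le> ?c * J0 x"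
  proof (rule AE_le_if_density_le)
    show "emeasure (density ?M (\<lambda>_. 1)) A \<le> emeasure (density ?M (\<lambda>x. ?c * J0 x)) A" if "A \<in> sets ?M" for A
    proof -
      have "emeasure (density ?M (\<lambda>x. ?c * J0 x)) A = ?c * emeasure (density ?M J0) A"
        using that J0(1) by (simp add: emeasure_density mult.assoc nn_integral_cmult)
      then show ?thesis using MN[OF that] that by (simp add: J0(2) emeasure_density_const density_1)
    qed
    show "(\<integral>\<^sup>+x. 1 \<partial>?M) < \<infinity>" using M.emeasure_finite[of U] by (simp add: less_top[symmetric])
  qed (use J0(1) in simp_all)
  \<comment> \<open>Clamping changes the density on a null set only, and makes both bounds valid at
    every point.\<close>
  define J where "J x = max (1 / distortion) (min distortion (enn2real (J0 x)))" for x
  have d: "distortion > 0" "1 / distortion \<le> distortion" using distortion_ge_1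
    by (auto intro: order_trans[of _ 1])
  have "AE x in ?M. ennreal (J x) = J0 x"
    using 1 2
  proof eventually_elim
    fix x assume x: "J0 x \<le> ?c" "1 \<le> ?c * J0 x"
    then obtain r where r: "r \<ge> 0" "J0 x = ennreal r" by (cases "J0 x") (auto simp: top_unique)
    have "r \<le> distortion" using x(1) r d(1) by (simp add: ennreal_le_iff)
    moreover have "1 \<le> distortion * r"
      using x(2) r d(1) by (simp add: ennreal_mult[symmetric] ennreal_1[symmetric] ennreal_le_iff del: ennreal_1)
    then have "1 / distortion \<le> r" using d(1) by (simp add: field_simps)
    ultimately show "ennreal (J x) = J0 x" using r by (simp add: J_def)
  qed
  then have "density ?M (\<lambda>x. ennreal (J x)) = density ?M J0"
    by (intro density_cong) (use J0(1) in \<open>simp_all add: J_def\<close>)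
  moreover have "J \<in> borel_measurable ?M" unfolding J_def[abs_def] using J0(1) by measurable
  ultimately show thesis using J0(2) d by (intro that[of J]) (auto simp: J_def)
qed

definition J :: "real^'n \<Rightarrow> real" where
  "J = (SOME J. J \<in> borel_measurable (lebesgue_on U) \<and> (\<forall>x. 1 / distortion \<le> J x) \<and> (\<forall>x. J x \<le> distortion) \<and>
    distr (lebesgue_on V) (lebesgue_on U) G = density (lebesgue_on U) (\<lambda>x. ennreal (J x)))"

lemma J: "J \<in> borel_measurable (lebesgue_on U)" "1 / distortion \<le> J x" "J x \<le> distortion"
    "distr (lebesgue_on V) (lebesgue_on U) G = density (lebesgue_on U) (\<lambda>x. ennreal (J x))"
proof -
  have "\<exists>J. J \<in> borel_measurable (lebesgue_on U) \<and> (\<forall>x. 1 / distortion \<le> J x) \<and> (\<forall>x. J x \<le> distortion) \<and>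
    distr (lebesgue_on V) (lebesgue_on U) G = density (lebesgue_on U) (\<lambda>x. ennreal (J x))"
    by (rule Jacobian_exists) blast
  from someI_ex[OF this] show "J \<in> borel_measurable (lebesgue_on U)" "1 / distortion \<le> J x" "J x \<le> distortion"
    "distr (lebesgue_on V) (lebesgue_on U) G = density (lebesgue_on U) (\<lambda>x. ennreal (J x))"
    unfolding J_def[symmetric] by auto
qed

lemma J_pos: "J x > 0"
  using J(2)[of x] distortion_ge_1 by (smt (verit) divide_pos_pos)

lemma F_measurable: "F \<in> measurable (lebesgue_on U) (lebesgue_on V)"
  by (rule bw.G_measurable)

text \<open>On \<open>V\<close> the integrand equals \<open>k (F (G y))\<close>, so the integral is
  one of \<open>k \<circ> F\<close> against the image measure under \<open>G\<close>, and this
  measure has the density \<open>J\<close>.\<close>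

lemma change_of_variables:
  fixes k :: "real^'n \<Rightarrow> real"
  assumes k: "k \<in> borel_measurable (lebesgue_on V)"
  shows "integrable (lebesgue_on V) k \<longleftrightarrow> integrable (lebesgue_on U) (\<lambda>x. J x * k (F x))"
    "integral\<^sup>L (lebesgue_on V) k = integral\<^sup>L (lebesgue_on U) (\<lambda>x. J x * k (F x))"
proof -
  have kF: "(\<lambda>x. k (F x)) \<in> borel_measurable (lebesgue_on U)"
    using measurable_compose[OF F_measurable k] .
  have nn: "AE x in lebesgue_on U. 0 \<le> J x" using J_pos by (auto intro: less_imp_le)
  have eq: "k y = k (F (G y))" if "y \<in> V" for y using fw.F_G[OF that] by simp
  have "integrable (lebesgue_on V) k \<longleftrightarrow> integrable (lebesgue_on V) (\<lambda>y. k (F (G y)))"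
    by (rule Bochner_Integration.integrable_cong) (use eq in auto)
  also have "\<dots> \<longleftrightarrow> integrable (distr (lebesgue_on V) (lebesgue_on U) G) (\<lambda>x. k (F x))"
    by (rule integrable_distr_eq[OF fw.G_measurable kF, symmetric])
  also have "\<dots> \<longleftrightarrow> integrable (lebesgue_on U) (\<lambda>x. J x * k (F x))"
    unfolding J(4) by (subst integrable_density[OF kF J(1) nn]) simp
  finally show "integrable (lebesgue_on V) k \<longleftrightarrow> integrable (lebesgue_on U) (\<lambda>x. J x * k (F x))" .
  have "integral\<^sup>L (lebesgue_on V) k = integral\<^sup>L (lebesgue_on V) (\<lambda>y. k (F (G y)))"
    by (rule Bochner_Integration.integral_cong) (use eq in auto)
  also have "\<dots> = integral\<^sup>L (distr (lebesgue_on V) (lebesgue_on U) G) (\<lambda>x. k (F x))"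
    by (rule integral_distr[OF fw.G_measurable kF, symmetric])
  also have "\<dots> = integral\<^sup>L (lebesgue_on U) (\<lambda>x. J x * k (F x))"
    unfolding J(4) by (subst integral_density[OF kF J(1) nn]) simp
  finally show "integral\<^sup>L (lebesgue_on V) k = integral\<^sup>L (lebesgue_on U) (\<lambda>x. J x * k (F x))" .
qed

text \<open>Since \<open>J\<close> lies between \<open>1 / distortion\<close> and
  \<open>distortion\<close>, the weight \<open>J\<close> can be inserted or dropped at the price of
  one factor \<open>distortion\<close>.\<close>

lemma L2_comp:
  assumes h: "h \<in> L2 V"
  shows "(\<lambda>x. h (F x)) \<in> L2 U"
    "(L2_norm U (\<lambda>x. h (F x)))\<^sup>2 \<le> distortion * (L2_norm V h)\<^sup>2"
    "(L2_norm V h)\<^sup>2 \<le> distortion * (L2_norm U (\<lambda>x. h (F x)))\<^sup>2"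
proof -
  have m: "(\<lambda>x. h (F x)) \<in> borel_measurable (lebesgue_on U)"
    using measurable_compose[OF F_measurable L2_D(1)[OF h]] .
  have h2: "(\<lambda>x. (h x)\<^sup>2) \<in> borel_measurable (lebesgue_on V)" using L2_D(1)[OF h] by simp
  have i: "integrable (lebesgue_on U) (\<lambda>x. J x * (h (F x))\<^sup>2)"
    using change_of_variables(1)[OF h2] L2_D(2)[OF h] by simp
  have e: "(L2_norm V h)\<^sup>2 = integral\<^sup>L (lebesgue_on U) (\<lambda>x. J x * (h (F x))\<^sup>2)"
    using change_of_variables(2)[OF h2] by (simp add: L2_norm_square)
  have d: "distortion > 0" using distortion_ge_1 by linarith
  have b: "(h (F x))\<^sup>2 \<le> distortion * (J x * (h (F x))\<^sup>2)" for x
  proof -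
    have "1 \<le> distortion * J x" using J(2)[of x] d by (simp add: field_simps)
    from mult_right_mono[OF this, of "(h (F x))\<^sup>2"] show ?thesis by (simp add: mult.assoc)
  qed
  have i2: "integrable (lebesgue_on U) (\<lambda>x. (h (F x))\<^sup>2)"
  proof (rule Bochner_Integration.integrable_bound)
    show "integrable (lebesgue_on U) (\<lambda>x. distortion * (J x * (h (F x))\<^sup>2))" using i by simp
    show "(\<lambda>x. (h (F x))\<^sup>2) \<in> borel_measurable (lebesgue_on U)" using m by simp
    show "AE x in lebesgue_on U. norm ((h (F x))\<^sup>2) \<le> norm (distortion * (J x * (h (F x))\<^sup>2))"
      using b by (intro AE_I2) (smt (verit) real_norm_def zero_le_power2)
  qed
  then show "(\<lambda>x. h (F x)) \<in> L2 U" using m by (simp add: L2_def)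
  have "(L2_norm U (\<lambda>x. h (F x)))\<^sup>2 \<le> integral\<^sup>L (lebesgue_on U) (\<lambda>x. distortion * (J x * (h (F x))\<^sup>2))"
    unfolding L2_norm_square by (rule integral_mono[OF i2 _ b]) (use i in simp)
  then show "(L2_norm U (\<lambda>x. h (F x)))\<^sup>2 \<le> distortion * (L2_norm V h)\<^sup>2" by (simp add: e)
  have "(L2_norm V h)\<^sup>2 \<le> integral\<^sup>L (lebesgue_on U) (\<lambda>x. distortion * (h (F x))\<^sup>2)"
    unfolding e by (rule integral_mono[OF i]) (use i2 J(3) in \<open>auto intro: mult_right_mono\<close>)
  then show "(L2_norm V h)\<^sup>2 \<le> distortion * (L2_norm U (\<lambda>x. h (F x)))\<^sup>2" by (simp add: L2_norm_square)
qed

end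

section \<open>The chain rule\<close>

context near_identity_map
begin

text \<open>The extension by zero is defined on the whole space, so that the composition can be
  mollified in turn.\<close>

definition comp0 :: "(real^'n \<Rightarrow> real) \<Rightarrow> real^'n \<Rightarrow> real" where
  "comp0 a x = (if x \<in> U then a (F x) else 0)"

lemma comp0_borel:
  assumes "continuous_on UNIV a" shows "comp0 a \<in> borel_measurable borel"
proof -
  have "(\<lambda>x. indicator U x *\<^sub>R (a (F x))) \<in> borel_measurable borel"
    by (rule borel_measurable_continuous_on_indicator)
       (use open_U in \<open>auto intro: continuous_on_compose2[OF assms continuous_F]\<close>)
  then show ?thesis by (rule back_subst[of "\<lambda>f. f \<in> borel_measurable borel"]) (auto simp: comp0_def fun_eq_iff)
qed

definition chain_deriv :: "'n \<Rightarrow> (real^'n \<Rightarrow> real) \<Rightarrow> real^'n \<Rightarrow> real" where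
  "chain_deriv j \<phi> x = (\<Sum>l\<in>UNIV. comp0 (partial_deriv l \<phi>) x * D0 l j x)"

lemma partial_deriv_comp_moll:
  fixes \<phi> :: "real^'n \<Rightarrow> real"
  assumes \<phi>: "C_k (Suc 0) \<phi>" and \<rho>: "is_mollifier r \<rho>"
  defines "H \<equiv> \<lambda>x. \<chi> l. moll (F0 l) \<rho> x"
  shows "C_k (Suc 0) (\<lambda>x. \<phi> (H x))"
    "partial_deriv j (\<lambda>x. \<phi> (H x)) x = (\<Sum>l\<in>UNIV. partial_deriv l \<phi> (H x) * partial_deriv j (moll (F0 l) \<rho>) x)"
    "continuous_on UNIV H"
proof -
  have Hd: "(H has_derivative (\<lambda>h. \<chi> l. \<Sum>i\<in>UNIV. h $ i * partial_deriv i (moll (F0 l) \<rho>) x)) (at x)" for x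
    unfolding H_def
    by (subst has_derivative_componentwise_within)
       (auto simp: Basis_vec_def inner_axis intro: mollifier_moll(3)[OF F0_integrable \<rho>])
  have d: "\<phi> differentiable at y" for y using \<phi> by simp
  have hd: "((\<lambda>x. \<phi> (H x)) has_derivative (\<lambda>h. \<Sum>l\<in>UNIV. (\<chi> l. \<Sum>i\<in>UNIV. h $ i * partial_deriv i (moll (F0 l) \<rho>) x) $ l * partial_deriv l \<phi> (H x))) (at x)" for x
    by (rule has_derivative_compose[OF Hd partial_deriv_has_derivative[OF d]])
  show p: "partial_deriv j (\<lambda>x. \<phi> (H x)) x = (\<Sum>l\<in>UNIV. partial_deriv l \<phi> (H x) * partial_deriv j (moll (F0 l) \<rho>) x)" for j x
    by (subst partial_deriv_eq[OF hd]) (simp add: sum_axis_mult mult.commute)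
  show Hc: "continuous_on UNIV H"
    using Hd by (auto simp: continuous_on_eq_continuous_within intro: has_derivative_continuous)
  have c: "continuous_on UNIV (partial_deriv l \<phi>)" "continuous_on UNIV (partial_deriv j (moll (F0 l) \<rho>))" for l j
    using \<phi> mollifier_moll(1)[OF F0_integrable \<rho>, of "Suc 0" l] by simp_all
  have "partial_deriv j (\<lambda>x. \<phi> (H x)) = (\<lambda>x. \<Sum>l\<in>UNIV. partial_deriv l \<phi> (H x) * partial_deriv j (moll (F0 l) \<rho>) x)" for j
    by (rule ext) (rule p)
  then have "continuous_on UNIV (partial_deriv j (\<lambda>x. \<phi> (H x)))" for j
    by (simp add: continuous_on_sum continuous_on_mult c continuous_on_compose2[OF c(1) Hc])
  then show "C_k (Suc 0) (\<lambda>x. \<phi> (H x))" using hd by (auto simp: differentiable_def)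
qed

lemma moll_F_tendsto:
  assumes \<rho>: "\<And>n. is_mollifier (r / real (Suc n)) (\<rho> n)" and x: "cball x r \<subseteq> U" and "r > 0"
  shows "(\<lambda>n. (\<chi> l. moll (F0 l) (\<rho> n) x)) \<longlonglongrightarrow> F x"
proof (rule vec_tendstoI)
  fix l
  have z: "(\<lambda>n. C * (r / real (Suc n))) \<longlonglongrightarrow> 0"
    using tendsto_mult_right_zero[OF LIMSEQ_inverse_real_of_nat, of "C * r"] by (simp add: divide_inverse mult.assoc)
  have "norm (moll (F0 l) (\<rho> n) x - F x $ l) \<le> C * (r / real (Suc n))" for n
  proof -
    have "cball x (r / real (Suc n)) \<subseteq> U" using x \<open>r > 0\<close>
      by (intro order_trans[OF subset_cball x]) (simp add: field_simps)
    then show ?thesis using moll_F_close[OF \<rho>, of x n l] \<open>r > 0\<close> by simp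
  qed
  then have "(\<lambda>n. moll (F0 l) (\<rho> n) x - F x $ l) \<longlonglongrightarrow> 0"
    by (intro Lim_null_comparison[OF _ z] always_eventually) auto
  then show "(\<lambda>n. (\<chi> l. moll (F0 l) (\<rho> n) x) $ l) \<longlonglongrightarrow> F x $ l" by (simp add: LIM_zero_iff)
qed

lemma bounded_U_radius: obtains R where "\<And>x. norm x > R \<Longrightarrow> x \<notin> U"
  using bounded_U unfolding bounded_iff by (metis not_le)

lemma comp0_test_function_borel:
  assumes \<phi>: "test_function V \<phi>"
  shows "comp0 \<phi> \<in> borel_measurable borel" "comp0 (partial_deriv l \<phi>) \<in> borel_measurable borel"
    "chain_deriv j \<phi> \<in> borel_measurable borel"
proof -
  show mw: "comp0 \<phi> \<in> borel_measurable borel" "comp0 (partial_deriv l \<phi>) \<in> borel_measurable borel" for l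
    using comp0_borel test_function_C_k(3,4)[OF \<phi>] by auto
  show "chain_deriv j \<phi> \<in> borel_measurable borel"
    unfolding chain_deriv_def[abs_def] using mw D0_borel by measurable
qed

lemma comp0_test_function_bounds:
  assumes \<phi>: "test_function V \<phi>"
  obtains M where "\<And>x. \<bar>comp0 \<phi> x\<bar> \<le> M" "\<And>j x. \<bar>chain_deriv j \<phi> x\<bar> \<le> M"
proof -
  obtain B where B: "B > 0" "\<And>x. \<bar>\<phi> x\<bar> \<le> B" "\<And>i x. \<bar>partial_deriv i \<phi> x\<bar> \<le> B"
    by (rule test_function_bounds[OF \<phi>]) blast
  have bw: "\<bar>comp0 \<phi> x\<bar> \<le> B" "\<bar>comp0 (partial_deriv l \<phi>) x\<bar> \<le> B" for l x
    using B by (auto simp: comp0_def)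
  have bc: "\<bar>chain_deriv j \<phi> x\<bar> \<le> CARD('n) * (B * (1 + \<epsilon>))" for j x
  proof -
    have "\<bar>chain_deriv j \<phi> x\<bar> \<le> (\<Sum>l::'n\<in>UNIV. B * (1 + \<epsilon>))"
      unfolding chain_deriv_def using bw D0_bound B(1)
      by (intro order_trans[OF sum_abs sum_mono]) (auto simp: abs_mult intro!: mult_mono)
    then show ?thesis by simp
  qed
  show thesis
    by (rule that[of "max B (CARD('n) * (B * (1 + \<epsilon>)))"])
       (use bw bc in \<open>auto intro: max.coboundedI1 max.coboundedI2\<close>)
qed

text \<open>Integration by parts is classical for the smooth maps \<open>H n\<close> obtained by
  mollifying \<open>F\<close>. On the support \<open>K\<close> of \<open>\<psi>\<close> they
  converge to \<open>F\<close> at every point. Their derivatives converge only almost everywhere but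
  stay bounded by \<open>1 + \<epsilon>\<close>, and the derivatives of \<open>\<phi>\<close> are
  continuous and bounded, so dominated convergence applies on both sides.\<close>

lemma comp0_has_weak_partial:
  assumes \<phi>: "test_function V \<phi>"
  shows "has_weak_partial U j (comp0 \<phi>) (chain_deriv j \<phi>)"
proof -
  obtain B where B: "B > 0" "\<And>x. \<bar>\<phi> x\<bar> \<le> B" "\<And>i x. \<bar>partial_deriv i \<phi> x\<bar> \<le> B"
    by (rule test_function_bounds[OF \<phi>]) blast
  note mw = comp0_test_function_borel(1,2)[OF \<phi>] and mc = comp0_test_function_borel(3)[OF \<phi>]
  have zw: "comp0 \<phi> x = 0" "chain_deriv j \<phi> x = 0" if "x \<notin> U" for x
    using that by (auto simp: comp0_def chain_deriv_def)
  have int: "integrable lborel (comp0 \<phi>)" "integrable lborel (chain_deriv j \<phi>)"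
    using comp0_test_function_bounds[OF \<phi>] integrable_bounded_support[OF mw(1) _ zw(1) bounded_U]
      integrable_bounded_support[OF mc _ zw(2) bounded_U] by metis+
  have loc: "locally_integrable U u" if u: "integrable lborel u" for u
    unfolding locally_integrable_def
  proof (intro allI impI)
    fix K assume K: "compact K \<and> K \<subseteq> U"
    then have Kb: "K \<in> sets borel" by (simp add: borel_compact)
    have m: "(\<lambda>x. indicator K x * u x) \<in> borel_measurable borel" using u Kb by auto
    have "integrable lborel (\<lambda>x. indicator K x *\<^sub>R u x)" using Kb u by (intro integrable_mult_indicator) auto
    then show "integrable (lebesgue_on K) u"
      by (subst integrable_lebesgue_on_lborel[OF _ m]) (use K in auto)
  qed
  show ?thesis
    unfolding has_weak_partial_def
  proof (intro conjI allI impI loc int)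
    fix \<psi> assume \<psi>: "test_function U \<psi>"
    obtain K q where K: "compact K" "K \<subseteq> U" "K \<subseteq> cball 0 q" "\<And>x. x \<notin> K \<Longrightarrow> \<psi> x = 0"
      "\<And>i x. x \<notin> K \<Longrightarrow> partial_deriv i \<psi> x = 0" by (rule test_functionE[OF \<psi>]) blast
    obtain B' where B': "B' > 0" "\<And>x. \<bar>\<psi> x\<bar> \<le> B'" "\<And>i x. \<bar>partial_deriv i \<psi> x\<bar> \<le> B'"
      by (rule test_function_bounds[OF \<psi>]) blast
    obtain r where r: "r > 0" "{x + y | x y. x \<in> K \<and> y \<in> cball 0 r} \<subseteq> U"
      by (rule compact_cball_sum[OF K(1) open_U K(2)])
    note rU = cball_subset_of_sum[OF r(2)]
    obtain R where R: "\<And>x. norm x > R \<Longrightarrow> x \<notin> U" by (rule bounded_U_radius) blast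
    obtain \<rho> where \<rho>: "\<And>n. is_mollifier (r / real (Suc n)) (\<rho> n)"
      "\<And>l. AE x in lborel. (\<lambda>n. moll (D0 l j) (\<rho> n) x) \<longlonglongrightarrow> D0 l j x"
      by (rule mollifier_sequence[where f="\<lambda>l. D0 l j" and M="1 + \<epsilon>" and R=R and r=r])
         (use D0_borel D0_bound r R in \<open>auto simp: D0_def\<close>)
    define H where "H n x = (\<chi> l. moll (F0 l) (\<rho> n) x)" for n x
    have f: "C_k (Suc 0) (\<lambda>x. \<phi> (H n x))"
      "partial_deriv j (\<lambda>x. \<phi> (H n x)) x = (\<Sum>l\<in>UNIV. partial_deriv l \<phi> (H n x) * partial_deriv j (moll (F0 l) (\<rho> n)) x)"
      "continuous_on UNIV (H n)" for n x
      unfolding H_def using partial_deriv_comp_moll[OF test_function_C_k(1)[OF \<phi>] \<rho>(1)] by auto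
    have Hm: "(\<lambda>x. \<phi> (H n x)) \<in> borel_measurable borel" "(\<lambda>x. partial_deriv l \<phi> (H n x)) \<in> borel_measurable borel" for n l
      by (rule borel_measurable_continuous_onI, rule continuous_on_compose2[OF _ f(3)];
          use test_function_C_k(3,4)[OF \<phi>] in auto)+
    have Dm: "moll (D0 l j) (\<rho> n) \<in> borel_measurable borel" for l n
      using C_k_continuous[OF mollifier_moll(1)[OF D0_integrable \<rho>(1), where k=0]] by (rule borel_measurable_continuous_onI)
    \<comment> \<open>\<open>F0\<close> and \<open>D0\<close> are mollified with the same kernels,
      so on \<open>K\<close> the classical Jacobian of \<open>H n\<close> is the mollified weak
      Jacobian.\<close>
    have pD: "partial_deriv j (moll (F0 l) (\<rho> n)) x = moll (D0 l j) (\<rho> n) x" if "x \<in> K" for l n x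
    proof (rule partial_deriv_moll_weak[OF open_U D0_weak F0_integrable D0_integrable \<rho>(1)])
      show "cball x (r / real (Suc n)) \<subseteq> U"
        using rU[OF that] r(1) by (intro order_trans[OF subset_cball rU[OF that]]) (simp add: field_simps)
    qed
    have Hlim: "(\<lambda>n. H n x) \<longlonglongrightarrow> F x" if "x \<in> K" for x
      unfolding H_def by (rule moll_F_tendsto[OF \<rho>(1) rU[OF that] r(1)])
    have cp: "isCont \<phi> y" "isCont (partial_deriv l \<phi>) y" for l y
      using test_function_C_k(3,4)[OF \<phi>, where S=UNIV] by (auto simp: continuous_on_eq_continuous_at)
    have ibp: "(\<integral>x. \<phi> (H n x) * partial_deriv j \<psi> x \<partial>lborel)
       = - (\<integral>x. (\<Sum>l\<in>UNIV. partial_deriv l \<phi> (H n x) * moll (D0 l j) (\<rho> n) x) * \<psi> x \<partial>lborel)" for n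
    proof -
      have "(\<integral>x. \<phi> (H n x) * partial_deriv j \<psi> x \<partial>lborel) = - (\<integral>x. partial_deriv j (\<lambda>x. \<phi> (H n x)) x * \<psi> x \<partial>lborel)"
        by (rule integral_by_parts[OF f(1) test_function_C_k(1)[OF \<psi>], where r=q]) (use K in force)
      also have "(\<integral>x. partial_deriv j (\<lambda>x. \<phi> (H n x)) x * \<psi> x \<partial>lborel) = (\<integral>x. (\<Sum>l\<in>UNIV. partial_deriv l \<phi> (H n x) * moll (D0 l j) (\<rho> n) x) * \<psi> x \<partial>lborel)"
      proof (rule Bochner_Integration.integral_cong[OF refl])
        fix x
        show "partial_deriv j (\<lambda>x. \<phi> (H n x)) x * \<psi> x = (\<Sum>l\<in>UNIV. partial_deriv l \<phi> (H n x) * moll (D0 l j) (\<rho> n) x) * \<psi> x"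
          by (cases "x \<in> K") (simp_all add: f(2) pD K(4))
      qed
      finally show ?thesis .
    qed
    have iK: "integrable lborel (\<lambda>x. M * indicator K x)" for M :: real
      using K(1) emeasure_bounded_finite[OF compact_imp_bounded[OF K(1)]]
      by (intro integrable_mult_right integrable_real_indicator) (auto intro: borel_compact)
    have L1: "(\<lambda>n. \<integral>x. \<phi> (H n x) * partial_deriv j \<psi> x \<partial>lborel) \<longlonglongrightarrow> (\<integral>x. comp0 \<phi> x * partial_deriv j \<psi> x \<partial>lborel)"
    proof (rule integral_dominated_convergence[OF _ _ iK[of "B * B'"]])
      show "(\<lambda>x. comp0 \<phi> x * partial_deriv j \<psi> x) \<in> borel_measurable lborel"
        using mw test_function_C_k(7)[OF \<psi>] by simp
      show "(\<lambda>x. \<phi> (H n x) * partial_deriv j \<psi> x) \<in> borel_measurable lborel" for n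
        using Hm test_function_C_k(7)[OF \<psi>] by simp
      show "AE x in lborel. (\<lambda>n. \<phi> (H n x) * partial_deriv j \<psi> x) \<longlonglongrightarrow> comp0 \<phi> x * partial_deriv j \<psi> x"
      proof (rule AE_I2)
        fix x
        show "(\<lambda>n. \<phi> (H n x) * partial_deriv j \<psi> x) \<longlonglongrightarrow> comp0 \<phi> x * partial_deriv j \<psi> x"
        proof (cases "x \<in> K")
          case True
          then have "comp0 \<phi> x = \<phi> (F x)" using K(2) by (auto simp: comp0_def)
          then show ?thesis using isCont_tendsto_compose[OF cp(1) Hlim[OF True]] by (auto intro: tendsto_mult_right)
        qed (simp add: K(5))
      qed
      show "AE x in lborel. norm (\<phi> (H n x) * partial_deriv j \<psi> x) \<le> B * B' * indicator K x" for n
      proof (rule AE_I2)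
        fix x
        show "norm (\<phi> (H n x) * partial_deriv j \<psi> x) \<le> B * B' * indicator K x"
          using B B' by (cases "x \<in> K") (auto simp: abs_mult K(5) intro!: mult_mono)
      qed
    qed
    have L2: "(\<lambda>n. \<integral>x. (\<Sum>l\<in>UNIV. partial_deriv l \<phi> (H n x) * moll (D0 l j) (\<rho> n) x) * \<psi> x \<partial>lborel) \<longlonglongrightarrow> (\<integral>x. chain_deriv j \<phi> x * \<psi> x \<partial>lborel)"
    proof (rule integral_dominated_convergence[OF _ _ iK[of "CARD('n) * (B * (1 + \<epsilon>)) * B'"]])
      show "(\<lambda>x. chain_deriv j \<phi> x * \<psi> x) \<in> borel_measurable lborel"
        using mc test_function_C_k(6)[OF \<psi>] by simp
      show "(\<lambda>x. (\<Sum>l\<in>UNIV. partial_deriv l \<phi> (H n x) * moll (D0 l j) (\<rho> n) x) * \<psi> x) \<in> borel_measurable lborel" for n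
        using Hm Dm test_function_C_k(6)[OF \<psi>] by simp
      have "AE x in lborel. \<forall>l\<in>UNIV. (\<lambda>n. moll (D0 l j) (\<rho> n) x) \<longlonglongrightarrow> D0 l j x"
        by (rule AE_finite_allI) (auto intro: \<rho>(2))
      then show "AE x in lborel. (\<lambda>n. (\<Sum>l\<in>UNIV. partial_deriv l \<phi> (H n x) * moll (D0 l j) (\<rho> n) x) * \<psi> x) \<longlonglongrightarrow> chain_deriv j \<phi> x * \<psi> x"
      proof (rule AE_mp, intro AE_I2 impI)
        fix x assume lim: "\<forall>l\<in>UNIV. (\<lambda>n. moll (D0 l j) (\<rho> n) x) \<longlonglongrightarrow> D0 l j x"
        show "(\<lambda>n. (\<Sum>l\<in>UNIV. partial_deriv l \<phi> (H n x) * moll (D0 l j) (\<rho> n) x) * \<psi> x) \<longlonglongrightarrow> chain_deriv j \<phi> x * \<psi> x"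
        proof (cases "x \<in> K")
          case True
          then have "chain_deriv j \<phi> x = (\<Sum>l\<in>UNIV. partial_deriv l \<phi> (F x) * D0 l j x)"
            using K(2) by (auto simp: comp0_def chain_deriv_def)
          moreover have "(\<lambda>n. \<Sum>l\<in>UNIV. partial_deriv l \<phi> (H n x) * moll (D0 l j) (\<rho> n) x) \<longlonglongrightarrow> (\<Sum>l\<in>UNIV. partial_deriv l \<phi> (F x) * D0 l j x)"
            using lim by (intro tendsto_sum tendsto_mult isCont_tendsto_compose[OF cp(2) Hlim[OF True]]) auto
          ultimately show ?thesis by (auto intro: tendsto_mult_right)
        qed (simp add: K(4))
      qed
      show "AE x in lborel. norm ((\<Sum>l\<in>UNIV. partial_deriv l \<phi> (H n x) * moll (D0 l j) (\<rho> n) x) * \<psi> x)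
          \<le> CARD('n) * (B * (1 + \<epsilon>)) * B' * indicator K x" for n
      proof (rule AE_I2)
        fix x
        have mb: "\<bar>moll (D0 l j) (\<rho> n) x\<bar> \<le> 1 + \<epsilon>" for l
          using moll_close[OF D0_integrable \<rho>(1), where x=x and c=0 and e="1 + \<epsilon>"] D0_bound by simp
        have "\<bar>\<Sum>l\<in>UNIV. partial_deriv l \<phi> (H n x) * moll (D0 l j) (\<rho> n) x\<bar> \<le> (\<Sum>l::'n\<in>UNIV. B * (1 + \<epsilon>))"
          using mb B by (intro order_trans[OF sum_abs sum_mono]) (auto simp: abs_mult intro!: mult_mono)
        then have "\<bar>\<Sum>l\<in>UNIV. partial_deriv l \<phi> (H n x) * moll (D0 l j) (\<rho> n) x\<bar> \<le> CARD('n) * (B * (1 + \<epsilon>))" by simp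
        then have "\<bar>\<Sum>l\<in>UNIV. partial_deriv l \<phi> (H n x) * moll (D0 l j) (\<rho> n) x\<bar> * \<bar>\<psi> x\<bar> \<le> (CARD('n) * (B * (1 + \<epsilon>))) * B'"
          using B'(2)[of x] B eps_nonneg by (intro mult_mono) auto
        then show "norm ((\<Sum>l\<in>UNIV. partial_deriv l \<phi> (H n x) * moll (D0 l j) (\<rho> n) x) * \<psi> x)
          \<le> CARD('n) * (B * (1 + \<epsilon>)) * B' * indicator K x"
          by (cases "x \<in> K") (simp_all add: abs_mult K(4))
      qed
    qed
    have "(\<integral>x. comp0 \<phi> x * partial_deriv j \<psi> x \<partial>lborel) = - (\<integral>x. chain_deriv j \<phi> x * \<psi> x \<partial>lborel)"
      using LIMSEQ_unique[OF L1] tendsto_minus[OF L2] by (simp add: ibp)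
    moreover have "integral\<^sup>L (lebesgue_on U) (\<lambda>x. comp0 \<phi> x * partial_deriv j \<psi> x) = (\<integral>x. comp0 \<phi> x * partial_deriv j \<psi> x \<partial>lborel)"
      by (rule integral_lebesgue_on_lborel) (use zw mw open_U test_function_C_k(7)[OF \<psi>] in auto)
    moreover have "integral\<^sup>L (lebesgue_on U) (\<lambda>x. chain_deriv j \<phi> x * \<psi> x) = (\<integral>x. chain_deriv j \<phi> x * \<psi> x \<partial>lborel)"
      by (rule integral_lebesgue_on_lborel) (use zw mc open_U test_function_C_k(6)[OF \<psi>] in auto)
    ultimately show "integral\<^sup>L (lebesgue_on U) (\<lambda>x. comp0 \<phi> x * partial_deriv j \<psi> x) = - integral\<^sup>L (lebesgue_on U) (\<lambda>x. chain_deriv j \<phi> x * \<psi> x)"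
      by simp
  qed
qed

lemma comp0_H10_grad:
  assumes \<phi>: "test_function V \<phi>"
  shows "H10_grad U (comp0 \<phi>) (\<lambda>j. chain_deriv j \<phi>)"
proof -
  obtain K q where K: "compact K" "K \<subseteq> V" "K \<subseteq> cball 0 q" "\<And>x. x \<notin> K \<Longrightarrow> \<phi> x = 0"
      "\<And>i x. x \<notin> K \<Longrightarrow> partial_deriv i \<phi> x = 0" by (rule test_functionE[OF \<phi>]) blast
  obtain M where M: "\<And>x. \<bar>comp0 \<phi> x\<bar> \<le> M" "\<And>j x. \<bar>chain_deriv j \<phi> x\<bar> \<le> M"
    by (rule comp0_test_function_bounds[OF \<phi>]) blast
  have M0: "M \<ge> 0" using M(1)[of 0] by linarith
  define K' where "K' = G ` K"
  have "continuous_on K G"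
    using lipschitz_on_continuous_on[OF lipschitz_G] K(2) continuous_on_subset by blast
  then have K': "compact K'" "K' \<subseteq> U"
    unfolding K'_def using K(1,2) G_in by (auto intro: compact_continuous_image)
  have nK: "F x \<notin> K" if "x \<in> U" "x \<notin> K'" for x
    using that G_F[of x] unfolding K'_def by (metis imageI)
  have zw: "comp0 \<phi> x = 0" "chain_deriv j \<phi> x = 0" if "x \<notin> K'" for j x
    using nK[OF _ that] K(4,5) by (auto simp: comp0_def chain_deriv_def intro!: sum.neutral)
  \<comment> \<open>The function and all its derivatives form one finite family indexed by an option
    type, so that one sequence of kernels serves them all.\<close>
  define f where "f k = (case k of None \<Rightarrow> comp0 \<phi> | Some j \<Rightarrow> chain_deriv j \<phi>)" for k
  have f: "f k \<in> borel_measurable borel" "\<bar>f k x\<bar> \<le> M" "x \<notin> K' \<Longrightarrow> f k x = 0" for k x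
    using comp0_test_function_borel[OF \<phi>] M zw by (auto simp: f_def split: option.splits)
  have fi: "integrable lborel (f k)" for k
    by (rule integrable_bounded_support[OF f(1,2,3) compact_imp_bounded[OF K'(1)]])
  obtain r0 where r0: "r0 > 0" "compact {x + y | x y. x \<in> K' \<and> y \<in> cball 0 r0}"
      "{x + y | x y. x \<in> K' \<and> y \<in> cball 0 r0} \<subseteq> U"
    by (rule compact_cball_sum[OF K'(1) open_U K'(2)])
  \<comment> \<open>One half of the room is used up by the support of the mollification; the other
    half leaves a ball of radius \<open>r\<close> inside \<open>U\<close> around each point of that
    support.\<close>
  define r where "r = r0 / 2"
  let ?K = "{x + y | x y. x \<in> K' \<and> y \<in> cball 0 r}"
  have rK: "compact ?K" by (rule compact_sums[OF K'(1) compact_cball])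
  have rU: "cball x r \<subseteq> U" if xK: "x \<in> ?K" for x
  proof
    fix y assume y: "y \<in> cball x r"
    obtain a b where ab: "x = a + b" "a \<in> K'" "b \<in> cball 0 r" using xK by blast
    have "norm (y - a) \<le> norm (y - x) + norm (x - a)" using norm_triangle_ineq[of "y - x" "x - a"] by simp
    also have "\<dots> \<le> r + r" using y ab by (intro add_mono) (auto simp: dist_norm norm_minus_commute)
    finally have "y - a \<in> cball 0 r0" by (simp add: r_def)
    moreover have "y = a + (y - a)" by simp
    ultimately show "y \<in> U" using r0(3) ab(2) by blast
  qed
  have r: "r > 0" using r0(1) by (simp add: r_def)
  have rKU: "?K \<subseteq> U" using rU r by force
  obtain R where R: "\<And>x. norm x > R \<Longrightarrow> x \<notin> U" by (rule bounded_U_radius) blast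
  obtain \<rho> where \<rho>: "\<And>n. is_mollifier (r / real (Suc n)) (\<rho> n)"
    "\<And>k. (\<lambda>n. \<integral>x. \<bar>moll (f k) (\<rho> n) x - f k x\<bar> \<partial>lborel) \<longlonglongrightarrow> 0"
    by (rule mollifier_sequence[where f=f and M=M and R=R and r=r]) (use f r R K' in blast)+
  have rn: "r / real (Suc n) \<le> r" for n using r by (simp add: field_simps)
  have z: "moll (f k) (\<rho> n) x = 0" if "x \<notin> ?K" for k n x
    by (rule moll_support[OF \<rho>(1) rn f(3) that])
  have zU: "moll (f k) (\<rho> n) x = 0" if "x \<notin> U" for k n x
    using z rKU that by blast
  have t: "test_function U (moll (f k) (\<rho> n))" for k n
    by (rule moll_test_function[OF fi f(3) \<rho>(1) rn rK rKU])
  have pd: "partial_deriv j (moll (comp0 \<phi>) (\<rho> n)) x = moll (chain_deriv j \<phi>) (\<rho> n) x" for j n x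
  proof (cases "x \<in> ?K")
    case True
    show ?thesis
      by (rule partial_deriv_moll_weak[OF open_U comp0_has_weak_partial[OF \<phi>] fi[of None, simplified f_def, simplified]
           fi[of "Some j", simplified f_def, simplified] \<rho>(1) order_trans[OF subset_cball[OF rn] rU[OF True]]])
  next
    case False
    have "partial_deriv j (moll (f None) (\<rho> n)) x = 0"
      by (rule partial_deriv_zero_off_closed[OF z compact_imp_closed[OF rK] False])
    then show ?thesis using z[OF False, of "Some j" n] by (simp add: f_def)
  qed
  have fb: "f k \<in> borel_measurable (lebesgue_on U)" for k
    using f(1) by (simp add: borel_measurable_lebesgue_on)
  have fU: "f k x = 0" if "x \<notin> U" for k x using that K'(2) f(3) by blast
  \<comment> \<open>Both functions are bounded by \<open>M\<close>, so the squared error is at most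
    \<open>2 * M\<close> times the error and convergence in \<open>L1\<close> implies convergence in
    \<open>L2\<close>.\<close>
  have conv: "(\<lambda>n. L2_norm U (\<lambda>x. f k x - moll (f k) (\<rho> n) x)) \<longlonglongrightarrow> 0" for k
  proof -
    let ?m = "\<lambda>n. moll (f k) (\<rho> n)"
    have mb: "\<bar>?m n x\<bar> \<le> M" for n x
      using moll_close[OF fi \<rho>(1), where x=x and c=0 and e=M] f(2) by simp
    have mm: "?m n \<in> borel_measurable borel" for n by (rule test_function_C_k(6)[OF t])
    have "(L2_norm U (\<lambda>x. f k x - ?m n x))\<^sup>2 = (\<integral>x. (f k x - ?m n x)\<^sup>2 \<partial>lborel)" for n
      unfolding L2_norm_square
      by (rule integral_lebesgue_on_lborel) (use open_U f(1) mm fU zU in auto)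
    also have "\<dots> n \<le> 2 * M * (\<integral>x. \<bar>?m n x - f k x\<bar> \<partial>lborel)" for n
    proof -
      have i: "integrable lborel (\<lambda>x. \<bar>?m n x - f k x\<bar>)"
        using moll_L1_bound(1)[OF fi \<rho>(1)] fi by (intro integrable_abs Bochner_Integration.integrable_diff)
      have b: "(f k x - ?m n x)\<^sup>2 \<le> 2 * M * \<bar>?m n x - f k x\<bar>" for x
      proof -
        have "\<bar>?m n x - f k x\<bar> \<le> 2 * M" using mb[of n x] f(2)[of k x] by linarith
        then have "\<bar>?m n x - f k x\<bar> * \<bar>?m n x - f k x\<bar> \<le> 2 * M * \<bar>?m n x - f k x\<bar>"
          by (rule mult_right_mono) simp
        then show ?thesis by (simp add: power2_eq_square algebra_simps)
      qed
      have "integrable lborel (\<lambda>x. (f k x - ?m n x)\<^sup>2)"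
      proof (rule Bochner_Integration.integrable_bound)
        show "integrable lborel (\<lambda>x. 2 * M * \<bar>?m n x - f k x\<bar>)" using i by simp
        show "(\<lambda>x. (f k x - ?m n x)\<^sup>2) \<in> borel_measurable lborel" using f(1) mm by simp
      qed (use b M0 in \<open>auto intro!: AE_I2\<close>)
      then have "(\<integral>x. (f k x - ?m n x)\<^sup>2 \<partial>lborel) \<le> (\<integral>x. 2 * M * \<bar>?m n x - f k x\<bar> \<partial>lborel)"
        using i b by (intro integral_mono) auto
      then show ?thesis by simp
    qed
    finally have le: "(L2_norm U (\<lambda>x. f k x - ?m n x))\<^sup>2 \<le> 2 * M * (\<integral>x. \<bar>?m n x - f k x\<bar> \<partial>lborel)" for n .
    have "(\<lambda>n. (L2_norm U (\<lambda>x. f k x - ?m n x))\<^sup>2) \<longlonglongrightarrow> 0"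
      by (rule real_tendsto_sandwich[OF _ _ tendsto_const tendsto_mult_right_zero[OF \<rho>(2), of "2 * M" k]])
         (use le in auto)
    from tendsto_real_sqrt[OF this] show ?thesis by simp
  qed
  have L2f: "f k \<in> L2 U" for k
  proof -
    have "integrable lborel (\<lambda>x. (f k x)\<^sup>2)"
    proof (rule integrable_bounded_support[OF _ _ _ compact_imp_bounded[OF K'(1)]])
      show "\<bar>(f k x)\<^sup>2\<bar> \<le> M\<^sup>2" for x using f(2)[of k x] M0 by (simp add: abs_le_square_iff[symmetric])
    qed (use f in auto)
    then have "integrable (lebesgue_on U) (\<lambda>x. (f k x)\<^sup>2)"
      by (subst integrable_lebesgue_on_lborel) (use open_U f fU in auto)
    then show ?thesis using fb by (simp add: L2_def)
  qed
  show ?thesis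
    unfolding H10_grad_def
  proof (intro conjI allI impI)
    show "comp0 \<phi> \<in> L2 U" using L2f[of None] by (simp add: f_def)
    show "chain_deriv j \<phi> \<in> L2 U" for j using L2f[of "Some j"] by (simp add: f_def)
    fix e :: real assume "e > 0"
    have "eventually (\<lambda>n. \<forall>k\<in>UNIV. L2_norm U (\<lambda>x. f k x - moll (f k) (\<rho> n) x) < e) sequentially"
      by (intro eventually_ball_finite ballI order_tendstoD(2)[OF conv \<open>e > 0\<close>]) simp
    then obtain n where n: "\<And>k. L2_norm U (\<lambda>x. f k x - moll (f k) (\<rho> n) x) < e"
      by (auto simp: eventually_sequentially)
    show "\<exists>\<psi>. test_function U \<psi> \<and> L2_norm U (\<lambda>x. comp0 \<phi> x - \<psi> x) < e \<and>
      (\<forall>i. L2_norm U (\<lambda>x. chain_deriv i \<phi> x - partial_deriv i \<psi> x) < e)"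
    proof (intro exI[of _ "moll (comp0 \<phi>) (\<rho> n)"] conjI allI)
      show "test_function U (moll (comp0 \<phi>) (\<rho> n))" using t[of None n] by (simp add: f_def)
      show "L2_norm U (\<lambda>x. comp0 \<phi> x - moll (comp0 \<phi>) (\<rho> n) x) < e" using n[of None] by (simp add: f_def)
      show "L2_norm U (\<lambda>x. chain_deriv i \<phi> x - partial_deriv i (moll (comp0 \<phi>) (\<rho> n)) x) < e" for i
        using n[of "Some i"] by (simp add: f_def pd)
    qed
  qed
qed

lemma D_measurable: "(\<lambda>x. D x $ k $ j) \<in> borel_measurable (lebesgue_on U)"
  using D_borel by (simp add: borel_measurable_lebesgue_on)

end

context near_identity_pair
begin

text \<open>The square root of \<open>distortion\<close> is generously replaced by
  \<open>distortion\<close>, which is at least 1.\<close>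

lemma L2_norm_comp:
  assumes "h \<in> L2 V" shows "L2_norm U (\<lambda>x. h (F x)) \<le> distortion * L2_norm V h"
proof (rule power2_le_imp_le)
  have "(L2_norm U (\<lambda>x. h (F x)))\<^sup>2 \<le> distortion * (L2_norm V h)\<^sup>2" by (rule L2_comp(2)[OF assms])
  also have "\<dots> \<le> distortion\<^sup>2 * (L2_norm V h)\<^sup>2"
    using distortion_ge_1 by (intro mult_right_mono) (auto simp: power2_eq_square)
  finally show "(L2_norm U (\<lambda>x. h (F x)))\<^sup>2 \<le> (distortion * L2_norm V h)\<^sup>2" by (simp add: power_mult_distrib)
qed (use distortion_ge_1 in simp)

text \<open>A density argument in two stages: a test function \<open>\<phi>\<close> on
  \<open>V\<close> approximates \<open>u\<close>, and a test function \<open>\<psi>\<close> on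
  \<open>U\<close> approximates \<open>\<phi> \<circ> F\<close>. The first error survives
  composition with \<open>F\<close> and multiplication by the bounded entries of \<open>D\<close> up
  to constant factors.\<close>

lemma H10_grad_comp:
  assumes u: "H10_grad V u g"
  shows "H10_grad U (\<lambda>x. u (F x)) (\<lambda>j x. \<Sum>l\<in>UNIV. g l (F x) * D x $ l $ j)"
  unfolding H10_grad_def
proof (intro conjI allI impI)
  have L: "u \<in> L2 V" "g l \<in> L2 V" for l using u by (auto simp: H10_grad_def)
  have DB: "\<bar>D x $ k $ j\<bar> \<le> 1 + \<epsilon>" for x k j by (rule fw.D_component)
  have e1: "1 + \<epsilon> \<ge> 0" using fw.eps_nonneg by simp
  show uF: "(\<lambda>x. u (F x)) \<in> L2 U" by (rule L2_comp(1)[OF L(1)])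
  show "(\<lambda>x. \<Sum>l\<in>UNIV. g l (F x) * D x $ l $ j) \<in> L2 U" for j
    by (intro L2_sum L2_bounded_mult[OF L2_comp(1)[OF L(2)] fw.D_measurable DB])
  fix e :: real assume "e > 0"
  \<comment> \<open>\<open>m\<close> adds the factor by which errors of partial derivatives are
    amplified to the factor for the function itself, so that one tolerance \<open>e'\<close> serves
    both.\<close>
  define m where "m = real CARD('n) * ((1 + \<epsilon>) * distortion) + distortion"
  have m: "m > 0" using distortion_ge_1 e1 by (auto simp: m_def intro!: add_nonneg_pos mult_nonneg_nonneg)
  define e' where "e' = e / (2 * m)"
  have e': "e' > 0" "m * e' = e / 2" using m \<open>e > 0\<close> by (auto simp: e'_def)
  obtain \<phi> where \<phi>: "test_function V \<phi>" "L2_norm V (\<lambda>x. u x - \<phi> x) < e'"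
    "\<And>i. L2_norm V (\<lambda>x. g i x - partial_deriv i \<phi> x) < e'"
    using u e'(1) unfolding H10_grad_def by blast
  have p: "\<phi> \<in> L2 V" "partial_deriv i \<phi> \<in> L2 V" for i using L2_test_function[OF fw.open_V \<phi>(1)] by auto
  obtain \<psi> where \<psi>: "test_function U \<psi>" "L2_norm U (\<lambda>x. fw.comp0 \<phi> x - \<psi> x) < e / 2"
    "\<And>i. L2_norm U (\<lambda>x. fw.chain_deriv i \<phi> x - partial_deriv i \<psi> x) < e / 2"
    using fw.comp0_H10_grad[OF \<phi>(1)] \<open>e > 0\<close> unfolding H10_grad_def by (metis half_gt_zero)
  have q: "\<psi> \<in> L2 U" "partial_deriv i \<psi> \<in> L2 U" for i using L2_test_function[OF fw.open_U \<psi>(1)] by auto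
  have cU: "L2_norm U a = L2_norm U b" if "\<And>x. x \<in> U \<Longrightarrow> a x = b x" for a b
    unfolding L2_norm_def L2_inner_def
    by (intro arg_cong[where f=sqrt] Bochner_Integration.integral_cong) (use that in auto)
  have c0: "fw.comp0 \<phi> \<in> L2 U" "fw.chain_deriv j \<phi> \<in> L2 U" for j
    using fw.comp0_H10_grad[OF \<phi>(1)] by (auto simp: H10_grad_def)
  show "\<exists>\<psi>. test_function U \<psi> \<and> L2_norm U (\<lambda>x. u (F x) - \<psi> x) < e \<and>
     (\<forall>j. L2_norm U (\<lambda>x. (\<Sum>l\<in>UNIV. g l (F x) * D x $ l $ j) - partial_deriv j \<psi> x) < e)"
  proof (intro exI[of _ \<psi>] conjI allI \<psi>(1))
    have "L2_norm U (\<lambda>x. u (F x) - \<psi> x) = L2_norm U (\<lambda>x. (u (F x) - \<phi> (F x)) + (fw.comp0 \<phi> x - \<psi> x))"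
      by (rule cU) (simp add: fw.comp0_def)
    also have "\<dots> \<le> L2_norm U (\<lambda>x. u (F x) - \<phi> (F x)) + L2_norm U (\<lambda>x. fw.comp0 \<phi> x - \<psi> x)"
      by (intro L2_norm_triangle L2_diff uF L2_comp(1) p q c0)
    also have "L2_norm U (\<lambda>x. u (F x) - \<phi> (F x)) \<le> distortion * L2_norm V (\<lambda>x. u x - \<phi> x)"
      by (rule L2_norm_comp[OF L2_diff[OF L(1) p(1)]])
    also have "\<dots> \<le> distortion * e'" using \<phi>(2) distortion_ge_1 by (intro mult_left_mono) auto
    also have "\<dots> \<le> m * e'" using e' e1 distortion_ge_1 by (intro mult_right_mono) (auto simp: m_def)
    finally show "L2_norm U (\<lambda>x. u (F x) - \<psi> x) < e" using \<psi>(2) e'(2) by simp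
    fix j
    let ?d = "\<lambda>l x. g l (F x) - partial_deriv l \<phi> (F x)"
    have dL: "?d l \<in> L2 U" for l by (intro L2_diff L2_comp(1) L p)
    have dn: "L2_norm U (\<lambda>x. ?d l x * D x $ l $ j) \<le> (1 + \<epsilon>) * distortion * e'" for l
    proof -
      have "L2_norm U (\<lambda>x. ?d l x * D x $ l $ j) \<le> (1 + \<epsilon>) * L2_norm U (?d l)"
        by (rule L2_norm_bounded_mult[OF dL fw.D_measurable DB e1])
      also have "\<dots> \<le> (1 + \<epsilon>) * (distortion * L2_norm V (\<lambda>x. g l x - partial_deriv l \<phi> x))"
        by (rule mult_left_mono[OF L2_norm_comp[OF L2_diff[OF L(2) p(2)]] e1])
      also have "\<dots> \<le> (1 + \<epsilon>) * (distortion * e')"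
        using \<phi>(3)[of l] distortion_ge_1 e1 by (intro mult_left_mono) auto
      finally show ?thesis by (simp add: mult.assoc)
    qed
    have "L2_norm U (\<lambda>x. (\<Sum>l\<in>UNIV. g l (F x) * D x $ l $ j) - partial_deriv j \<psi> x)
      = L2_norm U (\<lambda>x. (\<Sum>l\<in>UNIV. ?d l x * D x $ l $ j) + (fw.chain_deriv j \<phi> x - partial_deriv j \<psi> x))"
      by (rule cU) (simp add: fw.comp0_def fw.chain_deriv_def fw.D0_def left_diff_distrib sum_subtractf)
    also have "\<dots> \<le> L2_norm U (\<lambda>x. \<Sum>l\<in>UNIV. ?d l x * D x $ l $ j) + L2_norm U (\<lambda>x. fw.chain_deriv j \<phi> x - partial_deriv j \<psi> x)"
      by (intro L2_norm_triangle L2_diff L2_sum L2_bounded_mult[OF dL fw.D_measurable DB] c0 q)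
    also have "L2_norm U (\<lambda>x. \<Sum>l\<in>UNIV. ?d l x * D x $ l $ j) \<le> (\<Sum>l\<in>UNIV. L2_norm U (\<lambda>x. ?d l x * D x $ l $ j))"
      by (intro L2_norm_sum L2_bounded_mult[OF dL fw.D_measurable DB]) auto
    also have "\<dots> \<le> (\<Sum>l::'n\<in>UNIV. (1 + \<epsilon>) * distortion * e')" by (rule sum_mono) (rule dn)
    also have "\<dots> \<le> m * e'" using e' distortion_ge_1 by (simp add: m_def algebra_simps)
    finally show "L2_norm U (\<lambda>x. (\<Sum>l\<in>UNIV. g l (F x) * D x $ l $ j) - partial_deriv j \<psi> x) < e"
      using \<psi>(3)[of j] e'(2) by simp
  qed
qed

end

section \<open>Comparison of the inf-sup constants\<close>

lemma H10_vecD: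
  fixes \<Omega> :: "(real^'n::finite) set"
  assumes "open \<Omega>" "v \<in> H10_vec \<Omega>"
  shows "H10_grad \<Omega> (\<lambda>x. v x $ k) (\<lambda>j. weak_partial \<Omega> j (\<lambda>y. v y $ k))"
    "weak_partial \<Omega> j (\<lambda>y. v y $ k) \<in> L2 \<Omega>"
    "weak_div \<Omega> v \<in> L2 \<Omega>"
proof -
  show 1: "H10_grad \<Omega> (\<lambda>x. v x $ k) (\<lambda>j. weak_partial \<Omega> j (\<lambda>y. v y $ k))" for k
    by (rule H10_imp_H10_grad[OF assms(1)]) (use assms(2) in \<open>simp add: H10_vec_def\<close>)
  show 2: "weak_partial \<Omega> j (\<lambda>y. v y $ k) \<in> L2 \<Omega>" for j k using 1[of k] by (simp add: H10_grad_def)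
  show "weak_div \<Omega> v \<in> L2 \<Omega>" unfolding weak_div_def[abs_def] by (intro L2_sum 2)
qed

text \<open>As a Euclidean norm over pairs of indices the seminorm inherits monotonicity and the
  triangle inequality.\<close>

lemma H1_seminorm_L2_set:
  "H1_seminorm \<Omega> v = L2_set (\<lambda>(k, j). L2_norm \<Omega> (weak_partial \<Omega> j (\<lambda>y. v y $ k))) UNIV"
  by (simp add: H1_seminorm_def L2_set_def sum.cartesian_product case_prod_unfold)

lemma H1_seminorm_nonneg [simp]: "H1_seminorm \<Omega> v \<ge> 0"
  by (simp add: H1_seminorm_L2_set)

lemma weak_partial_le_H1_seminorm: "L2_norm \<Omega> (weak_partial \<Omega> j (\<lambda>y. v y $ k)) \<le> H1_seminorm \<Omega> v"
  unfolding H1_seminorm_L2_set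
  using member_le_L2_set[of UNIV "(k, j)" "\<lambda>(k, j). L2_norm \<Omega> (weak_partial \<Omega> j (\<lambda>y. v y $ k))"] by simp

text \<open>Each of the \<open>CARD('n)\<close> diagonal derivatives is bounded by the full
  seminorm. The factor is not sharp, but it enters the final constant only.\<close>

lemma weak_div_inner_bound:
  fixes \<Omega> :: "(real^'n::finite) set"
  assumes "open \<Omega>" "v \<in> H10_vec \<Omega>" "q \<in> L2 \<Omega>"
  shows "\<bar>L2_inner \<Omega> (weak_div \<Omega> v) q\<bar> \<le> CARD('n) * (H1_seminorm \<Omega> v * L2_norm \<Omega> q)"
proof -
  have "L2_norm \<Omega> (weak_div \<Omega> v) \<le> (\<Sum>k\<in>UNIV. L2_norm \<Omega> (weak_partial \<Omega> k (\<lambda>y. v y $ k)))"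
    unfolding weak_div_def[abs_def] by (rule L2_norm_sum) (auto intro: H10_vecD[OF assms(1,2)])
  also have "\<dots> \<le> (\<Sum>k::'n\<in>UNIV. H1_seminorm \<Omega> v)" by (rule sum_mono) (rule weak_partial_le_H1_seminorm)
  finally have "L2_norm \<Omega> (weak_div \<Omega> v) \<le> CARD('n) * H1_seminorm \<Omega> v" by simp
  then have "L2_norm \<Omega> (weak_div \<Omega> v) * L2_norm \<Omega> q \<le> CARD('n) * H1_seminorm \<Omega> v * L2_norm \<Omega> q"
    by (rule mult_right_mono) simp
  with L2_Cauchy_Schwarz_abs[OF H10_vecD(3)[OF assms(1,2)] assms(3)] show ?thesis by (simp add: mult.assoc)
qed

section \<open>The quotient and its supremum over velocities\<close>

definition inf_sup_quotient :: "(real^'n::finite) set \<Rightarrow> (real^'n \<Rightarrow> real^'n) \<Rightarrow> (real^'n \<Rightarrow> real) \<Rightarrow> real" where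
  "inf_sup_quotient \<Omega> v q = L2_inner \<Omega> (weak_div \<Omega> v) q / (H1_seminorm \<Omega> v * L2_norm \<Omega> q)"

definition velocities :: "(real^'n::finite) set \<Rightarrow> (real^'n \<Rightarrow> real^'n) set" where
  "velocities \<Omega> = {v \<in> H10_vec \<Omega>. \<not> (AE x in lebesgue_on \<Omega>. v x = 0)}"

definition pressures :: "(real^'n::finite) set \<Rightarrow> (real^'n \<Rightarrow> real) set" where
  "pressures \<Omega> = {q \<in> L2_mean_zero \<Omega>. \<not> (AE x in lebesgue_on \<Omega>. q x = 0)}"

definition sup_quotient :: "(real^'n::finite) set \<Rightarrow> (real^'n \<Rightarrow> real) \<Rightarrow> real" where
  "sup_quotient \<Omega> q = (SUP v\<in>velocities \<Omega>. inf_sup_quotient \<Omega> v q)"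

lemma inf_sup_constant_eq: "inf_sup_constant \<Omega> = (INF q\<in>pressures \<Omega>. sup_quotient \<Omega> q)"
  by (simp add: inf_sup_constant_def pressures_def sup_quotient_def velocities_def inf_sup_quotient_def)

lemma pressures_L2: "q \<in> pressures \<Omega> \<Longrightarrow> q \<in> L2 \<Omega>"
  by (simp add: pressures_def L2_mean_zero_def)

lemma inf_sup_quotient_bound:
  fixes \<Omega> :: "(real^'n::finite) set"
  assumes "open \<Omega>" "v \<in> H10_vec \<Omega>" "q \<in> L2 \<Omega>"
  shows "\<bar>inf_sup_quotient \<Omega> v q\<bar> \<le> CARD('n)"
proof -
  let ?P = "H1_seminorm \<Omega> v * L2_norm \<Omega> q"
  have P: "?P \<ge> 0" by simp
  have "\<bar>inf_sup_quotient \<Omega> v q\<bar> = \<bar>L2_inner \<Omega> (weak_div \<Omega> v) q\<bar> / ?P"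
    using P by (simp add: inf_sup_quotient_def abs_mult)
  also have "\<dots> \<le> CARD('n)"
  proof (cases "?P = 0")
    case False
    with P have "?P > 0" by linarith
    then show ?thesis using weak_div_inner_bound[OF assms] by (simp add: pos_divide_le_eq)
  next
    \<comment> \<open>Division by zero yields 0, which respects the bound.\<close>
    case True
    show ?thesis unfolding True by simp
  qed
  finally show ?thesis .
qed

text \<open>Multiplying out is legitimate even when the denominator vanishes, because
  \<open>weak_div_inner_bound\<close> then forces the numerator to vanish as well.\<close>

lemma inner_le_of_quotient_le:
  fixes \<Omega> :: "(real^'n::finite) set"
  assumes "open \<Omega>" "v \<in> H10_vec \<Omega>" "q \<in> L2 \<Omega>" "inf_sup_quotient \<Omega> v q \<le> s"
  shows "L2_inner \<Omega> (weak_div \<Omega> v) q \<le> s * (H1_seminorm \<Omega> v * L2_norm \<Omega> q)"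
proof (cases "H1_seminorm \<Omega> v * L2_norm \<Omega> q = 0")
  case True
  show ?thesis using weak_div_inner_bound[OF assms(1-3)] unfolding True by simp
next
  case False
  moreover have "H1_seminorm \<Omega> v * L2_norm \<Omega> q \<ge> 0" by simp
  ultimately have "H1_seminorm \<Omega> v * L2_norm \<Omega> q > 0" by linarith
  then show ?thesis using assms(4) by (simp add: inf_sup_quotient_def pos_divide_le_eq)
qed

lemma sup_quotient_bdd:
  fixes \<Omega> :: "(real^'a::finite) set"
  assumes "open \<Omega>" "q \<in> L2 \<Omega>"
  shows "bdd_above ((\<lambda>v. inf_sup_quotient \<Omega> v q) ` velocities \<Omega>)"
  unfolding bdd_above_def
  by (rule exI[of _ "real CARD('a)"])
     (use inf_sup_quotient_bound[OF assms(1) _ assms(2)] in \<open>auto simp: velocities_def abs_le_iff\<close>)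

lemma inf_sup_quotient_le_sup:
  assumes "open \<Omega>" "q \<in> L2 \<Omega>" "v \<in> velocities \<Omega>"
  shows "inf_sup_quotient \<Omega> v q \<le> sup_quotient \<Omega> q"
  unfolding sup_quotient_def by (rule cSUP_upper[OF assms(3) sup_quotient_bdd[OF assms(1,2)]])

text \<open>A supremum of reals is meaningful only over a nonempty set. A translated mollifier in
  every component is a witness; its integral is 1, so it is not zero almost everywhere.\<close>

lemma velocities_nonempty:
  fixes \<Omega> :: "(real^'n::finite) set"
  assumes "open \<Omega>" "\<Omega> \<noteq> {}" shows "velocities \<Omega> \<noteq> {}"
proof -
  obtain y r where y: "r > 0" "cball y r \<subseteq> \<Omega>" using assms open_contains_cball by blast
  obtain \<rho> :: "real^'n \<Rightarrow> real" where \<rho>: "is_mollifier r \<rho>" using mollifier_exists y(1) by blast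
  define \<phi> where "\<phi> x = \<rho> (1 *\<^sub>R x + (- y))" for x
  have z: "\<phi> x = 0" if "x \<notin> cball y r" for x
    using is_mollifierD(3)[OF \<rho>, of "x - y"] that by (simp add: \<phi>_def dist_norm norm_minus_commute)
  have z0: "\<phi> x = 0" if "x \<notin> \<Omega>" for x using z y that by blast
  have t: "test_function \<Omega> \<phi>"
    by (rule test_functionI[OF _ z compact_cball y(2)])
       (use C_k_affine[OF is_mollifierD(1)[OF \<rho>], of _ 1 "- y"] in \<open>simp add: \<phi>_def\<close>)
  have "(\<lambda>x. (\<chi> k. \<phi> x) :: real^'n) \<in> H10_vec \<Omega>"
    using H10_grad_imp_H10[OF assms(1) H10_grad_test_function[OF assms(1) t]] by (simp add: H10_vec_def)
  moreover have "\<not> (AE x in lebesgue_on \<Omega>. (\<chi> k. \<phi> x) = (0 :: real^'n))"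
  proof
    assume "AE x in lebesgue_on \<Omega>. (\<chi> k. \<phi> x) = (0 :: real^'n)"
    then have "AE x in lebesgue_on \<Omega>. \<phi> x = 0"
      by (rule eventually_mono) (simp add: vec_eq_iff)
    then have "integral\<^sup>L (lebesgue_on \<Omega>) \<phi> = integral\<^sup>L (lebesgue_on \<Omega>) (\<lambda>x. 0)"
      using L2_D(1)[OF L2_test_function(1)[OF assms(1) t]] by (intro integral_cong_AE) auto
    moreover have "integral\<^sup>L (lebesgue_on \<Omega>) \<phi> = (\<integral>x. \<rho> (x - y) \<partial>lborel)"
      by (rule integral_lebesgue_on_lborel)
         (use assms(1) z0 test_function_C_k(6)[OF t] in \<open>simp_all add: \<phi>_def[abs_def]\<close>)
    ultimately show False using integral_mollifier(2)[OF \<rho>] by simp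
  qed
  ultimately show ?thesis by (auto simp: velocities_def)
qed

lemma partial_deriv_uminus:
  fixes f :: "real^'n::finite \<Rightarrow> real"
  assumes "f differentiable at x"
  shows "partial_deriv i (\<lambda>x. - f x) x = - partial_deriv i f x"
  using has_derivative_minus[OF partial_deriv_has_derivative[OF assms]]
  by (rule partial_deriv_eq[THEN trans]) (simp add: sum_axis_mult)

lemma H10_grad_uminus:
  fixes \<Omega> :: "(real^'n::finite) set"
  assumes "H10_grad \<Omega> u g"
  shows "H10_grad \<Omega> (\<lambda>x. - u x) (\<lambda>i x. - g i x)"
  unfolding H10_grad_def
proof (intro conjI allI impI)
  show "(\<lambda>x. - u x) \<in> L2 \<Omega>" "(\<lambda>x. - g i x) \<in> L2 \<Omega>" for i
    using assms L2_scale[of u \<Omega> "-1"] L2_scale[of "g i" \<Omega> "-1"] by (auto simp: H10_grad_def)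
  fix e :: real assume "e > 0"
  then obtain \<phi> where \<phi>: "test_function \<Omega> \<phi>" "L2_norm \<Omega> (\<lambda>x. u x - \<phi> x) < e"
    "\<And>i. L2_norm \<Omega> (\<lambda>x. g i x - partial_deriv i \<phi> x) < e"
    using assms unfolding H10_grad_def by blast
  have neg: "L2_norm \<Omega> (\<lambda>x. b x - a x) = L2_norm \<Omega> (\<lambda>x. a x - b x)" for a b
    by (simp add: L2_norm_def L2_inner_def algebra_simps)
  obtain K r where K: "compact K" "K \<subseteq> \<Omega>" "\<And>x. x \<notin> K \<Longrightarrow> \<phi> x = 0" by (rule test_functionE[OF \<phi>(1)]) blast
  have "test_function \<Omega> (\<lambda>x. - \<phi> x)"
    by (rule test_functionI[OF _ _ K(1,2)])
       (use C_k_mult[OF C_k_const[of _ "-1"] test_function_C_k(1)[OF \<phi>(1)]] K(3) in simp_all)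
  then show "\<exists>\<psi>. test_function \<Omega> \<psi> \<and> L2_norm \<Omega> (\<lambda>x. - u x - \<psi> x) < e \<and>
       (\<forall>i. L2_norm \<Omega> (\<lambda>x. - g i x - partial_deriv i \<psi> x) < e)"
    using \<phi>(2,3) by (intro exI[of _ "\<lambda>x. - \<phi> x"])
      (simp add: partial_deriv_uminus[OF test_function_C_k(5)[OF \<phi>(1)]]
        neg[of \<phi> u] neg[of "partial_deriv i \<phi>" "g i" for i])
qed

lemma H10_grad_weak_partial:
  fixes \<Omega> :: "(real^'n::finite) set"
  assumes "open \<Omega>" "H10_grad \<Omega> u g"
  shows "AE x in lebesgue_on \<Omega>. weak_partial \<Omega> i u x = g i x"
    "weak_partial \<Omega> i u \<in> borel_measurable (lebesgue_on \<Omega>)" "weak_partial \<Omega> i u \<in> L2 \<Omega>"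
    "L2_norm \<Omega> (weak_partial \<Omega> i u) = L2_norm \<Omega> (g i)"
proof -
  note w = H10_grad_has_weak_partial[OF assms]
  have g: "g i \<in> L2 \<Omega>" using assms(2) by (simp add: H10_grad_def)
  show 1: "AE x in lebesgue_on \<Omega>. weak_partial \<Omega> i u x = g i x"
    "weak_partial \<Omega> i u \<in> borel_measurable (lebesgue_on \<Omega>)"
    using weak_partial_AE_eq[OF assms(1) w] by auto
  then have 2: "AE x in lebesgue_on \<Omega>. g i x = weak_partial \<Omega> i u x" by (auto elim: eventually_mono)
  show "weak_partial \<Omega> i u \<in> L2 \<Omega>" by (rule L2_cong_AE[OF g 2 1(2)])
  show "L2_norm \<Omega> (weak_partial \<Omega> i u) = L2_norm \<Omega> (g i)" by (rule L2_norm_cong_AE[OF 1(2) L2_D(1)[OF g] 1(1)])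
qed

lemma weak_div_AE:
  fixes \<Omega> :: "(real^'n::finite) set"
  assumes "open \<Omega>" "\<And>k. H10_grad \<Omega> (\<lambda>x. v x $ k) (g k)"
  shows "AE x in lebesgue_on \<Omega>. weak_div \<Omega> v x = (\<Sum>k\<in>UNIV. g k k x)"
proof -
  have "AE x in lebesgue_on \<Omega>. \<forall>k\<in>UNIV. weak_partial \<Omega> k (\<lambda>y. v y $ k) x = g k k x"
    by (rule AE_finite_allI) (auto intro: H10_grad_weak_partial(1)[OF assms])
  then show ?thesis by (rule eventually_mono) (simp add: weak_div_def)
qed

lemma L2_inner_cong_AE:
  assumes "u \<in> borel_measurable (lebesgue_on \<Omega>)" "u' \<in> borel_measurable (lebesgue_on \<Omega>)"
    "AE x in lebesgue_on \<Omega>. u x = u' x" "w \<in> borel_measurable (lebesgue_on \<Omega>)"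
  shows "L2_inner \<Omega> u w = L2_inner \<Omega> u' w"
  unfolding L2_inner_def using assms by (intro integral_cong_AE) auto

text \<open>
  The quotient changes its sign when \<open>v\<close> is replaced by \<open>-v\<close>.
\<close>

lemma sup_quotient_nonneg:
  fixes \<Omega> :: "(real^'n::finite) set"
  assumes "open \<Omega>" "\<Omega> \<noteq> {}" "q \<in> L2 \<Omega>"
  shows "sup_quotient \<Omega> q \<ge> 0"
proof -
  obtain v where v: "v \<in> velocities \<Omega>" using velocities_nonempty[OF assms(1,2)] by blast
  then have vH: "v \<in> H10_vec \<Omega>" by (simp add: velocities_def)
  define w where "w x = - v x" for x
  have g: "H10_grad \<Omega> (\<lambda>x. w x $ k) (\<lambda>j x. - weak_partial \<Omega> j (\<lambda>y. v y $ k) x)" for k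
    unfolding w_def using H10_grad_uminus[OF H10_vecD(1)[OF assms(1) vH, of k]] by simp
  have wH: "w \<in> H10_vec \<Omega>" using H10_grad_imp_H10[OF assms(1) g] by (simp add: H10_vec_def)
  have wV: "w \<in> velocities \<Omega>" using v wH by (simp add: velocities_def w_def)
  have "L2_norm \<Omega> (weak_partial \<Omega> j (\<lambda>y. w y $ k)) = L2_norm \<Omega> (weak_partial \<Omega> j (\<lambda>y. v y $ k))" for j k
    unfolding H10_grad_weak_partial(4)[OF assms(1) g] by (simp add: L2_norm_def L2_inner_def)
  then have s: "H1_seminorm \<Omega> w = H1_seminorm \<Omega> v" by (simp add: H1_seminorm_def)
  have "AE x in lebesgue_on \<Omega>. weak_div \<Omega> w x = - weak_div \<Omega> v x"
    using weak_div_AE[OF assms(1) g] by (rule eventually_mono) (simp add: weak_div_def sum_negf)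
  then have "L2_inner \<Omega> (weak_div \<Omega> w) q = L2_inner \<Omega> (\<lambda>x. - weak_div \<Omega> v x) q"
    using H10_vecD(3)[OF assms(1) vH] H10_vecD(3)[OF assms(1) wH] assms(3)
    by (intro L2_inner_cong_AE) (auto dest: L2_D(1))
  then have "inf_sup_quotient \<Omega> w q = - inf_sup_quotient \<Omega> v q"
    by (simp add: inf_sup_quotient_def s L2_inner_def)
  with inf_sup_quotient_le_sup[OF assms(1,3) v] inf_sup_quotient_le_sup[OF assms(1,3) wV] show ?thesis by linarith
qed

section \<open>Transport of velocities and pressures\<close>

context near_identity_pair
begin

text \<open>The image measure under \<open>G\<close> has a density, so null sets of \<open>U\<close>
  are null for it and their preimages are null in \<open>V\<close>.\<close>

lemma AE_transport:
  assumes "AE x in lebesgue_on U. P x" shows "AE y in lebesgue_on V. P (G y)"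
proof -
  have "AE x in distr (lebesgue_on V) (lebesgue_on U) G. P x"
    unfolding J(4) using assms J(1) by (subst AE_density) (auto elim: eventually_mono)
  then show ?thesis by (rule AE_distrD[OF fw.G_measurable])
qed

text \<open>\<open>\<alpha>\<close> is the norm on \<open>U\<close> of the gradient of
  \<open>v\<close> evaluated at \<open>F x\<close>, before the chain rule multiplies it by
  \<open>D x\<close>. All entries of \<open>D x\<close> differ from the identity by at most
  \<open>\<epsilon>\<close>, so both the gradient and the divergence of \<open>v \<circ> F\<close>
  deviate from the transported ones by a multiple of \<open>\<epsilon> * \<alpha>\<close>.\<close>

lemma H10_vec_comp:
  assumes v: "v \<in> H10_vec V"
  defines "a \<equiv> \<lambda>k l x. weak_partial V l (\<lambda>y. v y $ k) (F x)"
  defines "\<alpha> \<equiv> L2_set (\<lambda>(k, l). L2_norm U (a k l)) UNIV"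
  shows "(\<lambda>x. v (F x)) \<in> H10_vec U"
    "H1_seminorm U (\<lambda>x. v (F x)) \<le> (1 + \<epsilon> * (real CARD('n))\<^sup>2) * \<alpha>"
    "\<alpha> \<le> distortion * H1_seminorm V v"
    "q \<in> L2 U \<Longrightarrow> \<bar>L2_inner U (weak_div U (\<lambda>x. v (F x))) q - L2_inner U (\<lambda>x. weak_div V v (F x)) q\<bar>
       \<le> \<epsilon> * (real CARD('n))\<^sup>2 * \<alpha> * L2_norm U q"
proof -
  let ?n = "real CARD('n)"
  let ?E = "\<lambda>x l j. D x $ l $ j - (if l = j then 1 else 0)"
  let ?P = "\<lambda>k j x. \<Sum>l\<in>UNIV. a k l x * D x $ l $ j"
  have g: "H10_grad U (\<lambda>x. v (F x) $ k) (?P k)" for k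
    using H10_grad_comp[OF H10_vecD(1)[OF fw.open_V v, of k]] by (simp add: a_def)
  show vF: "(\<lambda>x. v (F x)) \<in> H10_vec U"
    using H10_grad_imp_H10[OF fw.open_U g] by (simp add: H10_vec_def)
  have aL: "a k l \<in> L2 U" for k l
    unfolding a_def by (rule L2_comp(1)[OF H10_vecD(2)[OF fw.open_V v]])
  have aN: "L2_norm U (a k l) \<le> distortion * L2_norm V (weak_partial V l (\<lambda>y. v y $ k))" for k l
    unfolding a_def by (rule L2_norm_comp[OF H10_vecD(2)[OF fw.open_V v]])
  have d0: "distortion \<ge> 0" using distortion_ge_1 by simp
  have "\<alpha> \<le> L2_set (\<lambda>(k, l). distortion * L2_norm V (weak_partial V l (\<lambda>y. v y $ k))) UNIV"
    unfolding \<alpha>_def by (rule L2_set_mono) (use aN in auto)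
  also have "\<dots> = distortion * H1_seminorm V v"
    unfolding H1_seminorm_L2_set using d0 by (subst L2_set_right_distrib) (simp_all add: case_prod_unfold)
  finally show "\<alpha> \<le> distortion * H1_seminorm V v" .
  have a\<alpha>: "L2_norm U (a k l) \<le> \<alpha>" for k l
    unfolding \<alpha>_def using member_le_L2_set[of UNIV "(k, l)" "\<lambda>(k, l). L2_norm U (a k l)"] by simp
  have \<alpha>0: "\<alpha> \<ge> 0" by (simp add: \<alpha>_def)
  have Em: "(\<lambda>x. ?E x l j) \<in> borel_measurable (lebesgue_on U)" for l j
    using fw.D_measurable[of l j] by (intro borel_measurable_diff) auto
  have Eb: "\<bar>?E x l j\<bar> \<le> \<epsilon>" for x l j
    using order_trans[OF matrix_component_le_onorm[of "D x - mat 1" l j] fw.D_close[of x]] by (simp add: mat_def)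
  have EN: "L2_norm U (\<lambda>x. a k l x * ?E x l j) \<le> \<epsilon> * \<alpha>" "(\<lambda>x. a k l x * ?E x l j) \<in> L2 U" for k l j
  proof -
    have "L2_norm U (\<lambda>x. a k l x * ?E x l j) \<le> \<epsilon> * L2_norm U (a k l)"
      by (rule L2_norm_bounded_mult[OF aL Em Eb fw.eps_nonneg])
    also have "\<dots> \<le> \<epsilon> * \<alpha>" by (rule mult_left_mono[OF a\<alpha> fw.eps_nonneg])
    finally show "L2_norm U (\<lambda>x. a k l x * ?E x l j) \<le> \<epsilon> * \<alpha>" .
    show "(\<lambda>x. a k l x * ?E x l j) \<in> L2 U" by (rule L2_bounded_mult[OF aL Em Eb])
  qed
  \<comment> \<open>Splitting \<open>D x\<close> into the identity and the remainder
    \<open>?E\<close> isolates the transported gradient \<open>a\<close> from the part of size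
    \<open>\<epsilon>\<close>.\<close>
  have Pdec: "?P k j x = a k j x + (\<Sum>l\<in>UNIV. a k l x * ?E x l j)" for k j x
    by (simp add: right_diff_distrib sum_subtractf if_distrib[of "\<lambda>b. _ * b"] cong: if_cong)
  have SN: "L2_norm U (\<lambda>x. \<Sum>l\<in>UNIV. a k l x * ?E x l j) \<le> ?n * (\<epsilon> * \<alpha>)" for k j
  proof -
    have "L2_norm U (\<lambda>x. \<Sum>l\<in>UNIV. a k l x * ?E x l j) \<le> (\<Sum>l\<in>UNIV. L2_norm U (\<lambda>x. a k l x * ?E x l j))"
      by (rule L2_norm_sum[OF finite EN(2)])
    also have "\<dots> \<le> (\<Sum>l::'n\<in>UNIV. \<epsilon> * \<alpha>)" by (rule sum_mono) (rule EN)
    finally show ?thesis by simp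
  qed
  have PN: "L2_norm U (weak_partial U j (\<lambda>y. v (F y) $ k)) \<le> L2_norm U (a k j) + ?n * (\<epsilon> * \<alpha>)" for k j
  proof -
    have "L2_norm U (weak_partial U j (\<lambda>y. v (F y) $ k)) = L2_norm U (?P k j)"
      by (rule H10_grad_weak_partial(4)[OF fw.open_U g])
    also have "\<dots> \<le> L2_norm U (a k j) + L2_norm U (\<lambda>x. \<Sum>l\<in>UNIV. a k l x * ?E x l j)"
      unfolding Pdec by (intro L2_norm_triangle aL L2_sum EN)
    finally show ?thesis using SN[of k j] by linarith
  qed
  have "H1_seminorm U (\<lambda>x. v (F x)) \<le> L2_set (\<lambda>p. (\<lambda>(k, l). L2_norm U (a k l)) p + ?n * (\<epsilon> * \<alpha>)) (UNIV :: ('n \<times> 'n) set)"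
    unfolding H1_seminorm_L2_set by (rule L2_set_mono) (use PN in auto)
  also have "\<dots> \<le> \<alpha> + L2_set (\<lambda>p. ?n * (\<epsilon> * \<alpha>)) (UNIV :: ('n \<times> 'n) set)"
    unfolding \<alpha>_def by (rule L2_set_triangle_ineq)
  \<comment> \<open>Each entry already carries a sum over \<open>?n\<close> terms; the Euclidean
    norm of \<open>?n * ?n\<close> equal entries contributes the second factor
    \<open>?n\<close>.\<close>
  also have "L2_set (\<lambda>p. ?n * (\<epsilon> * \<alpha>)) (UNIV :: ('n \<times> 'n) set) = ?n * (?n * (\<epsilon> * \<alpha>))"
    using \<alpha>0 fw.eps_nonneg by (simp add: L2_set_def real_sqrt_mult flip: UNIV_Times_UNIV)
  finally show "H1_seminorm U (\<lambda>x. v (F x)) \<le> (1 + \<epsilon> * ?n\<^sup>2) * \<alpha>"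
    by (simp add: power2_eq_square algebra_simps)
  show "\<bar>L2_inner U (weak_div U (\<lambda>x. v (F x))) q - L2_inner U (\<lambda>x. weak_div V v (F x)) q\<bar>
       \<le> \<epsilon> * ?n\<^sup>2 * \<alpha> * L2_norm U q" if q: "q \<in> L2 U"
  proof -
    let ?S = "\<lambda>x. \<Sum>k\<in>UNIV. \<Sum>l\<in>UNIV. a k l x * ?E x l k"
    have SL: "?S \<in> L2 U" by (intro L2_sum EN)
    have divF: "(\<lambda>x. weak_div V v (F x)) \<in> L2 U" by (rule L2_comp(1)[OF H10_vecD(3)[OF fw.open_V v]])
    have divU: "weak_div U (\<lambda>x. v (F x)) \<in> L2 U" by (rule H10_vecD(3)[OF fw.open_U vF])
    have "AE x in lebesgue_on U. weak_div U (\<lambda>x. v (F x)) x - weak_div V v (F x) = ?S x"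
      using weak_div_AE[OF fw.open_U g]
    proof (rule eventually_mono)
      fix x assume "weak_div U (\<lambda>x. v (F x)) x = (\<Sum>k\<in>UNIV. ?P k k x)"
      then show "weak_div U (\<lambda>x. v (F x)) x - weak_div V v (F x) = ?S x"
        unfolding Pdec by (simp add: sum.distrib weak_div_def a_def)
    qed
    then have "L2_inner U (\<lambda>x. weak_div U (\<lambda>x. v (F x)) x - weak_div V v (F x)) q = L2_inner U ?S q"
      by (intro L2_inner_cong_AE L2_D(1) L2_diff divU divF SL q)
    then have "\<bar>L2_inner U (weak_div U (\<lambda>x. v (F x))) q - L2_inner U (\<lambda>x. weak_div V v (F x)) q\<bar> = \<bar>L2_inner U ?S q\<bar>"
      by (simp add: L2_inner_diff_left[OF divU divF q])
    also have "\<dots> \<le> L2_norm U ?S * L2_norm U q" by (rule L2_Cauchy_Schwarz_abs[OF SL q])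
    also have "\<dots> \<le> (\<epsilon> * ?n\<^sup>2 * \<alpha>) * L2_norm U q"
    proof (rule mult_right_mono)
      have "L2_norm U ?S \<le> (\<Sum>k\<in>UNIV. L2_norm U (\<lambda>x. \<Sum>l\<in>UNIV. a k l x * ?E x l k))"
        by (rule L2_norm_sum[OF finite L2_sum[OF EN(2)]])
      also have "\<dots> \<le> (\<Sum>k::'n\<in>UNIV. ?n * (\<epsilon> * \<alpha>))" by (rule sum_mono) (rule SN)
      finally show "L2_norm U ?S \<le> \<epsilon> * ?n\<^sup>2 * \<alpha>" by (simp add: power2_eq_square algebra_simps)
    qed simp
    finally show ?thesis .
  qed
qed

lemma velocities_comp:
  assumes "v \<in> velocities V" shows "(\<lambda>x. v (F x)) \<in> velocities U"
proof -
  have "\<not> (AE x in lebesgue_on U. v (F x) = 0)"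
  proof
    assume "AE x in lebesgue_on U. v (F x) = 0"
    from AE_transport[OF this] have "AE y in lebesgue_on V. v (F (G y)) = 0" .
    then have "AE y in lebesgue_on V. v y = 0"
    proof (rule AE_mp, intro AE_I2 impI)
      fix y assume "y \<in> space (lebesgue_on V)" "v (F (G y)) = 0"
      then show "v y = 0" using fw.F_G[of y] by simp
    qed
    then show False using assms by (simp add: velocities_def)
  qed
  then show ?thesis using assms H10_vec_comp(1) by (simp add: velocities_def)
qed

text \<open>This is the density of the image under \<open>F\<close> of the signed measure with
  density \<open>q\<close>. Pairings with any function, in particular the mean value, are therefore
  carried over without error.\<close>

definition transported_pressure :: "(real^'n \<Rightarrow> real) \<Rightarrow> real^'n \<Rightarrow> real" where
  "transported_pressure q y = q (G y) / J (G y)"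

lemma transported_pressure_F:
  "x \<in> U \<Longrightarrow> J x * transported_pressure q (F x) = q x"
  "x \<in> U \<Longrightarrow> J x * (transported_pressure q (F x))\<^sup>2 = (q x)\<^sup>2 / J x"
  using J_pos[of x] by (simp_all add: transported_pressure_def fw.G_F power2_eq_square)

text \<open>The norm of \<open>q\<close> is bounded by that of the transported pressure, and not
  conversely, because the latter stands in the denominator of the quotient to be estimated on
  \<open>V\<close>.\<close>

lemma transported_pressure:
  assumes q: "q \<in> pressures U"
  shows "transported_pressure q \<in> pressures V"
    "L2_norm U q \<le> distortion * L2_norm V (transported_pressure q)"
    "f \<in> L2 V \<Longrightarrow> L2_inner V f (transported_pressure q) = L2_inner U (\<lambda>x. f (F x)) q"
proof -
  let ?p = "transported_pressure q"
  have qL: "q \<in> L2 U" by (rule pressures_L2[OF q])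
  have d: "distortion > 0" using distortion_ge_1 by linarith
  have "(\<lambda>x. q x / J x) \<in> borel_measurable (lebesgue_on U)" using L2_D(1)[OF qL] J(1) by simp
  from measurable_compose[OF fw.G_measurable this]
  have pm: "?p \<in> borel_measurable (lebesgue_on V)" unfolding transported_pressure_def[abs_def] .
  have p2m: "(\<lambda>x. (?p x)\<^sup>2) \<in> borel_measurable (lebesgue_on V)" using pm by simp
  have cong2: "integrable (lebesgue_on U) (\<lambda>x. J x * (?p (F x))\<^sup>2) \<longleftrightarrow> integrable (lebesgue_on U) (\<lambda>x. (q x)\<^sup>2 / J x)"
    "integral\<^sup>L (lebesgue_on U) (\<lambda>x. J x * (?p (F x))\<^sup>2) = integral\<^sup>L (lebesgue_on U) (\<lambda>x. (q x)\<^sup>2 / J x)"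
    by (auto intro!: Bochner_Integration.integrable_cong Bochner_Integration.integral_cong simp: transported_pressure_F)
  have Jb: "(q x)\<^sup>2 / J x \<le> distortion * (q x)\<^sup>2" "(q x)\<^sup>2 \<le> distortion * ((q x)\<^sup>2 / J x)" for x
  proof -
    have "1 / J x \<le> distortion" using J(2)[of x] J_pos[of x] d by (simp add: field_simps)
    from mult_right_mono[OF this, of "(q x)\<^sup>2"] show "(q x)\<^sup>2 / J x \<le> distortion * (q x)\<^sup>2" by simp
    have "1 \<le> distortion / J x" using J(3)[of x] J_pos[of x] by (simp add: field_simps)
    from mult_right_mono[OF this, of "(q x)\<^sup>2"] show "(q x)\<^sup>2 \<le> distortion * ((q x)\<^sup>2 / J x)" by simp
  qed
  have i: "integrable (lebesgue_on U) (\<lambda>x. (q x)\<^sup>2 / J x)"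
  proof (rule Bochner_Integration.integrable_bound)
    show "integrable (lebesgue_on U) (\<lambda>x. distortion * (q x)\<^sup>2)" using L2_D(2)[OF qL] by simp
    show "(\<lambda>x. (q x)\<^sup>2 / J x) \<in> borel_measurable (lebesgue_on U)" using L2_D(1)[OF qL] J(1) by simp
    show "AE x in lebesgue_on U. norm ((q x)\<^sup>2 / J x) \<le> norm (distortion * (q x)\<^sup>2)"
      using Jb(1) J_pos d by (intro AE_I2) (simp add: less_imp_le)
  qed
  have pL: "?p \<in> L2 V"
    using pm change_of_variables(1)[OF p2m] i cong2(1) by (simp add: L2_def)
  have n2: "(L2_norm U q)\<^sup>2 \<le> distortion * (L2_norm V ?p)\<^sup>2"
  proof -
    have "(L2_norm U q)\<^sup>2 \<le> integral\<^sup>L (lebesgue_on U) (\<lambda>x. distortion * ((q x)\<^sup>2 / J x))"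
      unfolding L2_norm_square by (rule integral_mono[OF L2_D(2)[OF qL] integrable_mult_right[OF i] Jb(2)])
    also have "\<dots> = distortion * integral\<^sup>L (lebesgue_on U) (\<lambda>x. (q x)\<^sup>2 / J x)"
      by (rule integral_mult_right_zero)
    finally show ?thesis using change_of_variables(2)[OF p2m] cong2(2) by (simp only: L2_norm_square)
  qed
  show "L2_norm U q \<le> distortion * L2_norm V ?p"
  proof (rule power2_le_imp_le)
    have "distortion * (L2_norm V ?p)\<^sup>2 \<le> distortion\<^sup>2 * (L2_norm V ?p)\<^sup>2"
      using distortion_ge_1 by (intro mult_right_mono) (auto simp: power2_eq_square)
    with n2 show "(L2_norm U q)\<^sup>2 \<le> (distortion * L2_norm V ?p)\<^sup>2" by (simp add: power_mult_distrib)
  qed (use d in simp)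
  have "integral\<^sup>L (lebesgue_on V) ?p = integral\<^sup>L (lebesgue_on U) q"
    unfolding change_of_variables(2)[OF pm]
    by (rule Bochner_Integration.integral_cong) (auto simp: transported_pressure_F)
  then have mean: "integral\<^sup>L (lebesgue_on V) ?p = 0" using q by (simp add: pressures_def L2_mean_zero_def)
  have "\<not> (AE y in lebesgue_on V. ?p y = 0)"
  proof
    assume "AE y in lebesgue_on V. ?p y = 0"
    then have "L2_norm V ?p = 0" using L2_norm_eq_0_iff[OF pL] by simp
    then have "L2_norm U q = 0" using n2 by simp
    then show False using L2_norm_eq_0_iff[OF qL] q by (simp add: pressures_def)
  qed
  with pL mean show "?p \<in> pressures V" by (simp add: pressures_def L2_mean_zero_def)
  show "L2_inner V f ?p = L2_inner U (\<lambda>x. f (F x)) q" if f: "f \<in> L2 V"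
  proof -
    have m: "(\<lambda>x. f x * ?p x) \<in> borel_measurable (lebesgue_on V)" using L2_D(1)[OF f] pm by simp
    show ?thesis unfolding L2_inner_def change_of_variables(2)[OF m]
    proof (rule Bochner_Integration.integral_cong[OF refl])
      fix x assume "x \<in> space (lebesgue_on U)"
      then show "J x * (f (F x) * ?p (F x)) = f (F x) * q x"
        using transported_pressure_F(1)[of x q] by (simp add: mult.left_commute)
    qed
  qed
qed

text \<open>The first summand is the supremum on \<open>U\<close>, enlarged since the seminorm of
  \<open>v \<circ> F\<close> may exceed \<open>\<alpha>\<close>; the second is the error in the
  divergence. One factor \<open>distortion\<close> comes from the velocity, the other from the
  pressure.\<close>

definition comparison_bound :: "real \<Rightarrow> real" where
  "comparison_bound s = (s * (1 + \<epsilon> * (real CARD('n))\<^sup>2) + \<epsilon> * (real CARD('n))\<^sup>2) * distortion\<^sup>2"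

lemma quotient_transported_pressure_le:
  assumes q: "q \<in> pressures U" and v: "v \<in> velocities V" and "U \<noteq> {}"
  shows "inf_sup_quotient V v (transported_pressure q) \<le> comparison_bound (sup_quotient U q)"
proof -
  let ?p = "transported_pressure q" let ?n = "real CARD('n)"
  define s where "s = sup_quotient U q"
  define \<alpha> where "\<alpha> = L2_set (\<lambda>(k, l). L2_norm U (\<lambda>x. weak_partial V l (\<lambda>y. v y $ k) (F x))) UNIV"
  have vH: "v \<in> H10_vec V" using v by (simp add: velocities_def)
  have qL: "q \<in> L2 U" by (rule pressures_L2[OF q])
  note H = H10_vec_comp[OF vH, folded \<alpha>_def]
  have s0: "s \<ge> 0" unfolding s_def by (rule sup_quotient_nonneg[OF fw.open_U \<open>U \<noteq> {}\<close> qL])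
  have \<alpha>0: "\<alpha> \<ge> 0" by (simp add: \<alpha>_def)
  define T where "T = s * (1 + \<epsilon> * ?n\<^sup>2) + \<epsilon> * ?n\<^sup>2"
  have T0: "T \<ge> 0" using s0 fw.eps_nonneg by (simp add: T_def)
  have "inf_sup_quotient U (\<lambda>x. v (F x)) q \<le> s"
    unfolding s_def by (rule inf_sup_quotient_le_sup[OF fw.open_U qL velocities_comp[OF v]])
  then have "L2_inner U (weak_div U (\<lambda>x. v (F x))) q \<le> s * (H1_seminorm U (\<lambda>x. v (F x)) * L2_norm U q)"
    by (rule inner_le_of_quotient_le[OF fw.open_U H(1) qL])
  \<comment> \<open>Enlarging the seminorm preserves the bound because \<open>s\<close>, as a
    supremum that is symmetric under a change of sign, is nonnegative.\<close>
  also have "\<dots> \<le> s * ((1 + \<epsilon> * ?n\<^sup>2) * \<alpha> * L2_norm U q)"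
    by (intro mult_left_mono mult_right_mono H(2) s0) simp
  finally have "L2_inner U (\<lambda>x. weak_div V v (F x)) q \<le> s * ((1 + \<epsilon> * ?n\<^sup>2) * \<alpha> * L2_norm U q) + \<epsilon> * ?n\<^sup>2 * \<alpha> * L2_norm U q"
    using H(4)[OF qL] by linarith
  also have "\<dots> = T * (\<alpha> * L2_norm U q)" by (simp add: T_def algebra_simps)
  also have "\<dots> \<le> T * ((distortion * H1_seminorm V v) * (distortion * L2_norm V ?p))"
    using distortion_ge_1 by (intro mult_left_mono mult_mono H(3) transported_pressure(2)[OF q] T0) auto
  also have "\<dots> = comparison_bound s * (H1_seminorm V v * L2_norm V ?p)"
    by (simp add: comparison_bound_def T_def power2_eq_square algebra_simps)
  finally have le: "L2_inner V (weak_div V v) ?p \<le> comparison_bound s * (H1_seminorm V v * L2_norm V ?p)"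
    using transported_pressure(3)[OF q H10_vecD(3)[OF fw.open_V vH]] by simp
  have c0: "comparison_bound s \<ge> 0" using T0 by (simp add: comparison_bound_def T_def)
  show ?thesis unfolding s_def[symmetric]
  proof (cases "H1_seminorm V v * L2_norm V ?p = 0")
    case True
    then show "inf_sup_quotient V v ?p \<le> comparison_bound s" using c0 by (auto simp: inf_sup_quotient_def)
  next
    case False
    moreover have "H1_seminorm V v * L2_norm V ?p \<ge> 0" by simp
    ultimately have "H1_seminorm V v * L2_norm V ?p > 0" by linarith
    then show "inf_sup_quotient V v ?p \<le> comparison_bound s"
      using le by (simp add: inf_sup_quotient_def pos_divide_le_eq)
  qed
qed

end

section \<open>The constant and the comparison of the infima\<close>

text \<open>The right side is the chord of the convex function \<open>(1 + x) ^ m\<close> over the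
  unit interval; in the induction this amounts to \<open>x * x \<le> x\<close>.\<close>

lemma power_one_plus_le:
  assumes "0 \<le> x" "x \<le> (1::real)"
  shows "(1 + x) ^ m \<le> 1 + (2 ^ m - 1) * x"
proof (induction m)
  case (Suc m)
  have p: "(2::real) ^ m - 1 \<ge> 0" by simp
  have "(1 + x) ^ Suc m \<le> (1 + x) * (1 + (2 ^ m - 1) * x)"
    using Suc assms by (simp add: mult_left_mono)
  also have "\<dots> = 1 + 2 ^ m * x + (2 ^ m - 1) * (x * x)" by (simp add: algebra_simps)
  also have "\<dots> \<le> 1 + 2 ^ m * x + (2 ^ m - 1) * x"
    using mult_left_mono[OF mult_right_le_one_le[OF assms(1) assms] p] by simp
  also have "\<dots> = 1 + (2 ^ Suc m - 1) * x" by (simp add: algebra_simps)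
  finally show ?case .
qed simp

text \<open>The first \<open>n\<close> bounds the supremum \<open>s\<close>, which is multiplied by
  the excess of \<open>distortion\<^sup>2\<close> over 1; \<open>n\<^sup>2 * (n + 1)\<close> bounds
  the coefficient \<open>n\<^sup>2 * (s + 1)\<close> of \<open>\<epsilon>\<close>; and
  \<open>4 ^ n\<close> is \<open>distortion\<^sup>2\<close> at
  \<open>\<epsilon> = 1\<close>.\<close>

definition comparison_const :: "nat \<Rightarrow> real" where
  "comparison_const n = (real n + (real n)\<^sup>2 * (real n + 1)) * 4 ^ n"

text \<open>For \<open>\<epsilon> > 1\<close> this puts the claimed error above the a priori bound
  \<open>n\<close> of every quotient.\<close>

lemma comparison_const_ge: "real n \<le> comparison_const n"
proof -
  have "real n * 1 \<le> (real n + (real n)\<^sup>2 * (real n + 1)) * 4 ^ n" by (rule mult_mono) auto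
  then show ?thesis by (simp add: comparison_const_def)
qed

context near_identity_pair
begin

lemma comparison_bound_le:
  assumes s: "0 \<le> s" "s \<le> real CARD('n)" and "\<epsilon> \<le> 1"
  shows "comparison_bound s \<le> s + comparison_const CARD('n) * \<epsilon>"
proof -
  let ?n = "real CARD('n)" let ?N = "4 ^ CARD('n) :: real"
  have e: "0 \<le> \<epsilon>" by (rule fw.eps_nonneg)
  have c: "distortion\<^sup>2 = (1 + \<epsilon>) ^ (2 * CARD('n))" by (simp add: distortion_def power_mult[symmetric] mult.commute)
  have N: "(2::real) ^ (2 * CARD('n)) = ?N" by (simp add: power_mult)
  have c1: "distortion\<^sup>2 \<le> 1 + (?N - 1) * \<epsilon>"
    using power_one_plus_le[OF e \<open>\<epsilon> \<le> 1\<close>, of "2 * CARD('n)"] by (simp add: c N)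
  have c2: "distortion\<^sup>2 \<le> ?N"
    using power_mono[of "1 + \<epsilon>" 2 "2 * CARD('n)"] e \<open>\<epsilon> \<le> 1\<close> by (simp add: c N)
  have "comparison_bound s = s * distortion\<^sup>2 + \<epsilon> * (?n\<^sup>2 * (s + 1)) * distortion\<^sup>2"
    by (simp add: comparison_bound_def algebra_simps)
  also have "\<dots> \<le> s * (1 + ?N * \<epsilon>) + \<epsilon> * (?n\<^sup>2 * (?n + 1)) * ?N"
  proof (intro add_mono mult_mono mult_left_mono)
    show "distortion\<^sup>2 \<le> 1 + ?N * \<epsilon>" using c1 e by (simp add: algebra_simps)
  qed (use s e c2 in auto)
  also have "s * (1 + ?N * \<epsilon>) \<le> s + ?n * (?N * \<epsilon>)"
    using mult_right_mono[OF s(2), of "?N * \<epsilon>"] e by (simp add: algebra_simps)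
  finally show ?thesis by (simp add: comparison_const_def algebra_simps)
qed

lemma sup_quotient_transported_pressure_le:
  assumes q: "q \<in> pressures U" and "U \<noteq> {}"
  shows "sup_quotient V (transported_pressure q) \<le> sup_quotient U q + comparison_const CARD('n) * \<epsilon>"
proof -
  have ne: "V \<noteq> {}" using \<open>U \<noteq> {}\<close> fw.F_in by blast
  have qL: "q \<in> L2 U" by (rule pressures_L2[OF q])
  have pL: "transported_pressure q \<in> L2 V" by (rule pressures_L2[OF transported_pressure(1)[OF q]])
  have s0: "sup_quotient U q \<ge> 0" by (rule sup_quotient_nonneg[OF fw.open_U \<open>U \<noteq> {}\<close> qL])
  have s1: "sup_quotient U q \<le> real CARD('n)"
    unfolding sup_quotient_def
    by (rule cSUP_least[OF velocities_nonempty[OF fw.open_U \<open>U \<noteq> {}\<close>]])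
       (use inf_sup_quotient_bound[OF fw.open_U _ qL] in \<open>auto simp: velocities_def abs_le_iff\<close>)
  have "inf_sup_quotient V v (transported_pressure q) \<le> sup_quotient U q + comparison_const CARD('n) * \<epsilon>"
    if v: "v \<in> velocities V" for v
  proof (cases "\<epsilon> \<le> 1")
    case True
    then show ?thesis
      using quotient_transported_pressure_le[OF q v \<open>U \<noteq> {}\<close>] comparison_bound_le[OF s0 s1] by linarith
  next
    case False
    have "inf_sup_quotient V v (transported_pressure q) \<le> real CARD('n)"
      using inf_sup_quotient_bound[OF fw.open_V _ pL, of v] v by (simp add: velocities_def abs_le_iff)
    also have "\<dots> \<le> comparison_const CARD('n) * 1" using comparison_const_ge by simp
    also have "\<dots> \<le> comparison_const CARD('n) * \<epsilon>"
      using False by (intro mult_left_mono) (auto simp: comparison_const_def)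
    finally show ?thesis using s0 by linarith
  qed
  then show ?thesis
    unfolding sup_quotient_def[of V] by (intro cSUP_least velocities_nonempty[OF fw.open_V ne])
qed

text \<open>An infimum is bounded above by its values at the transported pressures; nonnegativity of
  the suprema provides the lower bound that a real infimum requires.\<close>

lemma inf_sup_constant_le:
  assumes "pressures U \<noteq> {}" "U \<noteq> {}"
  shows "inf_sup_constant V \<le> inf_sup_constant U + comparison_const CARD('n) * \<epsilon>"
proof -
  have ne: "V \<noteq> {}" using \<open>U \<noteq> {}\<close> fw.F_in by blast
  have bdd: "bdd_below (sup_quotient V ` pressures V)"
    unfolding bdd_below_def
    by (rule exI[of _ 0]) (use sup_quotient_nonneg[OF fw.open_V ne pressures_L2] in auto)
  have "inf_sup_constant V - comparison_const CARD('n) * \<epsilon> \<le> inf_sup_constant U"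
    unfolding inf_sup_constant_eq[of U]
  proof (rule cINF_greatest[OF assms(1)])
    fix q assume q: "q \<in> pressures U"
    have "inf_sup_constant V \<le> sup_quotient V (transported_pressure q)"
      unfolding inf_sup_constant_eq by (rule cINF_lower[OF bdd transported_pressure(1)[OF q]])
    with sup_quotient_transported_pressure_le[OF q assms(2)]
    show "inf_sup_constant V - comparison_const CARD('n) * \<epsilon> \<le> sup_quotient U q" by linarith
  qed
  then show ?thesis by linarith
qed

lemma swap: "near_identity_pair V U G F E D C \<epsilon>"
  by unfold_locales

lemma inf_sup_constant_diff:
  assumes "U \<noteq> {}"
  shows "\<bar>inf_sup_constant U - inf_sup_constant V\<bar> \<le> comparison_const CARD('n) * \<epsilon>"
proof -
  interpret sw: near_identity_pair V U G F E D C \<epsilon> by (rule swap)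
  have ne: "V \<noteq> {}" using assms fw.F_in by blast
  show ?thesis
  proof (cases "pressures U = {}")
    \<comment> \<open>Pressures are transported in both directions, so the two sets are empty only
      together; then both constants are the infimum of the empty set and agree.\<close>
    case True
    then have "pressures V = {}" using sw.transported_pressure(1) by blast
    with True have "inf_sup_constant U = inf_sup_constant V" by (simp add: inf_sup_constant_eq)
    then show ?thesis using fw.eps_nonneg by (simp add: comparison_const_def)
  next
    case False
    then have "pressures V \<noteq> {}" using transported_pressure(1) by blast
    from inf_sup_constant_le[OF False assms] sw.inf_sup_constant_le[OF this ne] show ?thesis by linarith
  qed
qed

end

section \<open>From closeness in Lipschitz norm to near-identity maps\<close>

lemma near_identity_mapI:
  fixes U V :: "(real^'n::finite) set"
  assumes U: "open U" "bounded U" and V: "open V" "bounded V"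
    and FG: "\<And>x. x \<in> U \<Longrightarrow> F x \<in> V" "\<And>y. y \<in> V \<Longrightarrow> G y \<in> U"
      "\<And>x. x \<in> U \<Longrightarrow> G (F x) = x" "\<And>y. y \<in> V \<Longrightarrow> F (G y) = y"
    and lip: "lipschitz_on C U F" "lipschitz_on C V G" and "\<epsilon> \<ge> 0"
    and W: "F \<in> W1infty_vec U" "Linfty_op_norm U (\<lambda>x. weak_jacobian U F x - mat 1) \<le> ereal \<epsilon>"
  obtains D where "near_identity_map U V F G D C \<epsilon>"
proof -
  let ?W = "\<lambda>k j. weak_partial U j (\<lambda>y. F y $ k)"
  have "\<exists>g. has_weak_partial U j (\<lambda>y. F y $ k) g" for k j
    using W(1) by (auto simp: W1infty_vec_def W1infty_def)
  then have w: "has_weak_partial U j (\<lambda>y. F y $ k) (?W k j)" "?W k j \<in> borel_measurable (lebesgue_on U)" for k j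
    using weak_partial_AE_eq[OF U(1)] by metis+
  have Ul: "U \<in> sets lebesgue" "U \<in> sets borel" using U(1) by simp_all
  define d where "d k j = (SOME d. d \<in> borel_measurable borel \<and> (AE x in lebesgue_on U. ?W k j x = d x))" for k j
  have d: "d k j \<in> borel_measurable borel" "AE x in lebesgue_on U. ?W k j x = d k j x" for k j
  proof -
    have "\<exists>d. d \<in> borel_measurable borel \<and> (AE x in lebesgue_on U. ?W k j x = d x)"
      by (rule borel_representative[OF Ul(2) w(2)[of j k]]) blast
    from someI_ex[OF this] show "d k j \<in> borel_measurable borel" "AE x in lebesgue_on U. ?W k j x = d k j x"
      unfolding d_def by auto
  qed
  have on: "AE x in lebesgue_on U. onorm ((*v) (weak_jacobian U F x - mat 1)) \<le> \<epsilon>"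
    using esssup_AE[of "\<lambda>x. ereal (onorm ((*v) (weak_jacobian U F x - mat 1)))" "lebesgue_on U"]
  proof (rule eventually_mono)
    fix x assume "ereal (onorm ((*v) (weak_jacobian U F x - mat 1)))
      \<le> esssup (lebesgue_on U) (\<lambda>x. ereal (onorm ((*v) (weak_jacobian U F x - mat 1))))"
    with W(2) have "ereal (onorm ((*v) (weak_jacobian U F x - mat 1))) \<le> ereal \<epsilon>"
      unfolding Linfty_op_norm_def by (rule order_trans[rotated])
    then show "onorm ((*v) (weak_jacobian U F x - mat 1)) \<le> \<epsilon>" by simp
  qed
  have "AE x in lebesgue_on U. \<forall>k\<in>UNIV. \<forall>j\<in>UNIV. ?W k j x = d k j x"
    by (intro AE_finite_allI) (auto intro: d(2))
  with on have "AE x in lebesgue_on U. onorm ((*v) (weak_jacobian U F x - mat 1)) \<le> \<epsilon> \<and> (\<forall>k j. ?W k j x = d k j x)"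
    by eventually_elim auto
  \<comment> \<open>Stated over \<open>lborel\<close>, the property fails only on a Borel null set
    \<open>N\<close>, and removing a Borel set keeps \<open>D\<close> Borel measurable.\<close>
  then have "AE x in lborel. x \<in> U \<longrightarrow> onorm ((*v) (weak_jacobian U F x - mat 1)) \<le> \<epsilon> \<and> (\<forall>k j. ?W k j x = d k j x)"
    by (simp only: AE_lebesgue_on_iff[OF Ul(1)])
  then obtain N where N: "N \<in> sets lborel" "emeasure lborel N = 0"
    "{x \<in> space lborel. \<not> (x \<in> U \<longrightarrow> onorm ((*v) (weak_jacobian U F x - mat 1)) \<le> \<epsilon> \<and> (\<forall>k j. ?W k j x = d k j x))} \<subseteq> N"
    by (rule AE_E) blast
  have good: "onorm ((*v) (weak_jacobian U F x - mat 1)) \<le> \<epsilon>" "?W k j x = d k j x" if "x \<in> U - N" for x k j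
    using N(3) that by auto
  \<comment> \<open>The default value \<open>mat 1\<close> makes the difference to the identity
    vanish, so the bound holds on \<open>N\<close> and outside \<open>U\<close> as well.\<close>
  define D :: "real^'n \<Rightarrow> real^'n^'n" where "D x = (if x \<in> U - N then (\<chi> k j. d k j x) else mat 1)" for x
  have DW: "D x = weak_jacobian U F x" if "x \<in> U - N" for x
    using that good(2)[OF that] by (simp add: D_def weak_jacobian_def vec_eq_iff)
  have UN: "U - N \<in> sets borel" using N(1) Ul(2) by auto
  have Db: "(\<lambda>x. D x $ k $ j) \<in> borel_measurable borel" for k j
  proof -
    have "(\<lambda>x. if x \<in> U - N then d k j x else mat 1 $ k $ j) \<in> borel_measurable borel"
      using d(1) UN by (intro measurable_If_set) auto
    then show ?thesis by (rule back_subst[of "\<lambda>f. f \<in> borel_measurable borel"]) (auto simp: D_def fun_eq_iff)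
  qed
  have aeN: "AE x in lebesgue_on U. x \<notin> N"
  proof -
    have "AE x in lborel. x \<notin> N" by (rule AE_not_in) (use N in \<open>simp add: null_sets_def\<close>)
    then show ?thesis unfolding AE_lebesgue_on_iff[OF Ul(1)] by eventually_elim simp
  qed
  have "near_identity_map U V F G D C \<epsilon>"
  proof
    show "onorm ((*v) (D x - mat 1)) \<le> \<epsilon>" for x
    proof (cases "x \<in> U - N")
      case True
      then show ?thesis using good(1)[OF True] by (simp add: DW)
    next
      case False
      then have "(*v) (D x - mat 1) = (\<lambda>h. 0)" by (auto simp: D_def fun_eq_iff)
      then show ?thesis using \<open>\<epsilon> \<ge> 0\<close> by (simp add: onorm_zero)
    qed
    show "has_weak_partial U j (\<lambda>x. F x $ k) (\<lambda>x. D x $ k $ j)" for k j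
    proof (rule has_weak_partial_cong_AE[OF U(1) w(1)])
      show "AE x in lebesgue_on U. ?W k j x = D x $ k $ j"
      proof -
        have "AE x in lebesgue_on U. x \<in> U" by (rule AE_I2) simp
        with aeN d(2)[where k=k and j=j] show ?thesis by eventually_elim (simp add: D_def)
      qed
      show "(\<lambda>x. F x $ k) \<in> borel_measurable (lebesgue_on U)"
        by (rule has_weak_partial_measurable(1)[OF U(1) w(1)])
      show "(\<lambda>x. D x $ k $ j) \<in> borel_measurable (lebesgue_on U)"
        using Db by (simp add: borel_measurable_lebesgue_on)
    qed simp
  qed (use assms Db in auto)
  then show thesis by (rule that)
qed

theorem theorem4p4:
  shows "\<exists>c::real. \<forall>\<epsilon>>0. \<forall>\<Omega> \<Omega>' :: (real^'n::finite) set.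
           bounded_lipschitz_domain \<Omega> \<and> bounded_lipschitz_domain \<Omega>' \<and> lipschitz_close \<epsilon> \<Omega> \<Omega>' \<longrightarrow>
           \<bar>inf_sup_constant \<Omega> - inf_sup_constant \<Omega>'\<bar> \<le> c * \<epsilon>"
proof (intro exI[of _ "comparison_const CARD('n)"] allI impI)
  fix \<epsilon> :: real and \<Omega> \<Omega>' :: "(real^'n) set"
  assume "\<epsilon> > 0"
    and close: "bounded_lipschitz_domain \<Omega> \<and> bounded_lipschitz_domain \<Omega>' \<and> lipschitz_close \<epsilon> \<Omega> \<Omega>'"
  then have dom: "open \<Omega>" "bounded \<Omega>" "open \<Omega>'" "bounded \<Omega>'" "\<Omega>' \<noteq> {}"
    by (auto simp: bounded_lipschitz_domain_def is_domain_def)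
  obtain F G C1 C2 where FG: "bij_betw F \<Omega>' \<Omega>" "G = inv_into \<Omega>' F"
    and lip: "lipschitz_on C1 \<Omega>' F" "lipschitz_on C2 \<Omega> G"
    and W: "F \<in> W1infty_vec \<Omega>'" "Linfty_op_norm \<Omega>' (\<lambda>x. weak_jacobian \<Omega>' F x - mat 1) \<le> ereal \<epsilon>"
      "G \<in> W1infty_vec \<Omega>" "Linfty_op_norm \<Omega> (\<lambda>x. weak_jacobian \<Omega> G x - mat 1) \<le> ereal \<epsilon>"
    using close unfolding lipschitz_close_def by blast
  \<comment> \<open>A Lipschitz constant may be enlarged, so the maximum serves both maps, as the
    symmetric locale demands.\<close>
  define C where "C = max C1 C2"
  have lipC: "lipschitz_on C \<Omega>' F" "lipschitz_on C \<Omega> G"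
    using lip by (auto simp: C_def intro: lipschitz_on_le)
  have inv: "\<And>x. x \<in> \<Omega>' \<Longrightarrow> F x \<in> \<Omega>" "\<And>y. y \<in> \<Omega> \<Longrightarrow> G y \<in> \<Omega>'"
    "\<And>x. x \<in> \<Omega>' \<Longrightarrow> G (F x) = x" "\<And>y. y \<in> \<Omega> \<Longrightarrow> F (G y) = y"
    using FG(1) unfolding FG(2) bij_betw_def
    by (auto simp: inv_into_f_f inv_into_into f_inv_into_f)
  have e: "\<epsilon> \<ge> 0" using \<open>\<epsilon> > 0\<close> by simp
  obtain D where D: "near_identity_map \<Omega>' \<Omega> F G D C \<epsilon>"
    by (rule near_identity_mapI[OF dom(3,4,1,2) inv lipC e W(1,2)])
  obtain E where E: "near_identity_map \<Omega> \<Omega>' G F E C \<epsilon>"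
    by (rule near_identity_mapI[OF dom(1-4) inv(2,1,4,3) lipC(2,1) e W(3,4)])
  \<comment> \<open>\<open>F\<close> is defined on \<open>\<Omega>'\<close>, so
    \<open>\<Omega>'\<close> takes the role of \<open>U\<close> and \<open>\<Omega>\<close> that of
    \<open>V\<close>.\<close>
  interpret near_identity_pair \<Omega>' \<Omega> F G D E C \<epsilon>
    using D E by (rule near_identity_pair.intro)
  show "\<bar>inf_sup_constant \<Omega> - inf_sup_constant \<Omega>'\<bar> \<le> comparison_const CARD('n) * \<epsilon>"
    using inf_sup_constant_diff[OF dom(5)] by (simp add: abs_minus_commute)
qed

end
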